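(* Let $R:\mathbb{R}^n\to\mathbb{Z}^n$ be a quantizer, let $L\in\mathbb{R}^{n\times n}$ be nonsingular, and let $T=R\circ L:\mathbb{Z}^n\to\mathbb{Z}^n$. Suppose the matrix $L$ is iteratively nonresonant. Then the quantization errors $E_k$, $k\in\mathbb{N}$, of the quantized linear $(R,L)$-system are mutually independent, uniformly distributed on the set $R^{-1}(0)$ and measurable with respect to the forward algebra $\mathcal{Q}^+$. More precisely, for any $N\in\mathbb{N}$, the map $$\mathcal{E}_N=\begin{bmatrix}E_1\\ \vdots\\ E_N\end{bmatrix}:\mathbb{Z}^n\to(R^{-1}(0))^N$$ is $\mathrm{mes}_{Nn}$-distributed over the set $(R^{-1}(0))^N$, and the algebra $\mathcal{S}_{\mathcal{E}_N}$ generated by this map coincides with the algebra $\mathcal{Q}_N^+$.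
   Context: Frequency. For $a\in\mathbb{Z}^n$ and $\ell\in\mathbb{N}^n$ let $P_{a,\ell}=\{x\in\mathbb{Z}^n:\ a_k\le x_k<a_k+\ell_k \text{ for all }1\le k\le n\}$, and for $N\in\mathbb{N}$ let $\mathcal{P}_N=\{P_{a,\ell}:\ a\in\mathbb{Z}^n,\ \ell\in\mathbb{N}^n,\ \min_k\ell_k\ge N\}$. For $A\subset\mathbb{Z}^n$ put $\mathbf{F}_*(A)=\sup_{N\ge1}\inf_{P\in\mathcal{P}_N}\frac{\#(A\cap P)}{\#P}$ and $\mathbf{F}^*(A)=\inf_{N\ge1}\sup_{P\in\mathcal{P}_N}\frac{\#(A\cap P)}{\#P}$. The set $A$ is frequency measurable if $\mathbf{F}_*(A)=\mathbf{F}^*(A)$; the common value is the frequency $\mathbf{F}(A)$. Distributed maps. Let $X$ be a metric space with Borel $\sigma$-algebra $\mathcal{B}$ and $D$ a countably additive probability measure on $(X,\mathcal{B})$. A map $h:\mathbb{Z}^n\to X$ is $D$-distributed if for every $B\in\mathcal{B}$ with $D(\partial B)=0$ the preimage $h^{-1}(B)$ is frequency measurable and $\mathbf{F}(h^{-1}(B))=D(B)$. In this case the algebra generated by $h$ is $\mathcal{S}_h=\{h^{-1}(B):\ B\in\mathcal{B},\ D(\partial B)=0\}$. "$\mathrm{mes}_{Nn}$-distributed over $(R^{-1}(0))^N$" refers to $X=(R^{-1}(0))^N\subset\mathbb{R}^{Nn}$ and $D$ the restriction of the $Nn$-dimensional Lebesgue measure to $X$ (a probability measure, since $\mathrm{mes}_n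 R^{-1}(0)=1$). System. A quantizer is a map $R:\mathbb{R}^n\to\mathbb{Z}^n$ such that $R(u+z)=R(u)+z$ for all $u\in\mathbb{R}^n$, $z\in\mathbb{Z}^n$, and the set $R^{-1}(0)$ is Jordan measurable (bounded with boundary of zero Lebesgue measure). The quantization errors are the maps $E_k=E\circ T^{k-1}:\mathbb{Z}^n\to R^{-1}(0)$, $k\in\mathbb{N}$, where $E(x)=Lx-T(x)$. Algebras. For $m\in\mathbb{N}$, $G\subset\mathbb{R}^m$ and $\Lambda\in\mathbb{R}^{m\times n}$ let $Q_m(G,\Lambda)=\{x\in\mathbb{Z}^n:\ \Lambda x\in G+\mathbb{Z}^m\}$ and $\mathcal{Q}_m(\Lambda)=\{Q_m(G,\Lambda):\ G\subset[0,1)^m\text{ Jordan measurable}\}$. For $N\in\mathbb{N}$, $\mathcal{Q}_N^+=\mathcal{Q}_{Nn}(\mathcal{L}_N^+)$, where $\mathcal{L}_N^+\in\mathbb{R}^{Nn\times n}$ is obtained by stacking $L,L^2,\ldots,L^N$; the forward algebra is $\mathcal{Q}^+=\bigcup_{N\ge1}\mathcal{Q}_N^+$. Nonresonance. $\Lambda\in\mathbb{R}^{m\times n}$ is nonresonant if the rows of $\begin{bmatrix}I_n\\ \Lambda\end{bmatrix}$ are linearly independent over the rationals. A nonsingular $L$ is iteratively nonresonant if every finite submatrix (formed from finitely many rows with distinct indices) of the infinite matrix obtained by stacking all nonzero integer powers $L^k$, $k\in\mathbb{Z}\setminus\{0\}$, is nonresonant. *)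

theory Defs
  imports "HOL-Probability.Probability"
begin

section \<open>Frequency of subsets of the integer lattice\<close>

definition lattice_box :: "int^'n \<Rightarrow> nat^'n \<Rightarrow> (int^'n) set" where
  "lattice_box a l = {x. \<forall>k. a $ k \<le> x $ k \<and> x $ k < a $ k + int (l $ k)}"

definition lattice_boxes :: "nat \<Rightarrow> (int^'n) set set" where
  "lattice_boxes N = {lattice_box a l | a l. \<forall>k. N \<le> l $ k}"

definition lower_frequency :: "(int^'n) set \<Rightarrow> real" where
  "lower_frequency A =
    (SUP N\<in>{1..}. INF P\<in>lattice_boxes N. real (card (A \<inter> P)) / real (card P))"

definition upper_frequency :: "(int^'n) set \<Rightarrow> real" where
  "upper_frequency A =
    (INF N\<in>{1..}. SUP P\<in>lattice_boxes N. real (card (A \<inter> P)) / real (card P))"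

definition frequency_measurable :: "(int^'n) set \<Rightarrow> bool" where
  "frequency_measurable A \<longleftrightarrow> lower_frequency A = upper_frequency A"

text \<open>Only meaningful for frequency measurable sets.\<close>

definition frequency :: "(int^'n) set \<Rightarrow> real" where
  "frequency A = lower_frequency A"


section \<open>Distributed maps, generated algebras, independence\<close>

text \<open>
  A metric space enters these notions only through its topology, hence the metric space is
  given here as a (metrizable) topology \<open>X\<close>. In particular, boundaries are taken
  relative to \<open>X\<close>.
\<close>

definition borel_sets :: "'a topology \<Rightarrow> 'a set set" where
  "borel_sets X = sigma_sets (topspace X) {U. openin X U}"

definition distributed_map :: "'a topology \<Rightarrow> 'a measure \<Rightarrow> (int^'n \<Rightarrow> 'a) \<Rightarrow> bool" where
  "distributed_map X D h \<longleftrightarrow>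
     metrizable_space X \<and> prob_space D \<and> space D = topspace X \<and> sets D = borel_sets X \<and>
     range h \<subseteq> topspace X \<and>
     (\<forall>B\<in>borel_sets X. measure D (X frontier_of B) = 0 \<longrightarrow>
        frequency_measurable (h -` B) \<and> frequency (h -` B) = measure D B)"

definition generated_algebra ::
    "'a topology \<Rightarrow> 'a measure \<Rightarrow> (int^'n \<Rightarrow> 'a) \<Rightarrow> (int^'n) set set" where
  "generated_algebra X D h =
     {h -` B | B. B \<in> borel_sets X \<and> measure D (X frontier_of B) = 0}"

definition mutually_independent :: "'k set \<Rightarrow> ('k \<Rightarrow> (int^'n) set set) \<Rightarrow> bool" where
  "mutually_independent K \<A> \<longleftrightarrow>
     (\<forall>J A. J \<subseteq> K \<and> finite J \<and> J \<noteq> {} \<and> (\<forall>k\<in>J. A k \<in> \<A> k) \<longrightarrow>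
        (\<forall>k\<in>J. frequency_measurable (A k)) \<and>
        frequency_measurable (\<Inter>k\<in>J. A k) \<and>
        frequency (\<Inter>k\<in>J. A k) = (\<Prod>k\<in>J. frequency (A k)))"


section \<open>Euclidean spaces with a varying number of coordinates\<close>

text \<open>
  The space \<open>\<real>\<^sup>m\<close>, with \<open>m\<close> not fixed by a type, is the set
  \<open>I \<rightarrow>\<^sub>E UNIV\<close> of real families over a finite index set \<open>I\<close> with
  \<open>m\<close> elements. The product topology is that of the Euclidean metric.
\<close>

definition euclid_topology :: "'i set \<Rightarrow> ('i \<Rightarrow> real) topology" where
  "euclid_topology I = product_topology (\<lambda>_. euclideanreal) I"

definition euclid_lebesgue :: "'i set \<Rightarrow> ('i \<Rightarrow> real) measure" where
  "euclid_lebesgue I = completion (Pi\<^sub>M I (\<lambda>_. lborel))"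

definition jordan_measurable_on :: "'i set \<Rightarrow> ('i \<Rightarrow> real) set \<Rightarrow> bool" where
  "jordan_measurable_on I G \<longleftrightarrow>
     G \<subseteq> (I \<rightarrow>\<^sub>E UNIV) \<and> (\<exists>c. \<forall>y\<in>G. \<forall>i\<in>I. \<bar>y i\<bar> \<le> c) \<and>
     euclid_topology I frontier_of G \<in> null_sets (euclid_lebesgue I)"

definition jordan_measurable :: "(real^'n) set \<Rightarrow> bool" where
  "jordan_measurable S \<longleftrightarrow> bounded S \<and> negligible (frontier S)"

text \<open>
  The restriction of the measure \<open>M\<close> to the Borel subsets of the space \<open>X\<close>.
  It is applied to completed measures because \<open>X\<close> need not be Borel in the ambient
  Euclidean space.
\<close>

definition borel_restriction :: "'a topology \<Rightarrow> 'a measure \<Rightarrow> 'a measure" where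
  "borel_restriction X M = measure_of (topspace X) {U. openin X U} (emeasure M)"


section \<open>Quantized linear systems\<close>

definition real_vec :: "int^'n \<Rightarrow> real^'n" where
  "real_vec x = (\<chi> i. real_of_int (x $ i))"

definition quantizer :: "(real^'n \<Rightarrow> int^'n) \<Rightarrow> bool" where
  "quantizer R \<longleftrightarrow>
     (\<forall>u z. R (u + real_vec z) = R u + z) \<and> jordan_measurable (R -` {0})"

definition quantized_map :: "(real^'n \<Rightarrow> int^'n) \<Rightarrow> real^'n^'n \<Rightarrow> int^'n \<Rightarrow> int^'n" where
  "quantized_map R L x = R (L *v real_vec x)"

definition one_step_error :: "(real^'n \<Rightarrow> int^'n) \<Rightarrow> real^'n^'n \<Rightarrow> int^'n \<Rightarrow> real^'n" where
  "one_step_error R L x = L *v real_vec x - real_vec (quantized_map R L x)"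

text \<open>The errors are indexed by \<open>k \<ge> 1\<close>.\<close>

definition quantization_error ::
    "(real^'n \<Rightarrow> int^'n) \<Rightarrow> real^'n^'n \<Rightarrow> nat \<Rightarrow> int^'n \<Rightarrow> real^'n" where
  "quantization_error R L k = one_step_error R L \<circ> (quantized_map R L ^^ (k - 1))"

definition error_space :: "(real^'n \<Rightarrow> int^'n) \<Rightarrow> (real^'n) topology" where
  "error_space R = top_of_set (R -` {0})"

definition error_measure :: "(real^'n \<Rightarrow> int^'n) \<Rightarrow> (real^'n) measure" where
  "error_measure R = borel_restriction (error_space R) lebesgue"

text \<open>
  \<open>\<real>\<^bsup>Nn\<^esup>\<close> has the index set \<open>{1..N} \<times> UNIV\<close>; the pair \<open>(k, i)\<close>
  addresses the \<open>i\<close>-th coordinate of the \<open>k\<close>-th block.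
\<close>

definition block_index :: "nat \<Rightarrow> (nat \<times> 'n) set" where
  "block_index N = {1..N} \<times> UNIV"

definition stacked_errors ::
    "(real^'n \<Rightarrow> int^'n) \<Rightarrow> real^'n^'n \<Rightarrow> nat \<Rightarrow> int^'n \<Rightarrow> (nat \<times> 'n \<Rightarrow> real)" where
  "stacked_errors R L N x =
     (\<lambda>(k, i)\<in>block_index N. quantization_error R L k x $ i)"

definition stacked_error_space ::
    "(real^'n \<Rightarrow> int^'n) \<Rightarrow> nat \<Rightarrow> (nat \<times> 'n \<Rightarrow> real) topology" where
  "stacked_error_space R N =
     subtopology (euclid_topology (block_index N))
       {y \<in> block_index N \<rightarrow>\<^sub>E UNIV. \<forall>k\<in>{1..N}. (\<chi> i. y (k, i)) \<in> R -` {0}}"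

definition stacked_error_measure ::
    "(real^'n \<Rightarrow> int^'n) \<Rightarrow> nat \<Rightarrow> (nat \<times> 'n \<Rightarrow> real) measure" where
  "stacked_error_measure R N =
     borel_restriction (stacked_error_space R N) (euclid_lebesgue (block_index N))"


section \<open>Quasiperiodic sets and nonresonance\<close>

text \<open>
  A real matrix with rows indexed by \<open>I\<close> and \<open>n\<close> columns is given by the family
  of its rows.
\<close>

definition quasiperiodic_set ::
    "'i set \<Rightarrow> ('i \<Rightarrow> real) set \<Rightarrow> ('i \<Rightarrow> real^'n) \<Rightarrow> (int^'n) set" where
  "quasiperiodic_set I G \<Lambda> =
     {x. \<exists>g\<in>G. \<exists>z :: 'i \<Rightarrow> int. \<forall>i\<in>I. \<Lambda> i \<bullet> real_vec x = g i + real_of_int (z i)}"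

definition quasiperiodic_algebra :: "'i set \<Rightarrow> ('i \<Rightarrow> real^'n) \<Rightarrow> (int^'n) set set" where
  "quasiperiodic_algebra I \<Lambda> =
     {quasiperiodic_set I G \<Lambda> | G. G \<subseteq> (I \<rightarrow>\<^sub>E {0..<1}) \<and> jordan_measurable_on I G}"

definition matrix_power :: "real^'n^'n \<Rightarrow> nat \<Rightarrow> real^'n^'n" where
  "matrix_power L k = ((\<lambda>M. L ** M) ^^ k) (mat 1)"

definition matrix_int_power :: "real^'n^'n \<Rightarrow> int \<Rightarrow> real^'n^'n" where
  "matrix_int_power L k =
     (if 0 \<le> k then matrix_power L (nat k) else matrix_power (matrix_inv L) (nat (- k)))"

definition forward_algebra_upto :: "real^'n^'n \<Rightarrow> nat \<Rightarrow> (int^'n) set set" where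
  "forward_algebra_upto L N =
     quasiperiodic_algebra (block_index N) (\<lambda>(k, i). row i (matrix_power L k))"

definition forward_algebra :: "real^'n^'n \<Rightarrow> (int^'n) set set" where
  "forward_algebra L = (\<Union>N\<in>{1..}. forward_algebra_upto L N)"

text \<open>
  Linear independence of a family (not of the set of its values): equal rows at distinct
  indices are dependent.
\<close>

definition rationally_independent :: "'j set \<Rightarrow> ('j \<Rightarrow> real^'n) \<Rightarrow> bool" where
  "rationally_independent J v \<longleftrightarrow>
     (\<forall>c :: 'j \<Rightarrow> rat. (\<Sum>j\<in>J. of_rat (c j) *\<^sub>R v j) = 0 \<longrightarrow> (\<forall>j\<in>J. c j = 0))"

definition nonresonant :: "'i set \<Rightarrow> ('i \<Rightarrow> real^'n) \<Rightarrow> bool" where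
  "nonresonant I \<Lambda> \<longleftrightarrow>
     rationally_independent (UNIV <+> I) (case_sum (\<lambda>j. row j (mat 1 :: real^'n^'n)) \<Lambda>)"

definition iteratively_nonresonant :: "real^'n^'n \<Rightarrow> bool" where
  "iteratively_nonresonant L \<longleftrightarrow>
     (\<forall>J :: (int \<times> 'n) set. finite J \<and> J \<subseteq> (- {0}) \<times> UNIV \<longrightarrow>
        nonresonant J (\<lambda>(k, i). row i (matrix_int_power L k)))"

end

theory Submission
  imports Defs
begin

text \<open>
  Since the errors satisfy \<open>E\<^sub>k = L z\<^sub>k\<^sub>-\<^sub>1 - z\<^sub>k\<close> with \<open>z\<^sub>k = T\<^sup>k x\<close>, putting
  \<open>w\<^sub>k = L\<^sup>k x - z\<^sub>k\<close> gives \<open>E\<^sub>k = w\<^sub>k - L w\<^sub>k\<^sub>-\<^sub>1\<close> and \<open>w\<^sub>0 = 0\<close>. Conversely, as \<open>R\<^sup>-\<^sup>1(0)\<close> meets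
  every translate of the lattice in exactly one point, an integer vector \<open>z\<close> for which
  the triangular unimodular map \<open>\<Phi>: w \<mapsto> (w\<^sub>k - L w\<^sub>k\<^sub>-\<^sub>1)\<^sub>k\<close> takes \<open>(L\<^sup>k x - z\<^sub>k)\<^sub>k\<close> into
  \<open>(R\<^sup>-\<^sup>1(0))\<^sup>N\<close> is necessarily the orbit of \<open>x\<close>. Hence, for \<open>B\<close> in this set, the
  indicator of \<open>\<E>\<^sub>N \<in> B\<close> at \<open>x\<close> is the number of integer translates of
  \<open>(L x, \<dots>, L\<^sup>N x)\<close> in \<open>\<Phi>\<^sup>-\<^sup>1(B)\<close>. By nonresonance and Weyl's criterion, uniformly over
  boxes, the mean of this number is the volume of \<open>\<Phi>\<^sup>-\<^sup>1(B)\<close>, which is the volume of \<open>B\<close>.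
  Independence follows by applying this to product sets.
\<close>

section \<open>Frequencies as uniform box averages\<close>

text \<open>Weyl's criterion is used for upper bounds only. A Jordan set is bounded by its closure
  from above; from below it is controlled by the closed rest of a cube of integer side, since such a
  half-open cube is hit equally often by every translate of the lattice. The main obstacle is
  measurability. The cell \<open>error_cell R\<close> need not be Borel, so volumes are taken in the
  completed Lebesgue measure, and volume identities are proved for closure and interior and carried
  over by squeezing. For the same reason a set of \<open>forward_algebra_upto L N\<close> yields at
  once only a subset of the error space with null boundary; a Borel set with the same preimage
  exists because the errors attain only countably many values. Boundaries are relative to the error
  space. As the cell has a null boundary, null relative boundary and null ambient boundary amount to
  the same thing. That the cell has volume 1 is read off from the frequency of the whole lattice for
  N = 1. It makes the error measures probabilities and lets independence treat arbitrary finite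
  index sets, with the whole cell in the missing places.\<close>

definition box_filter :: "(int^'n) set filter" where
  "box_filter = (INF N\<in>{1..}. principal (lattice_boxes N))"

text \<open>Values in a normed space, so that complex characters and real counts share one
  notion.\<close>

definition box_average :: "(int^'n \<Rightarrow> 'a::real_normed_vector) \<Rightarrow> (int^'n) set \<Rightarrow> 'a" where
  "box_average F P = (\<Sum>x\<in>P. F x) /\<^sub>R real (card P)"

lemma lattice_boxes_mono: "M \<le> N \<Longrightarrow> lattice_boxes N \<subseteq> lattice_boxes M"
  unfolding lattice_boxes_def by (blast intro: order_trans)

lemma eventually_box_filter:
  "eventually Q box_filter \<longleftrightarrow> (\<exists>N\<ge>1. \<forall>P\<in>lattice_boxes N. Q P)"
proof -
  have *: "\<exists>x\<in>{1..}. principal (lattice_boxes x) \<le> inf (principal (lattice_boxes a)) (principal (lattice_boxes b))"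
    if "a \<in> {1..}" for a b :: nat
    using that lattice_boxes_mono[of a "max a b"] lattice_boxes_mono[of b "max a b"]
    by (intro bexI[of _ "max a b"]) auto
  show ?thesis
    unfolding box_filter_def
    by (subst eventually_INF_base) (use * in \<open>auto simp: eventually_principal Bex_def\<close>)
qed

lemma bij_betw_lattice_box:
  "bij_betw vec_lambda (PiE UNIV (\<lambda>k. {a $ k..<a $ k + int (l $ k)})) (lattice_box a l)"
  by (rule bij_betw_byWitness[where f' = vec_nth]) (auto simp: lattice_box_def)

lemma finite_lattice_box: "finite (lattice_box a l)"
  using bij_betw_finite[OF bij_betw_lattice_box, of a l] by (simp add: finite_PiE)

lemma card_lattice_box: "card (lattice_box a l) = (\<Prod>k\<in>UNIV. l $ k)"
  using bij_betw_same_card[OF bij_betw_lattice_box, of a l, symmetric] by (simp add: card_PiE)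

lemma lattice_boxes_nonempty: "lattice_boxes N \<noteq> {}"
  unfolding lattice_boxes_def by (auto intro!: exI[of _ "\<chi> k. N"])

lemma lattice_boxes_finite_pos:
  assumes "P \<in> lattice_boxes N" "1 \<le> N"
  shows "finite P" "card P > 0"
proof -
  from assms(1) obtain a l where P: "P = lattice_box a l" and l: "\<And>k. N \<le> l $ k"
    unfolding lattice_boxes_def by auto
  show "finite P" by (simp add: P finite_lattice_box)
  have "0 < l $ k" for k using l[of k] assms(2) by linarith
  then show "card P > 0" unfolding P card_lattice_box by (intro prod_pos) auto
qed

text \<open>Each infimum \<open>I N\<close> is at most each supremum \<open>S M\<close>, because
  boxes with sides at least max N M belong to both families; hence the lower frequency is at most
  the upper one. Convergence gives the opposite bounds, lower at least v and upper at most v, so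
  both equal v.\<close>

lemma frequency_eqI:
  fixes A :: "(int^'n) set"
  assumes "((\<lambda>P. real (card (A \<inter> P)) / real (card P)) \<longlongrightarrow> v) box_filter"
  shows "frequency_measurable A \<and> frequency A = v"
proof -
  define q where "q P = real (card (A \<inter> P)) / real (card P)" for P
  have q01: "0 \<le> q P \<and> q P \<le> 1" if "P \<in> lattice_boxes N" "1 \<le> N" for P N
    using lattice_boxes_finite_pos[OF that] by (auto simp: q_def divide_simps card_mono)
  have bb: "bdd_below (q ` lattice_boxes N)" and ba: "bdd_above (q ` lattice_boxes N)" if "1 \<le> N" for N
    using q01[OF _ that] by (auto intro!: bdd_belowI2[where m=0] bdd_aboveI2[where M=1])
  define I where "I N = (INF P\<in>lattice_boxes N. q P)" for N
  define S where "S N = (SUP P\<in>lattice_boxes N. q P)" for N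
  have IS: "I N \<le> S M" if "1 \<le> N" "1 \<le> M" for N M
  proof -
    obtain P :: "(int^'n) set" where P: "P \<in> lattice_boxes (max N M)" using lattice_boxes_nonempty by blast
    have "P \<in> lattice_boxes N" "P \<in> lattice_boxes M"
      using P lattice_boxes_mono[of N "max N M"] lattice_boxes_mono[of M "max N M"] by auto
    then have "I N \<le> q P" "q P \<le> S M"
      unfolding I_def S_def using that by (auto intro!: cINF_lower cSUP_upper bb ba)
    then show ?thesis by linarith
  qed
  have *: "v - e \<le> (SUP N\<in>{1..}. I N)" "(INF N\<in>{1..}. S N) \<le> v + e" if e: "e > 0" for e
  proof -
    from assms e have "eventually (\<lambda>P. dist (q P) v < e) box_filter"
      unfolding q_def tendsto_iff by auto
    then obtain N where N: "1 \<le> N" "\<And>P. P \<in> lattice_boxes N \<Longrightarrow> dist (q P) v < e"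
      unfolding eventually_box_filter by auto
    have "v - e \<le> I N"
      unfolding I_def using lattice_boxes_nonempty N(2) 
      by (intro cINF_greatest) (auto simp: dist_real_def abs_less_iff intro: less_imp_le dest!: N(2))
    also have "\<dots> \<le> (SUP N\<in>{1..}. I N)"
      using N(1) IS[of _ 1] by (intro cSUP_upper) (auto intro!: bdd_aboveI2[where M="S 1"])
    finally show "v - e \<le> (SUP N\<in>{1..}. I N)" .
    have "(INF N\<in>{1..}. S N) \<le> S N"
      using N(1) IS[of 1] by (intro cINF_lower) (auto intro!: bdd_belowI2[where m="I 1"])
    also have "\<dots> \<le> v + e"
      unfolding S_def using lattice_boxes_nonempty N(2)
      by (intro cSUP_least) (auto simp: dist_real_def abs_less_iff intro: less_imp_le dest!: N(2))
    finally show "(INF N\<in>{1..}. S N) \<le> v + e" .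
  qed
  have "v \<le> (SUP N\<in>{1..}. I N) + e" if "e > 0" for e using *(1)[OF that] by linarith
  then have "v \<le> (SUP N\<in>{1..}. I N)" by (rule field_le_epsilon)
  moreover have "(INF N\<in>{1..}. S N) \<le> v" using *(2) by (rule field_le_epsilon)
  moreover have "(SUP N\<in>{1..}. I N) \<le> (INF N\<in>{1..}. S N)"
    using IS by (intro cSUP_least cINF_greatest) auto
  ultimately have "(SUP N\<in>{1..}. I N) = v" "(INF N\<in>{1..}. S N) = v" by linarith+
  then show ?thesis
    unfolding frequency_measurable_def frequency_def lower_frequency_def upper_frequency_def
      I_def S_def q_def by simp
qed

lemma box_average_indicator:
  "finite P \<Longrightarrow> box_average (indicat_real A) P = real (card (A \<inter> P)) / real (card P)"
  by (simp add: box_average_def sum.If_cases indicator_def divide_inverse mult.commute Int_commute Collect_conj_eq)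

lemma frequency_indicatorI:
  assumes "(box_average (indicat_real A) \<longlongrightarrow> v) box_filter"
  shows "frequency_measurable A \<and> frequency A = v"
proof (rule frequency_eqI, rule Lim_transform_eventually[OF assms])
  show "\<forall>\<^sub>F P in box_filter. box_average (indicat_real A) P = real (card (A \<inter> P)) / real (card P)"
    unfolding eventually_box_filter
    by (auto intro!: exI[of _ 1] box_average_indicator lattice_boxes_finite_pos)
qed

lemma box_average_add: "box_average (\<lambda>x. F x + G x) P = box_average F P + box_average G P"
  by (simp add: box_average_def sum.distrib scaleR_add_right)

lemma box_average_sum: "box_average (\<lambda>x. \<Sum>j\<in>J. F j x) P = (\<Sum>j\<in>J. box_average (F j) P)"
  unfolding box_average_def by (subst sum.swap) (simp add: scaleR_sum_right)

lemma box_average_cmult: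
  fixes F :: "_ \<Rightarrow> 'a::real_normed_algebra"
  shows "box_average (\<lambda>x. c * F x) P = c * box_average F P"
  by (simp add: box_average_def sum_distrib_left)

lemma box_average_Re: "box_average (\<lambda>x. Re (F x)) P = Re (box_average F P)"
  by (simp add: box_average_def)

lemma box_average_mono:
  "(\<And>x. F x \<le> (G x :: real)) \<Longrightarrow> box_average F P \<le> box_average G P"
  by (simp add: box_average_def mult_left_mono sum_mono)

text \<open>Equality is only eventual: the average over an empty box is 0 by convention, so sides of
  length at least 1 are required.\<close>

lemma eventually_box_average_const:
  "eventually (\<lambda>P. box_average (\<lambda>x::int^'n. c) P = c) box_filter"
  unfolding eventually_box_filter
proof (intro exI[of _ 1] conjI ballI)
  fix P :: "(int^'n) set" assume "P \<in> lattice_boxes 1"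
  from lattice_boxes_finite_pos(2)[OF this] have "real (card P) \<noteq> 0" by linarith
  then show "box_average (\<lambda>x. c) P = c"
    by (simp add: box_average_def sum_constant_scaleR del: of_nat_eq_0_iff)
qed simp

section \<open>Geometric sums and the decay of character averages\<close>

lemma norm_sum_powers_le:
  fixes w :: complex
  assumes "norm w = 1" "w \<noteq> 1"
  shows "norm (\<Sum>t\<in>{a..<a + int m}. w powi t) \<le> 2 / norm (w - 1)"
proof -
  have w0: "w \<noteq> 0" using assms by auto
  have "(\<Sum>t\<in>{a..<a + int m}. w powi t) = (\<Sum>j<m. w powi (a + int j))"
    by (rule sum.reindex_bij_witness[of _ "\<lambda>j. a + int j" "\<lambda>t. nat (t - a)"]) auto
  also have "\<dots> = w powi a * (\<Sum>j<m. w ^ j)"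
    using w0 by (simp add: power_int_add sum_distrib_left)
  also have "(\<Sum>j<m. w ^ j) = (w ^ m - 1) / (w - 1)"
    using assms by (simp add: geometric_sum)
  finally have "norm (\<Sum>t\<in>{a..<a + int m}. w powi t) = norm (w ^ m - 1) / norm (w - 1)"
    using assms by (simp add: norm_mult norm_power_int norm_divide)
  also have "\<dots> \<le> 2 / norm (w - 1)"
    using norm_triangle_ineq4[of "w ^ m" 1] assms by (intro divide_right_mono) (auto simp: norm_power)
  finally show ?thesis .
qed

lemma cis_2pi_eq_1_iff: "cis (2 * pi * t) = 1 \<longleftrightarrow> t \<in> \<int>"
proof
  assume "cis (2 * pi * t) = 1"
  then have "cos (2 * pi * t) = 1" by (simp add: complex_eq_iff)
  then obtain k :: int where "2 * pi * t = of_int k * 2 * pi" using cos_one_2pi_int by blast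
  then have "t = of_int k" by simp
  then show "t \<in> \<int>" by simp
next
  assume "t \<in> \<int>"
  then show "cis (2 * pi * t) = 1" by (auto elim!: Ints_cases)
qed

text \<open>A character factors over the coordinates, so its sum over a box is a product of
  geometric sums. The factor in direction j is bounded by \<open>C\<close> whatever its length, the
  others by the side lengths. After division by the number of points only \<open>C\<close> over the
  side in direction j remains, uniformly in the position of the box.\<close>

theorem box_average_character:
  fixes \<theta> :: "real^'n"
  assumes "\<theta> $ j \<notin> \<int>"
  shows "(box_average (\<lambda>x. cis (2 * pi * (\<theta> \<bullet> real_vec x))) \<longlongrightarrow> 0) box_filter"
proof -
  define w where "w k = cis (2 * pi * \<theta> $ k)" for k
  have w: "norm (w k) = 1" for k by (simp add: w_def)
  have wj: "w j \<noteq> 1" using assms cis_2pi_eq_1_iff by (simp add: w_def)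
  define C where "C = 2 / norm (w j - 1)"
  have C0: "C > 0" using wj by (simp add: C_def)
  have char: "cis (2 * pi * (\<theta> \<bullet> real_vec x)) = (\<Prod>k\<in>UNIV. w k powi (x $ k))" for x
  proof -
    have "cis (2 * pi * (\<theta> \<bullet> real_vec x)) = cis (\<Sum>k\<in>UNIV. 2 * pi * \<theta> $ k * real_of_int (x $ k))"
      by (simp add: inner_vec_def real_vec_def sum_distrib_left mult.assoc)
    also have "\<dots> = (\<Prod>k\<in>UNIV. cis (2 * pi * \<theta> $ k * real_of_int (x $ k)))"
      by (simp add: cis_conv_exp sum_distrib_left exp_sum)
    also have "\<dots> = (\<Prod>k\<in>UNIV. w k powi (x $ k))"
      by (simp add: w_def Complex.DeMoivre2 cis_power_int mult.commute)
    finally show ?thesis .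
  qed
  have bound: "norm (box_average (\<lambda>x. cis (2 * pi * (\<theta> \<bullet> real_vec x))) P) \<le> C / real N"
    if P: "P \<in> lattice_boxes N" and N: "1 \<le> N" for P N
  proof -
    from P obtain a l where Pal: "P = lattice_box a l" and l: "\<And>k. N \<le> l $ k"
      unfolding lattice_boxes_def by auto
    have lpos: "l $ k > 0" for k using l[of k] N by linarith
    have "(\<Sum>x\<in>P. cis (2 * pi * (\<theta> \<bullet> real_vec x)))
        = (\<Sum>g\<in>PiE UNIV (\<lambda>k. {a $ k..<a $ k + int (l $ k)}). \<Prod>k\<in>UNIV. w k powi (g k))"
      unfolding char Pal by (subst sum.reindex_bij_betw[OF bij_betw_lattice_box, symmetric]) simp
    also have "\<dots> = (\<Prod>k\<in>UNIV. \<Sum>t\<in>{a $ k..<a $ k + int (l $ k)}. w k powi t)"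
      by (rule prod_sum_PiE[symmetric]) auto
    finally have eq: "norm (\<Sum>x\<in>P. cis (2 * pi * (\<theta> \<bullet> real_vec x)))
        = (\<Prod>k\<in>UNIV. norm (\<Sum>t\<in>{a $ k..<a $ k + int (l $ k)}. w k powi t))"
      by (simp add: prod_norm)
    have le: "norm (\<Sum>t\<in>{a $ k..<a $ k + int (l $ k)}. w k powi t) \<le> (if k = j then C else real (l $ k))" for k
    proof (cases "k = j")
      case True
      then show ?thesis using norm_sum_powers_le[OF w[of j] wj] by (simp add: C_def)
    next
      case False
      have "norm (\<Sum>t\<in>{a $ k..<a $ k + int (l $ k)}. w k powi t) \<le> real (card {a $ k..<a $ k + int (l $ k)}) * 1"
        by (intro sum_norm_bound order.refl) (auto simp: norm_power_int w intro!: sum_norm_bound)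
      then show ?thesis using False by simp
    qed
    have "norm (\<Sum>x\<in>P. cis (2 * pi * (\<theta> \<bullet> real_vec x))) \<le> (\<Prod>k\<in>UNIV. if k = j then C else real (l $ k))"
      unfolding eq by (intro prod_mono conjI le norm_ge_zero)
    also have "\<dots> = C * (\<Prod>k\<in>UNIV - {j}. real (l $ k))"
      by (subst prod.remove[of _ j]) (auto intro!: prod.cong)
    finally have "norm (box_average (\<lambda>x. cis (2 * pi * (\<theta> \<bullet> real_vec x))) P)
        \<le> C * (\<Prod>k\<in>UNIV - {j}. real (l $ k)) / (\<Prod>k\<in>UNIV. real (l $ k))"
      by (simp add: box_average_def Pal card_lattice_box divide_inverse mult.commute mult_left_mono prod_nonneg)
    also have "(\<Prod>k\<in>UNIV. real (l $ k)) = real (l $ j) * (\<Prod>k\<in>UNIV - {j}. real (l $ k))"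
      by (subst prod.remove[of _ j]) auto
    also have "C * (\<Prod>k\<in>UNIV - {j}. real (l $ k)) / \<dots> = C / real (l $ j)"
      using lpos by (simp add: prod_zero_iff)
    also have "\<dots> \<le> C / real N" using l[of j] N C0 by (intro divide_left_mono) auto
    finally show ?thesis .
  qed
  show ?thesis
    unfolding tendsto_iff
  proof (intro allI impI)
    fix e :: real assume e: "e > 0"
    obtain N :: nat where N: "C / e < real N" using reals_Archimedean2 by blast
    have N1: "N \<ge> 1" using N C0 e by (cases N) (auto simp: divide_less_0_iff)
    have "C / real N < e" using N e C0 N1 by (simp add: field_simps)
    then show "\<forall>\<^sub>F P in box_filter. dist (box_average (\<lambda>x. cis (2 * pi * (\<theta> \<bullet> real_vec x))) P) 0 < e"
      unfolding eventually_box_filter using N1 bound by (fastforce intro!: exI[of _ N])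
  qed
qed

section \<open>Trigonometric majorants of arcs\<close>

text \<open>On the unit circle the conjugate of z is its inverse, so Re z and Im z are Laurent
  polynomials in z, and so is every real polynomial in them. The factor z^m clears the negative
  powers.\<close>

lemma real_polynomial_function_circle:
  fixes q :: "complex \<Rightarrow> real"
  assumes "real_polynomial_function q"
  shows "\<exists>m p. \<forall>z. norm z = 1 \<longrightarrow> complex_of_real (q z) * z ^ m = poly p z"
  using assms
proof induction
  case (linear f)
  have f: "f z = Re z * f 1 + Im z * f \<i>" for z
  proof -
    have "z = Re z *\<^sub>R 1 + Im z *\<^sub>R \<i>" by (simp add: complex_eq_iff)
    then have "f z = f (Re z *\<^sub>R 1 + Im z *\<^sub>R \<i>)" by (rule arg_cong)
    also have "\<dots> = Re z * f 1 + Im z * f \<i>"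
      using linear by (simp add: linear_simps)
    finally show ?thesis .
  qed
  have ReIm: "complex_of_real (Re z) * z = (z\<^sup>2 + 1) / 2" "complex_of_real (Im z) * z = (z\<^sup>2 - 1) / (2 * \<i>)"
    if "norm z = 1" for z
  proof -
    have "Re z * Re z + Im z * Im z = 1"
      using that by (simp add: cmod_def power2_eq_square)
    then show "complex_of_real (Re z) * z = (z\<^sup>2 + 1) / 2" "complex_of_real (Im z) * z = (z\<^sup>2 - 1) / (2 * \<i>)"
      by (auto simp: complex_eq_iff power2_eq_square Re_divide Im_divide) (simp add: field_simps)
  qed
  \<comment> \<open>By linearity f is determined by its values at 1 and \<i>; inserting
    \<open>ReIm\<close> into z * f z gives these coefficients of 1, z and z^2.\<close>
  define P where "P = [:of_real (f 1) / 2 - of_real (f \<i>) / (2 * \<i>), 0, of_real (f 1) / 2 + of_real (f \<i>) / (2 * \<i>):]"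
  have "complex_of_real (f z) * z ^ 1 = poly P z" if "norm z = 1" for z
  proof -
    have "complex_of_real (f z) * z = of_real (f 1) * (of_real (Re z) * z) + of_real (f \<i>) * (of_real (Im z) * z)"
      by (subst f) (simp add: algebra_simps)
    also have "\<dots> = poly P z"
      unfolding ReIm[OF that] P_def by (simp add: field_simps power2_eq_square)
    finally show ?thesis by simp
  qed
  then show ?case by blast
next
  case (const c)
  show ?case by (intro exI[of _ 0] exI[of _ "[:of_real c:]"]) simp
next
  case (add f g)
  then obtain m p m' p' where "\<And>z. norm z = 1 \<Longrightarrow> of_real (f z) * z ^ m = poly p z"
    "\<And>z. norm z = 1 \<Longrightarrow> of_real (g z) * z ^ m' = poly p' z" by blast
  \<comment> \<open>The two exponents may differ; each summand is multiplied by the other's power of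
    z to reach m + m'.\<close>
  then show ?case
    by (intro exI[of _ "m + m'"] exI[of _ "p * monom 1 m' + p' * monom 1 m"])
      (auto simp: poly_monom power_add algebra_simps)
next
  case (mult f g)
  then obtain m p m' p' where "\<And>z. norm z = 1 \<Longrightarrow> of_real (f z) * z ^ m = poly p z"
    "\<And>z. norm z = 1 \<Longrightarrow> of_real (g z) * z ^ m' = poly p' z" by blast
  then have "complex_of_real (f z * g z) * z ^ (m + m') = poly (p * p') z" if "norm z = 1" for z
    using that by (simp add: power_add flip: \<open>\<And>z. norm z = 1 \<Longrightarrow> of_real (f z) * z ^ m = poly p z\<close>
      \<open>\<And>z. norm z = 1 \<Longrightarrow> of_real (g z) * z ^ m' = poly p' z\<close>)
  then show ?case by blast
qed

lemma has_integral_cis_2pi: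
  "((\<lambda>t. cis (2 * pi * real_of_int k * t)) has_integral (if k = 0 then 1 else 0)) {0..1}"
proof (cases "k = 0")
  case True
  then show ?thesis using has_integral_const_real[of "1::complex" 0 1] by simp
next
  case False
  define b where "b = 2 * pi * real_of_int k"
  have b: "b \<noteq> 0" using False by (simp add: b_def)
  have "((\<lambda>t. cis (b * t)) has_integral (cis (b * 1) / (\<i> * b) - cis (b * 0) / (\<i> * b))) {0..1}"
  proof (rule fundamental_theorem_of_calculus)
    fix t :: real
    have "((\<lambda>z. exp (\<i> * (b * z)) / (\<i> * b)) has_field_derivative exp (\<i> * (b * of_real t))) (at (of_real t))"
      using b by (auto intro!: derivative_eq_intros simp: field_simps)
    from has_vector_derivative_real_field[OF this] show "((\<lambda>t. cis (b * t) / (\<i> * b)) has_vector_derivative cis (b * t)) (at t within {0..1})"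
      by (simp add: cis_conv_exp)
  qed simp
  moreover have "cis (b * 1) = 1" using cis_2pi_eq_1_iff[of "of_int k"] by (simp add: b_def)
  ultimately show ?thesis using False by (simp add: b_def)
qed

text \<open>The tent functions \<open>g K\<close> are 1 on the closed arc, fall off with slope K in
  the distance from it, and tend to its indicator. By dominated convergence their integrals tend to
  the length w of the arc.\<close>

lemma arc_integral_majorant:
  assumes "0 \<le> w" "w \<le> 1" "0 < e"
  obtains g :: "complex \<Rightarrow> real" where "continuous_on UNIV g" "\<And>z. 0 \<le> g z"
    "\<And>t. 0 \<le> t \<Longrightarrow> t \<le> w \<Longrightarrow> 1 \<le> g (cis (2 * pi * t))"
    "integral {0..1} (\<lambda>t. g (cis (2 * pi * t))) \<le> w + e"
proof -
  define u where "u t = cis (2 * pi * t)" for t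
  have cu: "continuous_on S u" for S unfolding u_def by (intro continuous_intros)
  define A where "A = u ` {0..w}"
  have A: "closed A" "A \<noteq> {}"
    using assms cu unfolding A_def by (auto intro!: compact_imp_closed compact_continuous_image)
  define g where "g K z = max 0 (1 - real K * infdist z A)" for K :: nat and z
  have cg: "continuous_on UNIV (g K)" for K unfolding g_def by (intro continuous_intros)
  define h where "h t = indicat_real A (u t)" for t
  \<comment> \<open>The end points are left out because \<open>u\<close> identifies 0 and 1: the arc
    contains \<open>u 1\<close> even if w < 1. Two points do not affect the integral.\<close>
  have uA: "u t \<in> A \<longleftrightarrow> t \<in> {0..w}" if "t \<in> {0..1} - {0,1}" for t
  proof
    assume "u t \<in> A"
    then obtain s where s: "s \<in> {0..w}" "cis (2 * pi * t) = cis (2 * pi * s)" by (auto simp: A_def u_def)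
    have "cis (2 * pi * (t - s)) = cis (2 * pi * t) / cis (2 * pi * s)"
      by (simp add: cis_divide right_diff_distrib)
    then have "cis (2 * pi * (t - s)) = 1" using s(2) by simp
    then obtain k where k: "t - s = of_int k" unfolding cis_2pi_eq_1_iff by (auto elim: Ints_cases)
    have "\<bar>t - s\<bar> < 1" using s(1) assms that by auto
    then have "k = 0" unfolding k by linarith
    then show "t \<in> {0..w}" using k s(1) by simp
  qed (auto simp: A_def)
  have "((\<lambda>t. indicat_real {0..w} t) has_integral w) {0..1}"
  proof -
    have "((\<lambda>t. 1::real) has_integral w) {0..w}" using has_integral_const_real[of "1::real" 0 w] assms by simp
    then have "((\<lambda>t. if t \<in> {0..w} then 1::real else 0) has_integral w) {0..1}"
      by (subst has_integral_restrict) (use assms in auto)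
    then show ?thesis by (simp add: indicator_def of_bool_def)
  qed
  then have hw: "(h has_integral w) {0..1}"
    by (rule has_integral_spike_finite[of "{0,1}", rotated 2]) (auto simp: h_def indicator_def uA)
  have lim: "(\<lambda>K. integral {0..1} (\<lambda>t. g K (u t))) \<longlonglongrightarrow> integral {0..1} h"
  proof (rule dominated_convergence(2)[where h="\<lambda>_. 1"])
    show "(\<lambda>t. g K (u t)) integrable_on {0..1}" for K
      by (intro integrable_continuous_real continuous_on_compose2[OF cg cu]) auto
    show "norm (g K (u t)) \<le> 1" for K t by (simp add: g_def infdist_nonneg)
    show "(\<lambda>K. g K (u t)) \<longlonglongrightarrow> h t" for t
    proof (cases "u t \<in> A")
      case True
      then show ?thesis by (simp add: g_def h_def)
    next
      case False
      then have pos: "infdist (u t) A > 0"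
        using A in_closed_iff_infdist_zero infdist_nonneg by (metis less_eq_real_def)
      obtain K0 :: nat where K0: "1 / infdist (u t) A < real K0" using reals_Archimedean2 by blast
      have "g K (u t) = 0" if "K \<ge> K0" for K
      proof -
        have "1 / infdist (u t) A < real K" using K0 that by (meson less_le_trans of_nat_le_iff)
        then show ?thesis using pos by (simp add: g_def field_simps)
      qed
      then have "eventually (\<lambda>K. g K (u t) = 0) sequentially"
        unfolding eventually_sequentially by blast
      then show ?thesis using False by (simp add: h_def tendsto_eventually)
    qed
  qed auto
  from hw have "integral {0..1} h < w + e" using assms by (simp add: integral_unique)
  from order_tendstoD(2)[OF lim this] obtain K where K: "integral {0..1} (\<lambda>t. g K (u t)) < w + e"
    unfolding eventually_sequentially by blast
  show thesis
  proof (rule that[OF cg[of K]])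
    show "0 \<le> g K z" for z by (simp add: g_def)
    show "1 \<le> g K (cis (2 * pi * t))" if "0 \<le> t" "t \<le> w" for t
    proof -
      have "u t \<in> A" using that by (auto simp: A_def)
      then show ?thesis by (simp add: g_def u_def)
    qed
    show "integral {0..1} (\<lambda>t. g K (cis (2 * pi * t))) \<le> w + e" using K by (simp add: u_def)
  qed
qed

text \<open>One third of e is the excess of the integral of the tent over w. Stone-Weierstrass
  replaces the tent by a polynomial within another third on the circle, and adding e/3 keeps the
  result above the tent. The coefficient \<open>c 0\<close> is the integral of the majorant, which
  is why it is close to w.\<close>

lemma arc_trigonometric_majorant:
  assumes "0 \<le> w" "w \<le> 1" "0 < e"
  obtains J :: "int set" and c :: "int \<Rightarrow> complex" and p :: "real \<Rightarrow> real" and r :: real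
  where "finite J" "0 \<in> J" "\<And>t. complex_of_real (p t) = (\<Sum>k\<in>J. c k * cis (2 * pi * real_of_int k * t))"
    "\<And>t. 0 \<le> p t" "\<And>t z. 0 \<le> t - real_of_int z \<Longrightarrow> t - real_of_int z \<le> w \<Longrightarrow> 1 \<le> p t"
    "c 0 = of_real r" "0 \<le> r" "r \<le> w + e"
proof -
  have e3: "0 < e / 3" using assms by simp
  obtain g :: "complex \<Rightarrow> real" where g: "continuous_on UNIV g" "\<And>z. 0 \<le> g z"
    "\<And>t. 0 \<le> t \<Longrightarrow> t \<le> w \<Longrightarrow> 1 \<le> g (cis (2 * pi * t))"
    "integral {0..1} (\<lambda>t. g (cis (2 * pi * t))) \<le> w + e / 3"
    using arc_integral_majorant[OF assms(1,2) e3] by blast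
  obtain q :: "complex \<Rightarrow> real" where q: "real_polynomial_function q" "\<And>z. z \<in> sphere 0 1 \<Longrightarrow> \<bar>g z - q z\<bar> < e / 3"
    by (rule Stone_Weierstrass_real_polynomial_function[of "sphere 0 1" g "e/3"])
      (use continuous_on_subset[OF g(1)] e3 in auto)
  have "real_polynomial_function (\<lambda>z. q z + e / 3)" using q(1) by auto
  then obtain m P where P: "\<And>z. norm z = 1 \<Longrightarrow> complex_of_real (q z + e / 3) * z ^ m = poly P z"
    using real_polynomial_function_circle by blast
  define p where "p t = q (cis (2 * pi * t)) + e / 3" for t
  have pg: "g (cis (2 * pi * t)) \<le> p t" "p t \<le> g (cis (2 * pi * t)) + 2 * e / 3" for t
    using q(2)[of "cis (2 * pi * t)"] unfolding p_def by (simp_all add: abs_if field_simps split: if_splits)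
  have per: "cis (2 * pi * (t - real_of_int z)) = cis (2 * pi * t)" for t z
    using cis_2pi_eq_1_iff[of "real_of_int z"] by (simp add: right_diff_distrib flip: cis_divide)
  \<comment> \<open>\<open>P\<close> divided by z^m has exponents from - m to the degree of
    \<open>P\<close>, and the coefficient of frequency k sits at position k + m.\<close>
  define J where "J = {- int m..int (degree P)}"
  define c where "c k = coeff P (nat (k + int m))" for k
  have pJ: "complex_of_real (p t) = (\<Sum>k\<in>J. c k * cis (2 * pi * real_of_int k * t))" for t
  proof -
    define z where "z = cis (2 * pi * t)"
    have z: "z \<noteq> 0" "norm z = 1" by (auto simp: z_def)
    have "complex_of_real (p t) = poly P z / z ^ m"
      using P[OF z(2)] z(1) by (simp add: p_def z_def field_simps)
    also have "\<dots> = (\<Sum>j\<le>degree P. coeff P j * z powi (int j - int m))"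
      using z(1) by (simp add: poly_altdef sum_divide_distrib power_int_diff)
    also have "\<dots> = (\<Sum>j\<le>m + degree P. coeff P j * z powi (int j - int m))"
      by (rule sum.mono_neutral_left) (auto simp: coeff_eq_0)
    also have "\<dots> = (\<Sum>k\<in>J. c k * z powi k)"
      by (rule sum.reindex_bij_witness[of _ "\<lambda>k. nat (k + int m)" "\<lambda>j. int j - int m"])
        (auto simp: J_def c_def)
    finally show ?thesis by (simp add: z_def cis_power_int mult.commute mult.left_commute)
  qed
  have "((\<lambda>t. complex_of_real (p t)) has_integral (\<Sum>k\<in>J. c k * (if k = 0 then 1 else 0))) {0..1}"
    unfolding pJ by (intro has_integral_sum has_integral_mult_right has_integral_cis_2pi) (auto simp: J_def)
  also have "(\<Sum>k\<in>J. c k * (if k = 0 then 1 else 0)) = c 0"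
    by (simp add: J_def if_distrib cong: if_cong)
  finally have int: "((\<lambda>t. complex_of_real (p t)) has_integral c 0) {0..1}" .
  from has_integral_linear[OF this bounded_linear_Re] have re: "(p has_integral Re (c 0)) {0..1}" by (simp add: o_def)
  \<comment> \<open>\<open>p\<close> is real, so the imaginary part of its integral vanishes and
    \<open>c 0\<close> is real.\<close>
  from has_integral_linear[OF int bounded_linear_Im] have "((\<lambda>t. 0::real) has_integral Im (c 0)) {0..1}" by (simp add: o_def)
  then have im: "Im (c 0) = 0" by (simp add: has_integral_0_eq)
  have p0: "0 \<le> p t" for t using pg(1)[of t] g(2) order_trans by blast
  have "(\<lambda>t. g (cis (2 * pi * t))) integrable_on {0..1}"
    by (intro integrable_continuous_real continuous_on_compose2[OF g(1)] continuous_intros) auto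
  then have "((\<lambda>t. g (cis (2 * pi * t)) + 2 * e / 3) has_integral (integral {0..1} (\<lambda>t. g (cis (2 * pi * t))) + 2 * e / 3)) {0..1}"
    using has_integral_const_real[of "2 * e / 3" 0 1] by (intro has_integral_add integrable_integral) simp_all
  from has_integral_le[OF re this] have "Re (c 0) \<le> w + e" using pg(2) g(4) by simp
  moreover have "0 \<le> Re (c 0)" using has_integral_nonneg[OF re] p0 by simp
  ultimately show thesis
  proof (intro that[of J p c "Re (c 0)"])
    show "1 \<le> p t" if "0 \<le> t - real_of_int z" "t - real_of_int z \<le> w" for t z
      using g(3)[OF that] pg(1)[of t] by (simp add: per)
  qed (use p0 pJ im in \<open>auto simp: J_def complex_eq_iff\<close>)
qed

section \<open>Equidistribution modulo one\<close>

text \<open>The points of v + \<int>^I lying in B, encoded by their integer shifts. Their number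
  \<open>hit_count\<close> is the periodization of the indicator of B, a function on the torus; B
  may exceed a unit cube, so values above 1 occur.\<close>

definition lattice_hits :: "'i set \<Rightarrow> ('i \<Rightarrow> real) set \<Rightarrow> ('i \<Rightarrow> real) \<Rightarrow> ('i \<Rightarrow> int) set" where
  "lattice_hits I B v = {z \<in> I \<rightarrow>\<^sub>E UNIV. (\<lambda>i\<in>I. v i - real_of_int (z i)) \<in> B}"

definition hit_count :: "'i set \<Rightarrow> ('i \<Rightarrow> real) set \<Rightarrow> ('i \<Rightarrow> real) \<Rightarrow> real" where
  "hit_count I B v = real (card (lattice_hits I B v))"

lemma finite_lattice_hits:
  assumes "finite I" "\<forall>y\<in>B. \<forall>i\<in>I. \<bar>y i\<bar> \<le> c"
  shows "finite (lattice_hits I B v)"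
proof (rule finite_subset)
  show "lattice_hits I B v \<subseteq> PiE I (\<lambda>i. {\<lfloor>v i - c\<rfloor>..\<lceil>v i + c\<rceil>})"
  proof
    fix z assume z: "z \<in> lattice_hits I B v"
    have "z i \<in> {\<lfloor>v i - c\<rfloor>..\<lceil>v i + c\<rceil>}" if "i \<in> I" for i
    proof -
      have "\<bar>v i - real_of_int (z i)\<bar> \<le> c"
        using assms(2) z that by (fastforce simp: lattice_hits_def)
      then have "v i - c \<le> z i" "z i \<le> v i + c" by linarith+
      then show ?thesis by (auto simp: floor_le_iff le_ceiling_iff)
    qed
    then show "z \<in> PiE I (\<lambda>i. {\<lfloor>v i - c\<rfloor>..\<lceil>v i + c\<rceil>})"
      using z by (auto simp: lattice_hits_def)
  qed
qed (use assms in \<open>auto intro!: finite_PiE\<close>)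

text \<open>The bound on the larger set matters, since \<open>card\<close> is 0 on infinite
  sets.\<close>

lemma hit_count_mono:
  assumes "finite I" "B \<subseteq> C" "\<forall>y\<in>C. \<forall>i\<in>I. \<bar>y i\<bar> \<le> c"
  shows "hit_count I B v \<le> hit_count I C v"
  unfolding hit_count_def of_nat_le_iff using assms
  by (intro card_mono finite_lattice_hits[of I C c]) (auto simp: lattice_hits_def)

lemma hit_count_UN_le:
  assumes "finite J"
  shows "hit_count I (\<Union>j\<in>J. B j) v \<le> (\<Sum>j\<in>J. hit_count I (B j) v)"
proof -
  have "lattice_hits I (\<Union>j\<in>J. B j) v = (\<Union>j\<in>J. lattice_hits I (B j) v)"
    by (auto simp: lattice_hits_def)
  then show ?thesis
    unfolding hit_count_def using card_UN_le[OF assms, of "\<lambda>j. lattice_hits I (B j) v"]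
    by (simp flip: of_nat_sum)
qed

lemma hit_count_Un_le: "hit_count I (B \<union> C) v \<le> hit_count I B v + hit_count I C v"
proof -
  have "lattice_hits I (B \<union> C) v = lattice_hits I B v \<union> lattice_hits I C v"
    by (auto simp: lattice_hits_def)
  then show ?thesis
    unfolding hit_count_def using card_Un_le by (simp flip: of_nat_add)
qed

lemma hit_count_PiE:
  assumes "finite I"
  shows "hit_count I (PiE I A) v = (\<Prod>i\<in>I. real (card {z. v i - real_of_int z \<in> A i}))"
proof -
  have "lattice_hits I (PiE I A) v = PiE I (\<lambda>i. {z. v i - real_of_int z \<in> A i})"
    by (auto simp: lattice_hits_def PiE_iff extensional_def)
  then show ?thesis using assms by (simp add: hit_count_def card_PiE)
qed

text \<open>With a half-open interval of integer length the count does not depend on t. This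
  exactness later converts upper bounds for a complement into lower bounds.\<close>

lemma card_int_translates:
  "finite {z. t - real_of_int z \<in> {a..<a + real n}}"
  "card {z. t - real_of_int z \<in> {a..<a + real n}} = n"
proof -
  have "{z. t - real_of_int z \<in> {a..<a + real n}} = {\<lfloor>t - a\<rfloor> - int n<..\<lfloor>t - a\<rfloor>}"
    by (auto simp: le_floor_iff floor_less_iff) (linarith | simp add: algebra_simps floor_less_iff)+
  then show "finite {z. t - real_of_int z \<in> {a..<a + real n}}"
    "card {z. t - real_of_int z \<in> {a..<a + real n}} = n" by simp_all
qed

text \<open>The hypothesis of Weyl's criterion: every nontrivial character of the torus, composed
  with x \<mapsto> \<Lambda> x, is nontrivial on the integer lattice.\<close>

definition torus_free :: "'i set \<Rightarrow> ('i \<Rightarrow> real^'n) \<Rightarrow> bool" where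
  "torus_free I \<Lambda> \<longleftrightarrow>
     (\<forall>g :: 'i \<Rightarrow> int. (\<exists>i\<in>I. g i \<noteq> 0) \<longrightarrow> (\<exists>j. (\<Sum>i\<in>I. real_of_int (g i) *\<^sub>R \<Lambda> i) $ j \<notin> \<int>))"

text \<open>The product of shifted one-dimensional majorants dominates the count for the cube.
  Expanded, it is a finite sum of characters of which all but the zero frequency average to 0, so
  its averages tend to r ^ card I, where r is the mean of the one-dimensional majorant.\<close>

theorem box_average_cube_le:
  fixes \<Lambda> :: "'i \<Rightarrow> real^'n"
  assumes "finite I" "torus_free I \<Lambda>" "0 \<le> w" "w \<le> 1" "0 < e"
  shows "eventually (\<lambda>P. box_average
    (\<lambda>x. hit_count I (PiE I (\<lambda>i. {a i..<a i + w})) (\<lambda>i. \<Lambda> i \<bullet> real_vec x)) P \<le> w ^ card I + e) box_filter"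
proof -
  \<comment> \<open>Continuity of s \<mapsto> (w + s) ^ card I at 0 determines the tolerance e'
    allowed to a single factor.\<close>
  have "((\<lambda>s. (w + s) ^ card I) \<longlongrightarrow> (w + 0) ^ card I) (at_right 0)" by (intro tendsto_intros)
  from order_tendstoD(2)[OF this, of "w ^ card I + e"] assms(5)
  have "eventually (\<lambda>s. (w + s) ^ card I < w ^ card I + e) (at_right 0)" by simp
  then obtain b where b: "b > 0" "\<And>s. 0 < s \<Longrightarrow> s < b \<Longrightarrow> (w + s) ^ card I < w ^ card I + e"
    unfolding eventually_at_right_field by blast
  define e' where "e' = b / 2"
  have e': "e' > 0" "(w + e') ^ card I < w ^ card I + e" using b by (auto simp: e'_def)
  obtain J :: "int set" and c :: "int \<Rightarrow> complex" and p :: "real \<Rightarrow> real" and r :: real where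
    J: "finite J" "0 \<in> J" and p: "\<And>t. complex_of_real (p t) = (\<Sum>k\<in>J. c k * cis (2 * pi * real_of_int k * t))"
    "\<And>t. 0 \<le> p t" and p1: "\<And>t z. 0 \<le> t - real_of_int z \<Longrightarrow> t - real_of_int z \<le> w \<Longrightarrow> 1 \<le> p t"
    and r: "c 0 = of_real r" "0 \<le> r" "r \<le> w + e'"
    by (rule arc_trigonometric_majorant[OF assms(3,4) e'(1)], rule that, assumption+)
  define v where "v x i = \<Lambda> i \<bullet> real_vec x" for x :: "int^'n" and i
  define C where "C g = (\<Prod>i\<in>I. c (g i) * cis (2 * pi * (- (real_of_int (g i) * a i))))" for g
  define \<theta> where "\<theta> g = (\<Sum>i\<in>I. real_of_int (g i) *\<^sub>R \<Lambda> i)" for g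
  have expand: "complex_of_real (\<Prod>i\<in>I. p (v x i - a i))
      = (\<Sum>g\<in>PiE I (\<lambda>_. J). C g * cis (2 * pi * (\<theta> g \<bullet> real_vec x)))" for x
  proof -
    have "complex_of_real (\<Prod>i\<in>I. p (v x i - a i))
        = (\<Prod>i\<in>I. \<Sum>k\<in>J. c k * cis (2 * pi * real_of_int k * (v x i - a i)))"
      by (simp add: p)
    also have "\<dots> = (\<Sum>g\<in>PiE I (\<lambda>_. J). \<Prod>i\<in>I. c (g i) * cis (2 * pi * real_of_int (g i) * (v x i - a i)))"
      using assms J by (intro prod_sum_PiE) auto
    also have "\<dots> = (\<Sum>g\<in>PiE I (\<lambda>_. J). C g * cis (2 * pi * (\<theta> g \<bullet> real_vec x)))"
    proof (rule sum.cong[OF refl])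
      fix g
      have "(\<Prod>i\<in>I. c (g i) * cis (2 * pi * real_of_int (g i) * (v x i - a i)))
          = (\<Prod>i\<in>I. (c (g i) * cis (2 * pi * (- (real_of_int (g i) * a i)))) * cis (2 * pi * (real_of_int (g i) * v x i)))"
        by (intro prod.cong refl) (simp add: cis_mult algebra_simps)
      also have "\<dots> = C g * (\<Prod>i\<in>I. cis (2 * pi * (real_of_int (g i) * v x i)))"
        by (simp add: prod.distrib C_def)
      also have "(\<Prod>i\<in>I. cis (2 * pi * (real_of_int (g i) * v x i))) = cis (\<Sum>i\<in>I. 2 * pi * (real_of_int (g i) * v x i))"
        using assms(1) by (simp add: cis_conv_exp sum_distrib_left exp_sum)
      also have "(\<Sum>i\<in>I. 2 * pi * (real_of_int (g i) * v x i)) = 2 * pi * (\<theta> g \<bullet> real_vec x)"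
        by (simp add: \<theta>_def v_def inner_sum_left sum_distrib_left)
      finally show "(\<Prod>i\<in>I. c (g i) * cis (2 * pi * real_of_int (g i) * (v x i - a i)))
          = C g * cis (2 * pi * (\<theta> g \<bullet> real_vec x))" .
    qed
    finally show ?thesis .
  qed
  \<comment> \<open>The zero frequency, in the extensional form in which it occurs in the index set
    of the sum.\<close>
  define g0 :: "'i \<Rightarrow> int" where "g0 = (\<lambda>i\<in>I. 0)"
  have lim1: "(box_average (\<lambda>x. cis (2 * pi * (\<theta> g \<bullet> real_vec x))) \<longlongrightarrow> (if g = g0 then 1 else 0)) box_filter"
    if "g \<in> PiE I (\<lambda>_. J)" for g
  proof (cases "g = g0")
    case True
    then have "\<theta> g = 0" by (simp add: \<theta>_def g0_def)
    then show ?thesis using True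
      by (simp add: tendsto_eventually eventually_box_average_const)
  next
    case False
    then have "\<exists>i\<in>I. g i \<noteq> 0" using that unfolding g0_def by (metis PiE_restrict restrict_ext)
    then show ?thesis
      using False assms(2) box_average_character[of "\<theta> g"] unfolding torus_free_def \<theta>_def by auto
  qed
  have "(box_average (\<lambda>x. complex_of_real (\<Prod>i\<in>I. p (v x i - a i)))
      \<longlongrightarrow> (\<Sum>g\<in>PiE I (\<lambda>_. J). C g * (if g = g0 then 1 else 0))) box_filter"
    unfolding expand box_average_sum box_average_cmult
    by (intro tendsto_sum tendsto_mult_left lim1)
  also have "(\<Sum>g\<in>PiE I (\<lambda>_. J). C g * (if g = g0 then 1 else 0)) = C g0"
  proof -
    have "g0 \<in> PiE I (\<lambda>_. J)" using J by (simp add: g0_def)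
    then show ?thesis
      using assms(1) J by (simp add: if_distrib finite_PiE sum.delta cong: if_cong)
  qed
  also have "C g0 = of_real (r ^ card I)" by (simp add: C_def g0_def r)
  finally have "((\<lambda>P. Re (box_average (\<lambda>x. complex_of_real (\<Prod>i\<in>I. p (v x i - a i))) P)) \<longlongrightarrow> Re (of_real (r ^ card I))) box_filter"
    by (rule tendsto_Re)
  then have "(box_average (\<lambda>x. \<Prod>i\<in>I. p (v x i - a i)) \<longlongrightarrow> r ^ card I) box_filter"
    by (simp flip: box_average_Re of_real_prod)
  moreover have "r ^ card I < w ^ card I + e"
    using power_mono[OF r(3,2), of "card I"] e'(2) by linarith
  ultimately have "eventually (\<lambda>P. box_average (\<lambda>x. \<Prod>i\<in>I. p (v x i - a i)) P < w ^ card I + e) box_filter"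
    by (rule order_tendstoD(2))
  moreover have "hit_count I (PiE I (\<lambda>i. {a i..<a i + w})) (v x) \<le> (\<Prod>i\<in>I. p (v x i - a i))" for x
    unfolding hit_count_PiE[OF assms(1)]
  proof (intro prod_mono conjI)
    fix i
    let ?Z = "{z. v x i - real_of_int z \<in> {a i..<a i + w}}"
    \<comment> \<open>As w \<le> 1, at most one integer translate falls into the side of the cube,
      and \<open>p\<close> is at least 1 if one does.\<close>
    have "?Z \<subseteq> {z. v x i - real_of_int z \<in> {a i..<a i + real 1}}" using assms(4) by auto
    from card_mono[OF card_int_translates(1) this] have "card ?Z \<le> 1"
      unfolding card_int_translates(2) .
    show "real (card ?Z) \<le> p (v x i - a i)"
    proof (cases "?Z = {}")
      case True
      show ?thesis by (simp only: True card.empty of_nat_0 p(2))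
    next
      case False
      then obtain z where "v x i - real_of_int z \<in> {a i..<a i + w}" by blast
      then have "1 \<le> p (v x i - a i)" by (intro p1[of _ z]) (auto simp: algebra_simps)
      then show ?thesis using \<open>card ?Z \<le> 1\<close> by linarith
    qed
  qed simp
  ultimately show ?thesis
    unfolding v_def
    by (elim eventually_mono) (rule order_trans[OF box_average_mono less_imp_le])
qed

section \<open>Closed sets in finite products of lines and their grid approximations\<close>

lemma topspace_euclid_topology: "topspace (euclid_topology I) = (I \<rightarrow>\<^sub>E UNIV)"
  by (simp add: euclid_topology_def)

lemma openin_euclid_topology_ball:
  assumes "finite I" "openin (euclid_topology I) U" "y \<in> U"
  obtains e where "e > 0" "\<And>y'. y' \<in> (I \<rightarrow>\<^sub>E UNIV) \<Longrightarrow> (\<And>i. i \<in> I \<Longrightarrow> \<bar>y' i - y i\<bar> < e) \<Longrightarrow> y' \<in> U"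
proof -
  obtain V where V: "\<forall>i\<in>I. openin euclideanreal (V i)" "y \<in> PiE I V" "PiE I V \<subseteq> U"
    using bspec[OF assms(2)[unfolded euclid_topology_def openin_product_topology_alt] assms(3)] by blast
  have openV: "open (V i)" if "i \<in> I" for i 
    by (rule iffD2[OF open_openin]) (rule bspec[OF V(1) that])
  have "\<exists>e>0. \<forall>t. \<bar>t - y i\<bar> < e \<longrightarrow> t \<in> V i" if "i \<in> I" for i
  proof -
    have "y i \<in> V i" using V(2) that by auto
    with openV[OF that] show ?thesis unfolding open_dist dist_real_def by blast
  qed
  then obtain e where e: "\<And>i. i \<in> I \<Longrightarrow> e i > 0" "\<And>i t. i \<in> I \<Longrightarrow> \<bar>t - y i\<bar> < e i \<Longrightarrow> t \<in> V i"
    by metis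
  \<comment> \<open>The inserted 1 gives \<open>Min\<close> a nonempty set when I is empty.\<close>
  define d where "d = Min (insert 1 (e ` I))"
  have d: "d > 0" "\<And>i. i \<in> I \<Longrightarrow> d \<le> e i" using assms(1) e(1) by (auto simp: d_def)
  show thesis
  proof (rule that[OF d(1)])
    fix y' assume y': "y' \<in> (I \<rightarrow>\<^sub>E UNIV)" "\<And>i. i \<in> I \<Longrightarrow> \<bar>y' i - y i\<bar> < d"
    have "y' i \<in> V i" if "i \<in> I" for i
      using e(2)[OF that] y'(2)[OF that] d(2)[OF that] by fastforce
    then have "y' \<in> PiE I V" using y'(1) by auto
    then show "y' \<in> U" using V(3) by blast
  qed
qed

lemma closedin_euclid_topology_PiE:
  "(\<And>i. i \<in> I \<Longrightarrow> closed (A i)) \<Longrightarrow> closedin (euclid_topology I) (PiE I A)"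
  by (simp add: euclid_topology_def closedin_product_topology)

definition grid_index :: "'i set \<Rightarrow> nat \<Rightarrow> ('i \<Rightarrow> real) \<Rightarrow> ('i \<Rightarrow> int)" where
  "grid_index I M y = (\<lambda>i\<in>I. \<lfloor>real M * y i\<rfloor>)"

definition grid_cell :: "'i set \<Rightarrow> nat \<Rightarrow> ('i \<Rightarrow> int) \<Rightarrow> ('i \<Rightarrow> real) set" where
  "grid_cell I M m = PiE I (\<lambda>i. {real_of_int (m i) / real M..<real_of_int (m i) / real M + 1 / real M})"

text \<open>The outer approximation of F by the half-open cells of mesh 1/M that meet it. The cells
  are disjoint, and the estimate for cubes applies to each of them.\<close>

definition grid_hull :: "'i set \<Rightarrow> nat \<Rightarrow> ('i \<Rightarrow> real) set \<Rightarrow> ('i \<Rightarrow> real) set" where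
  "grid_hull I M F = (\<Union>m\<in>grid_index I M ` F. grid_cell I M m)"

lemma in_grid_cell_iff:
  assumes "0 < M" "m \<in> I \<rightarrow>\<^sub>E UNIV"
  shows "y \<in> grid_cell I M m \<longleftrightarrow> y \<in> (I \<rightarrow>\<^sub>E UNIV) \<and> grid_index I M y = m"
proof -
  have "real_of_int k / real M \<le> t \<and> t < real_of_int k / real M + 1 / real M \<longleftrightarrow> \<lfloor>real M * t\<rfloor> = k" for k t
    using assms(1) by (simp add: floor_eq_iff field_simps)
  then have "y \<in> grid_cell I M m \<longleftrightarrow> y \<in> (I \<rightarrow>\<^sub>E UNIV) \<and> (\<forall>i\<in>I. \<lfloor>real M * y i\<rfloor> = m i)"
    unfolding grid_cell_def PiE_iff atLeastLessThan_iff by auto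
  also have "\<dots> \<longleftrightarrow> y \<in> (I \<rightarrow>\<^sub>E UNIV) \<and> grid_index I M y = m"
    using assms(2) by (auto simp: grid_index_def fun_eq_iff PiE_iff extensional_def)
  finally show ?thesis .
qed

lemma grid_index_PiE: "grid_index I M y \<in> I \<rightarrow>\<^sub>E UNIV"
  by (simp add: grid_index_def)

lemma in_grid_hull_iff:
  assumes "0 < M"
  shows "y \<in> grid_hull I M F \<longleftrightarrow> y \<in> (I \<rightarrow>\<^sub>E UNIV) \<and> (\<exists>y'\<in>F. grid_index I M y' = grid_index I M y)"
proof -
  have "y \<in> grid_hull I M F \<longleftrightarrow> (\<exists>y'\<in>F. y \<in> grid_cell I M (grid_index I M y'))"
    unfolding grid_hull_def by blast
  also have "\<dots> \<longleftrightarrow> (\<exists>y'\<in>F. y \<in> (I \<rightarrow>\<^sub>E UNIV) \<and> grid_index I M y = grid_index I M y')"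
    unfolding in_grid_cell_iff[OF assms grid_index_PiE] ..
  also have "\<dots> \<longleftrightarrow> y \<in> (I \<rightarrow>\<^sub>E UNIV) \<and> (\<exists>y'\<in>F. grid_index I M y' = grid_index I M y)"
    unfolding eq_commute[of "grid_index I M y"] by blast
  finally show ?thesis .
qed

lemma grid_index_eq_imp_dist:
  assumes "0 < M" "i \<in> I" "grid_index I M y' = grid_index I M y"
  shows "\<bar>y' i - y i\<bar> < 1 / real M"
proof -
  have "\<lfloor>real M * y' i\<rfloor> = \<lfloor>real M * y i\<rfloor>"
    using fun_cong[OF assms(3), of i] assms(2) by (simp add: grid_index_def)
  then have "\<bar>real M * y' i - real M * y i\<bar> < 1" by linarith
  also have "real M * y' i - real M * y i = real M * (y' i - y i)" by (simp add: algebra_simps)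
  finally have "real M * \<bar>y' i - y i\<bar> < 1" by (simp add: abs_mult)
  then show ?thesis using assms(1) by (simp add: field_simps)
qed

text \<open>A point outside a closed set keeps some sup-norm distance e from it, whereas points
  sharing a cell differ by less than 1/M; the hull misses the point once 1/M < e.\<close>

lemma closedin_grid_hull_separate:
  assumes "finite I" "closedin (euclid_topology I) F" "y \<notin> F"
  obtains M0 where "0 < M0" "\<And>M. M0 \<le> M \<Longrightarrow> y \<notin> grid_hull I M F"
proof (cases "y \<in> (I \<rightarrow>\<^sub>E UNIV)")
  case True
  have "openin (euclid_topology I) ((I \<rightarrow>\<^sub>E UNIV) - F)"
    using assms(2) by (simp add: closedin_def topspace_euclid_topology)
  from openin_euclid_topology_ball[OF assms(1) this, of y]
  obtain e where e: "e > 0" "\<And>y'. y' \<in> (I \<rightarrow>\<^sub>E UNIV) \<Longrightarrow> (\<And>i. i \<in> I \<Longrightarrow> \<bar>y' i - y i\<bar> < e) \<Longrightarrow> y' \<notin> F"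
    using True assms(3) by (metis DiffD2 DiffI)
  obtain M0 :: nat where M0: "1 / e < real M0" using reals_Archimedean2 by blast
  have M0pos: "0 < M0" using M0 e(1) by (cases M0) (auto simp: divide_less_0_iff)
  show thesis
  proof (rule that[OF M0pos])
    fix M assume M: "M0 \<le> M"
    have Mpos: "0 < M" using M M0pos by simp
    have "1 / e < real M" using M M0 by linarith
    then have Me: "1 / real M < e" using e(1) Mpos by (simp add: field_simps)
    show "y \<notin> grid_hull I M F"
    proof
      assume "y \<in> grid_hull I M F"
      then obtain y' where y': "y' \<in> F" "grid_index I M y' = grid_index I M y"
        unfolding in_grid_hull_iff[OF Mpos] by blast
      have "\<bar>y' i - y i\<bar> < e" if "i \<in> I" for i
        using grid_index_eq_imp_dist[OF Mpos that y'(2)] Me by linarith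
      moreover have "y' \<in> (I \<rightarrow>\<^sub>E UNIV)"
        using y'(1) closedin_subset[OF assms(2)] by (auto simp: topspace_euclid_topology)
      ultimately show False using e(2) y'(1) by blast
    qed
  qed
next
  case False
  then show thesis by (intro that[of 1]) (auto simp: in_grid_hull_iff)
qed

lemma subset_grid_hull: "0 < M \<Longrightarrow> F \<subseteq> (I \<rightarrow>\<^sub>E UNIV) \<Longrightarrow> F \<subseteq> grid_hull I M F"
  by (intro subsetI) (use in_grid_hull_iff[of M _ I F] in blast)

lemma sets_grid_cell: "finite I \<Longrightarrow> grid_cell I M m \<in> sets (Pi\<^sub>M I (\<lambda>_. lborel))"
  unfolding grid_cell_def by (rule sets_PiM_I_finite) auto

lemma sets_grid_hull:
  assumes "finite I"
  shows "grid_hull I M F \<in> sets (Pi\<^sub>M I (\<lambda>_. lborel))"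
  unfolding grid_hull_def
proof (rule sets.countable_UN'')
  have "countable (PiE I (\<lambda>_. UNIV :: int set))" using assms by (intro countable_PiE) auto
  then show "countable (grid_index I M ` F)"
    by (rule countable_subset[rotated]) (intro image_subsetI grid_index_PiE)
qed (use assms in \<open>auto intro: sets_grid_cell\<close>)

text \<open>A closed set is the intersection of its grid hulls, each a countable union of boxes.
  This ties the product topology, in which boundaries are taken, to the product
  sigma-algebra.\<close>

lemma closedin_euclid_sets:
  assumes "finite I" "closedin (euclid_topology I) F"
  shows "F \<in> sets (Pi\<^sub>M I (\<lambda>_. lborel))"
proof -
  have "F = (\<Inter>M\<in>{1..}. grid_hull I M F)"
  proof
    show "F \<subseteq> (\<Inter>M\<in>{1..}. grid_hull I M F)"
      using closedin_subset[OF assms(2)] unfolding topspace_euclid_topology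
      by (intro INT_greatest subset_grid_hull) auto
    show "(\<Inter>M\<in>{1..}. grid_hull I M F) \<subseteq> F"
    proof
      fix y assume y: "y \<in> (\<Inter>M\<in>{1..}. grid_hull I M F)"
      show "y \<in> F"
      proof (rule ccontr)
        assume "y \<notin> F"
        with closedin_grid_hull_separate[OF assms this] y show False
          by (metis INT_E One_nat_def Suc_leI atLeast_iff order_refl)
      qed
    qed
  qed
  also have "\<dots> \<in> sets (Pi\<^sub>M I (\<lambda>_. lborel))"
    using assms by (intro sets.countable_INT) (auto intro: sets_grid_hull)
  finally show ?thesis .
qed

lemma openin_euclid_sets:
  assumes "finite I" "openin (euclid_topology I) U"
  shows "U \<in> sets (Pi\<^sub>M I (\<lambda>_. lborel))"
proof -
  have sp: "space (Pi\<^sub>M I (\<lambda>_. lborel)) = topspace (euclid_topology I)"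
    by (simp add: space_PiM topspace_euclid_topology)
  have "space (Pi\<^sub>M I (\<lambda>_. lborel)) - (topspace (euclid_topology I) - U) \<in> sets (Pi\<^sub>M I (\<lambda>_. lborel))"
    using assms by (intro sets.compl_sets closedin_euclid_sets) auto
  moreover have "space (Pi\<^sub>M I (\<lambda>_. lborel)) - (topspace (euclid_topology I) - U) = U"
    using openin_subset[OF assms(2)] by (auto simp: sp)
  ultimately show ?thesis by simp
qed

section \<open>Volumes of grid hulls and averages over closed sets\<close>

interpretation lborel_product: product_sigma_finite "\<lambda>_::'i. lborel :: real measure" ..

lemma emeasure_PiM_interval:
  fixes a b :: "'i \<Rightarrow> real"
  assumes "finite I" "\<And>i. i \<in> I \<Longrightarrow> a i \<le> b i"
  shows "emeasure (Pi\<^sub>M I (\<lambda>_. lborel)) (PiE I (\<lambda>i. {a i..b i})) = ennreal (\<Prod>i\<in>I. b i - a i)"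
    and "emeasure (Pi\<^sub>M I (\<lambda>_. lborel)) (PiE I (\<lambda>i. {a i..<b i})) = ennreal (\<Prod>i\<in>I. b i - a i)"
proof -
  have *: "(\<Prod>i\<in>I. ennreal (b i - a i)) = ennreal (\<Prod>i\<in>I. b i - a i)"
    by (rule prod_ennreal) (simp add: assms(2))
  have "emeasure (Pi\<^sub>M I (\<lambda>_. lborel)) (PiE I (\<lambda>i. {a i..b i})) = (\<Prod>i\<in>I. emeasure lborel {a i..b i})"
    by (rule lborel_product.emeasure_PiM[OF assms(1)]) simp
  also have "\<dots> = (\<Prod>i\<in>I. ennreal (b i - a i))"
    by (intro prod.cong refl) (simp add: assms(2))
  finally show "emeasure (Pi\<^sub>M I (\<lambda>_. lborel)) (PiE I (\<lambda>i. {a i..b i})) = ennreal (\<Prod>i\<in>I. b i - a i)"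
    unfolding * .
  have "emeasure (Pi\<^sub>M I (\<lambda>_. lborel)) (PiE I (\<lambda>i. {a i..<b i})) = (\<Prod>i\<in>I. emeasure lborel {a i..<b i})"
    by (rule lborel_product.emeasure_PiM[OF assms(1)]) simp
  also have "\<dots> = (\<Prod>i\<in>I. ennreal (b i - a i))"
    by (intro prod.cong refl) (simp add: assms(2))
  finally show "emeasure (Pi\<^sub>M I (\<lambda>_. lborel)) (PiE I (\<lambda>i. {a i..<b i})) = ennreal (\<Prod>i\<in>I. b i - a i)"
    unfolding * .
qed

lemma measure_grid_hull:
  assumes "finite I" "finite (grid_index I M ` F)" "0 < M"
  shows "measure (Pi\<^sub>M I (\<lambda>_. lborel)) (grid_hull I M F)
    = real (card (grid_index I M ` F)) * (1 / real M) ^ card I"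
proof -
  have cell: "emeasure (Pi\<^sub>M I (\<lambda>_. lborel)) (grid_cell I M m) = ennreal ((1 / real M) ^ card I)" for m
    unfolding grid_cell_def using assms by (subst emeasure_PiM_interval(2)) auto
  have "measure (Pi\<^sub>M I (\<lambda>_. lborel)) (grid_hull I M F)
      = (\<Sum>m\<in>grid_index I M ` F. measure (Pi\<^sub>M I (\<lambda>_. lborel)) (grid_cell I M m))"
    unfolding grid_hull_def using assms cell
    by (intro measure_finite_Union)
      (auto simp: sets_grid_cell disjoint_family_on_def in_grid_cell_iff[OF assms(3) grid_index_PiE])
  then show ?thesis by (simp add: measure_def cell)
qed

lemma grid_hull_bounded:
  assumes "0 < M" "\<forall>y\<in>F. \<forall>i\<in>I. \<bar>y i\<bar> \<le> c" "y \<in> grid_hull I M F" "i \<in> I"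
  shows "\<bar>y i\<bar> \<le> c + 1"
proof -
  obtain y' where y': "y' \<in> F" "grid_index I M y' = grid_index I M y"
    using assms(3) unfolding in_grid_hull_iff[OF assms(1)] by blast
  have "\<bar>y' i - y i\<bar> < 1 / real M" by (rule grid_index_eq_imp_dist[OF assms(1,4) y'(2)])
  also have "\<dots> \<le> 1" using assms(1) by simp
  finally show ?thesis using assms(2)[rule_format, OF y'(1) assms(4)] by linarith
qed

lemma finite_grid_index:
  assumes "finite I" "\<forall>y\<in>F. \<forall>i\<in>I. \<bar>y i\<bar> \<le> c"
  shows "finite (grid_index I M ` F)"
proof (rule finite_subset)
  show "grid_index I M ` F \<subseteq> PiE I (\<lambda>_. {\<lfloor>- (real M * c)\<rfloor>..\<lfloor>real M * c\<rfloor>})"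
  proof (intro image_subsetI PiE_I)
    fix y i assume yi: "y \<in> F" "i \<in> I"
    have "\<bar>real M * y i\<bar> \<le> real M * c" using assms(2)[rule_format, OF yi] by (simp add: abs_mult mult_left_mono)
    then show "grid_index I M y i \<in> {\<lfloor>- (real M * c)\<rfloor>..\<lfloor>real M * c\<rfloor>}"
      using yi by (auto simp: grid_index_def intro!: floor_mono)
  qed (simp add: grid_index_def)
qed (use assms in \<open>auto intro!: finite_PiE\<close>)

lemma bounded_emeasure_finite:
  fixes B :: "('i \<Rightarrow> real) set"
  assumes "finite I" "B \<subseteq> (I \<rightarrow>\<^sub>E UNIV)" "\<forall>y\<in>B. \<forall>i\<in>I. \<bar>y i\<bar> \<le> c"
  shows "emeasure (Pi\<^sub>M I (\<lambda>_. lborel)) B \<noteq> \<infinity>"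
proof -
  \<comment> \<open>If B is empty, the bound c may be negative; \<open>d\<close> keeps the interval
    nonempty.\<close>
  define d where "d = max c 0"
  have "B \<subseteq> PiE I (\<lambda>_. {-d..d})"
  proof (intro subsetI PiE_I)
    show "y i \<in> {-d..d}" if "y \<in> B" "i \<in> I" for y i
    proof -
      have "\<bar>y i\<bar> \<le> c" using assms(3) that by blast
      moreover have "c \<le> d" by (simp add: d_def)
      ultimately show ?thesis unfolding atLeastAtMost_iff by linarith
    qed
  qed (use assms(2) in auto)
  then have "emeasure (Pi\<^sub>M I (\<lambda>_. lborel)) B \<le> emeasure (Pi\<^sub>M I (\<lambda>_. lborel)) (PiE I (\<lambda>_. {-d..d}))"
    by (intro emeasure_mono sets_PiM_I_finite assms(1)) auto
  also have "\<dots> < \<infinity>" using emeasure_PiM_interval(1)[OF assms(1), of "\<lambda>_. -d" "\<lambda>_. d"] by (simp add: d_def)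
  finally show ?thesis by simp
qed

text \<open>Hulls of different meshes are in general not nested, so continuity from above does not
  apply to them directly. The unions \<open>V s\<close> of all hulls finer than s are decreasing,
  bounded by c + 1, and have their intersection inside F.\<close>

lemma grid_hull_approximation:
  assumes "finite I" "closedin (euclid_topology I) F" "\<forall>y\<in>F. \<forall>i\<in>I. \<bar>y i\<bar> \<le> c" "0 < e"
  obtains M where "0 < M"
    "measure (Pi\<^sub>M I (\<lambda>_. lborel)) (grid_hull I M F) < measure (Pi\<^sub>M I (\<lambda>_. lborel)) F + e"
proof -
  define V where "V s = (\<Union>M\<in>{Suc s..}. grid_hull I M F)" for s
  have setsV: "V s \<in> sets (Pi\<^sub>M I (\<lambda>_. lborel))" for s
    unfolding V_def using assms(1) by (intro sets.countable_UN'') (auto intro: sets_grid_hull)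
  have bV: "\<bar>y i\<bar> \<le> c + 1" if yV: "y \<in> V s" and iI: "i \<in> I" for y i s
  proof -
    obtain M where M: "M \<in> {Suc s..}" "y \<in> grid_hull I M F"
      using yV by (auto simp: V_def)
    have "0 < M" using M(1) by simp
    then show ?thesis by (rule grid_hull_bounded[OF _ assms(3) M(2) iI])
  qed
  have finV: "emeasure (Pi\<^sub>M I (\<lambda>_. lborel)) (V s) \<noteq> \<infinity>" for s
    using sets.sets_into_space[OF setsV] bV by (intro bounded_emeasure_finite[OF assms(1)]) (auto simp: space_PiM)
  have "decseq V" unfolding V_def by (intro decseq_SucI) (auto intro: Suc_leD)
  then have lim: "(\<lambda>s. measure (Pi\<^sub>M I (\<lambda>_. lborel)) (V s)) \<longlonglongrightarrow> measure (Pi\<^sub>M I (\<lambda>_. lborel)) (\<Inter>s. V s)"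
    using setsV finV by (intro Lim_measure_decseq) auto
  have sub: "(\<Inter>s. V s) \<subseteq> F"
  proof
    fix y assume y: "y \<in> (\<Inter>s. V s)"
    show "y \<in> F"
    proof (rule ccontr)
      assume "y \<notin> F"
      then obtain M0 where M0: "\<And>M. M0 \<le> M \<Longrightarrow> y \<notin> grid_hull I M F"
        using closedin_grid_hull_separate[OF assms(1,2)] by metis
      from y have "y \<in> V M0" by blast
      then show False using M0 by (auto simp: V_def)
    qed
  qed
  have fF: "F \<in> fmeasurable (Pi\<^sub>M I (\<lambda>_. lborel))"
    using bounded_emeasure_finite[OF assms(1) _ assms(3)] closedin_euclid_sets[OF assms(1,2)]
      closedin_subset[OF assms(2)] by (auto simp: fmeasurable_def topspace_euclid_topology less_top)
  have "measure (Pi\<^sub>M I (\<lambda>_. lborel)) (\<Inter>s. V s) \<le> measure (Pi\<^sub>M I (\<lambda>_. lborel)) F"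
    using sub setsV by (intro measure_mono_fmeasurable fF) auto
  then have "measure (Pi\<^sub>M I (\<lambda>_. lborel)) (\<Inter>s. V s) < measure (Pi\<^sub>M I (\<lambda>_. lborel)) F + e"
    using assms(4) by linarith
  from order_tendstoD(2)[OF lim this] obtain s where
    s: "measure (Pi\<^sub>M I (\<lambda>_. lborel)) (V s) < measure (Pi\<^sub>M I (\<lambda>_. lborel)) F + e"
    unfolding eventually_sequentially by blast
  have "measure (Pi\<^sub>M I (\<lambda>_. lborel)) (grid_hull I (Suc s) F) \<le> measure (Pi\<^sub>M I (\<lambda>_. lborel)) (V s)"
    using setsV finV assms(1)
    by (intro measure_mono_fmeasurable) (auto simp: V_def fmeasurable_def less_top intro: sets_grid_hull)
  with s show thesis by (intro that[of "Suc s"]) auto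
qed

theorem box_average_closed_le:
  fixes \<Lambda> :: "'i \<Rightarrow> real^'n"
  assumes "finite I" "torus_free I \<Lambda>" "closedin (euclid_topology I) F"
    "\<forall>y\<in>F. \<forall>i\<in>I. \<bar>y i\<bar> \<le> c" "0 < e"
  shows "eventually (\<lambda>P. box_average (\<lambda>x. hit_count I F (\<lambda>i. \<Lambda> i \<bullet> real_vec x)) P
      \<le> measure (Pi\<^sub>M I (\<lambda>_. lborel)) F + e) box_filter"
proof -
  have e2: "0 < e / 2" using assms(5) by simp
  obtain M where M: "0 < M"
    "measure (Pi\<^sub>M I (\<lambda>_. lborel)) (grid_hull I M F) < measure (Pi\<^sub>M I (\<lambda>_. lborel)) F + e / 2"
    using grid_hull_approximation[OF assms(1,3,4) e2] by blast
  define K where "K = grid_index I M ` F"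
  have K: "finite K" unfolding K_def by (rule finite_grid_index[OF assms(1,4)])
  \<comment> \<open>Half of e went to the volume of the hull; the other half is shared by the cells.
    The summand 1 covers an empty \<open>K\<close>.\<close>
  define e' where "e' = e / (2 * (real (card K) + 1))"
  have e': "e' > 0" "real (card K) * e' \<le> e / 2"
    using assms(5) by (auto simp: e'_def field_simps)
  define v where "v x i = \<Lambda> i \<bullet> real_vec x" for x :: "int^'n" and i
  have "eventually (\<lambda>P. \<forall>m\<in>K. box_average (\<lambda>x. hit_count I (grid_cell I M m) (v x)) P
      \<le> (1 / real M) ^ card I + e') box_filter"
    unfolding eventually_ball_finite_distrib[OF K] grid_cell_def v_def
    using M(1) by (intro ballI box_average_cube_le assms(1,2) e') auto
  then show ?thesis
  proof (rule eventually_mono)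
    fix P :: "(int^'n) set" assume P: "\<forall>m\<in>K. box_average (\<lambda>x. hit_count I (grid_cell I M m) (v x)) P
      \<le> (1 / real M) ^ card I + e'"
    have "hit_count I F (v x) \<le> (\<Sum>m\<in>K. hit_count I (grid_cell I M m) (v x))" for x
    proof -
      have "hit_count I F (v x) \<le> hit_count I (grid_hull I M F) (v x)"
        using closedin_subset[OF assms(3)] grid_hull_bounded[OF M(1) assms(4)]
        by (intro hit_count_mono[OF assms(1), of _ _ "c + 1"] subset_grid_hull[OF M(1)])
          (auto simp: topspace_euclid_topology)
      also have "\<dots> \<le> (\<Sum>m\<in>K. hit_count I (grid_cell I M m) (v x))"
        using hit_count_UN_le[OF K] by (simp add: grid_hull_def K_def)
      finally show ?thesis .
    qed
    then have "box_average (\<lambda>x. hit_count I F (v x)) P \<le> box_average (\<lambda>x. \<Sum>m\<in>K. hit_count I (grid_cell I M m) (v x)) P"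
      by (rule box_average_mono)
    also have "\<dots> \<le> (\<Sum>m\<in>K. (1 / real M) ^ card I + e')"
      unfolding box_average_sum using P by (intro sum_mono) auto
    also have "\<dots> = measure (Pi\<^sub>M I (\<lambda>_. lborel)) (grid_hull I M F) + real (card K) * e'"
      using measure_grid_hull[OF assms(1) K[unfolded K_def] M(1)] by (simp add: K_def algebra_simps)
    also have "\<dots> \<le> measure (Pi\<^sub>M I (\<lambda>_. lborel)) F + e" using M(2) e'(2) by linarith
    finally show "box_average (\<lambda>x. hit_count I F (\<lambda>i. \<Lambda> i \<bullet> real_vec x)) P
      \<le> measure (Pi\<^sub>M I (\<lambda>_. lborel)) F + e" by (simp add: v_def[abs_def])
  qed
qed

section \<open>Jordan measurable sets and the equidistribution limit\<close>

lemma space_PiM_lborel: "space (Pi\<^sub>M I (\<lambda>_. lborel :: real measure)) = (I \<rightarrow>\<^sub>E UNIV)"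
  by (simp add: space_PiM)

text \<open>B lies between its interior and its closure, which differ by the null frontier.
  Completeness makes B measurable although it need not be Borel, and monotonicity makes the three
  measures equal. Topology and measure are general, to serve both the coordinate families and
  \<open>real^'n\<close>.\<close>

lemma null_frontier_sets:
  assumes op: "\<And>U. openin Z U \<Longrightarrow> U \<in> sets M" and sp: "space M = topspace Z"
    and "B \<subseteq> topspace Z" "Z frontier_of B \<in> null_sets (completion M)"
  shows "B \<in> sets (completion M)"
    and "emeasure (completion M) B = emeasure M (Z closure_of B)"
    and "emeasure (completion M) B = emeasure M (Z interior_of B)"
proof -
  let ?C = "Z closure_of B" and ?U = "Z interior_of B"
  let ?N = "Z frontier_of B"
  have cl: "F \<in> sets M" if "closedin Z F" for F
  proof -
    have "topspace Z - (topspace Z - F) \<in> sets M"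
      using that op sp by (metis closedin_def sets.compl_sets)
    then show ?thesis using closedin_subset[OF that] by (simp add: double_diff)
  qed
  have C: "?C \<in> sets M" and U: "?U \<in> sets M" and N: "?N \<in> sets M"
    by (rule cl op closedin_closure_of openin_interior_of closedin_frontier_of)+
  have N0: "?N \<in> null_sets M"
    using assms(4) N by (simp add: null_sets_completion_iff)
  have BC: "B \<subseteq> ?C" by (rule closure_of_subset[OF assms(3)])
  have UB: "?U \<subseteq> B" by (rule interior_of_subset)
  have CUN: "?C \<subseteq> ?U \<union> ?N" unfolding frontier_of_def by blast
  have "B = ?U \<union> (B - ?U)" using UB by blast
  moreover have "B - ?U \<in> sets (completion M)"
    using BC CUN by (intro null_sets_completion[OF N0]) blast
  ultimately show B: "B \<in> sets (completion M)"
    using U by (metis sets.Un sets_completionI_sets)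
  have "emeasure M ?C \<le> emeasure M (?U \<union> ?N)" using CUN sets.Un[OF U N] by (rule emeasure_mono)
  also have "\<dots> = emeasure M ?U" using emeasure_Un_null_set[OF U N0] .
  finally have 1: "emeasure M ?C \<le> emeasure M ?U" .
  have "emeasure (completion M) ?U \<le> emeasure (completion M) B"
    by (intro emeasure_mono UB B)
  then have 2: "emeasure M ?U \<le> emeasure (completion M) B"
    using U by simp
  have "emeasure (completion M) B \<le> emeasure (completion M) ?C"
    using C by (intro emeasure_mono BC) simp
  then have 3: "emeasure (completion M) B \<le> emeasure M ?C"
    using C by simp
  show "emeasure (completion M) B = emeasure M ?C" "emeasure (completion M) B = emeasure M ?U"
    using 1 2 3 by auto
qed

lemma jordan_measurable_on_sets:
  fixes B :: "('i \<Rightarrow> real) set"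
  assumes "finite I" "jordan_measurable_on I B"
  shows "B \<in> sets (euclid_lebesgue I)"
    and "emeasure (euclid_lebesgue I) B = emeasure (Pi\<^sub>M I (\<lambda>_. lborel)) (euclid_topology I closure_of B)"
    and "emeasure (euclid_lebesgue I) B = emeasure (Pi\<^sub>M I (\<lambda>_. lborel)) (euclid_topology I interior_of B)"
proof -
  have op: "U \<in> sets (Pi\<^sub>M I (\<lambda>_. lborel))" if "openin (euclid_topology I) U" for U
    by (rule openin_euclid_sets[OF assms(1) that])
  have sp: "space (Pi\<^sub>M I (\<lambda>_. lborel :: real measure)) = topspace (euclid_topology I)"
    by (simp add: space_PiM topspace_euclid_topology)
  have BT: "B \<subseteq> topspace (euclid_topology I)"
    and fr: "euclid_topology I frontier_of B \<in> null_sets (completion (Pi\<^sub>M I (\<lambda>_. lborel)))"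
    using assms(2) by (simp_all add: jordan_measurable_on_def euclid_lebesgue_def topspace_euclid_topology)
  show "B \<in> sets (euclid_lebesgue I)"
    unfolding euclid_lebesgue_def by (rule null_frontier_sets(1)[OF op sp BT fr])
  show "emeasure (euclid_lebesgue I) B = emeasure (Pi\<^sub>M I (\<lambda>_. lborel)) (euclid_topology I closure_of B)"
    unfolding euclid_lebesgue_def by (rule null_frontier_sets(2)[OF op sp BT fr])
  show "emeasure (euclid_lebesgue I) B = emeasure (Pi\<^sub>M I (\<lambda>_. lborel)) (euclid_topology I interior_of B)"
    unfolding euclid_lebesgue_def by (rule null_frontier_sets(3)[OF op sp BT fr])
qed

lemma closure_of_bounded:
  assumes "B \<subseteq> (I \<rightarrow>\<^sub>E UNIV)" "\<forall>y\<in>B. \<forall>i\<in>I. \<bar>y i\<bar> \<le> c"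
  shows "euclid_topology I closure_of B \<subseteq> PiE I (\<lambda>_. {-c..c})"
proof (intro closure_of_minimal closedin_euclid_topology_PiE subsetI PiE_I)
  show "y i \<in> {-c..c}" if "y \<in> B" "i \<in> I" for y i
    using assms(2) that by (auto simp: abs_le_iff) (metis abs_le_iff minus_le_iff)
  show "y i = undefined" if "y \<in> B" "i \<notin> I" for y i
    using assms(1) that by auto
qed auto

text \<open>The closed-set estimate is applied to the closure of B and to the part of a closed cube
  outside the interior of B. The null frontier makes the resulting upper and lower bounds for B
  meet.\<close>

theorem box_average_jordan:
  fixes \<Lambda> :: "'i \<Rightarrow> real^'n"
  assumes "finite I" "torus_free I \<Lambda>" "jordan_measurable_on I B"
  shows "(box_average (\<lambda>x. hit_count I B (\<lambda>i. \<Lambda> i \<bullet> real_vec x))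
    \<longlongrightarrow> measure (euclid_lebesgue I) B) box_filter"
proof -
  let ?T = "euclid_topology I" and ?M = "Pi\<^sub>M I (\<lambda>_. lborel :: real measure)"
  let ?m = "measure (euclid_lebesgue I) B"
  define v where "v x i = \<Lambda> i \<bullet> real_vec x" for x :: "int^'n" and i
  have BT: "B \<subseteq> (I \<rightarrow>\<^sub>E UNIV)" using assms(3) by (simp add: jordan_measurable_on_def)
  obtain c' where "\<forall>y\<in>B. \<forall>i\<in>I. \<bar>y i\<bar> \<le> c'" using assms(3) by (auto simp: jordan_measurable_on_def)
  \<comment> \<open>The bound is rounded up to a natural number so that the half-open cube
    \<open>H\<close> has the integer side 2 * c.\<close>
  moreover obtain c :: nat where "c' \<le> real c" using real_arch_simple by blast
  ultimately have Bc: "\<forall>y\<in>B. \<forall>i\<in>I. \<bar>y i\<bar> \<le> real c" by (meson order_trans)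
  define D where "D = PiE I (\<lambda>_. {- real c..real c})"
  define H where "H = PiE I (\<lambda>_. {- real c..<- real c + real (2 * c)})"
  define C where "C = ?T closure_of B"
  define F where "F = D - ?T interior_of B"
  have D: "closedin ?T D" unfolding D_def by (intro closedin_euclid_topology_PiE) auto
  have C: "closedin ?T C" "C \<subseteq> D" "B \<subseteq> C"
    using closure_of_bounded[OF BT Bc] closure_of_subset[of B ?T] BT
    by (auto simp: C_def D_def topspace_euclid_topology)
  have F: "closedin ?T F" unfolding F_def by (intro closedin_diff D) auto
  have Dc: "\<forall>y\<in>D. \<forall>i\<in>I. \<bar>y i\<bar> \<le> real c" by (auto simp: D_def abs_le_iff PiE_iff) (metis minus_le_iff)
  have Fc: "\<forall>y\<in>F. \<forall>i\<in>I. \<bar>y i\<bar> \<le> real c" using Dc by (auto simp: F_def)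
  have mC: "measure ?M C = ?m"
    using jordan_measurable_on_sets(2)[OF assms(1,3)] by (simp add: measure_def C_def)
  have mU: "measure ?M (?T interior_of B) = ?m"
    using jordan_measurable_on_sets(3)[OF assms(1,3)] by (simp add: measure_def)
  have UD: "?T interior_of B \<subseteq> D" using interior_of_subset C by fast
  have eD: "emeasure ?M D = ennreal ((2 * real c) ^ card I)"
    unfolding D_def by (subst emeasure_PiM_interval(1)) (auto simp: assms(1))
  have Df: "D \<in> fmeasurable ?M"
    using eD closedin_euclid_sets[OF assms(1) D] by (auto simp: fmeasurable_def)
  have mF: "measure ?M F = (2 * real c) ^ card I - ?m"
  proof -
    have "measure ?M D = (2 * real c) ^ card I" by (simp add: measure_def eD)
    then show ?thesis
      unfolding F_def using UD openin_euclid_sets[OF assms(1), of "?T interior_of B"] Df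
      by (subst measurable_measure_Diff) (auto simp: mU)
  qed
  have hH: "hit_count I H w = (2 * real c) ^ card I" for w
    unfolding H_def hit_count_PiE[OF assms(1)] card_int_translates(2) by simp
  (* H is hit exactly (2c)^d times, so an upper bound for F, which covers H - B, bounds B from below. *)
  have HBF: "H \<subseteq> B \<union> F" using interior_of_subset[of ?T B] by (fastforce simp: H_def F_def D_def PiE_iff)
  show ?thesis
  proof (rule tendstoI)
    fix e :: real assume "0 < e"
    then have e: "0 < e / 2" by simp
    have "eventually (\<lambda>P. box_average (\<lambda>x. hit_count I C (v x)) P \<le> ?m + e / 2) box_filter"
      using box_average_closed_le[OF assms(1,2) C(1) _ e, of "real c"] Dc C(2) by (auto simp: v_def[abs_def] mC)
    moreover have "eventually (\<lambda>P. box_average (\<lambda>x. hit_count I F (v x)) P \<le> (2 * real c) ^ card I - ?m + e / 2) box_filter"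
      using box_average_closed_le[OF assms(1,2) F Fc e] by (simp only: v_def[abs_def] mF)
    moreover have "eventually (\<lambda>P. box_average (\<lambda>x::int^'n. (2 * real c) ^ card I) P = (2 * real c) ^ card I) box_filter"
      by (rule eventually_box_average_const)
    ultimately show "eventually (\<lambda>P. dist (box_average (\<lambda>x. hit_count I B (\<lambda>i. \<Lambda> i \<bullet> real_vec x)) P) ?m < e) box_filter"
    proof eventually_elim
      case (elim P)
      have "hit_count I B (v x) \<le> hit_count I C (v x)" for x
        by (rule hit_count_mono[OF assms(1) C(3)]) (use Dc C(2) in blast)
      then have 1: "box_average (\<lambda>x. hit_count I B (v x)) P \<le> box_average (\<lambda>x. hit_count I C (v x)) P"
        by (rule box_average_mono)
      have "(2 * real c) ^ card I \<le> hit_count I B (v x) + hit_count I F (v x)" for x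
      proof -
        have "(2 * real c) ^ card I = hit_count I H (v x)" by (simp only: hH)
        also have "\<dots> \<le> hit_count I (B \<union> F) (v x)"
          by (rule hit_count_mono[OF assms(1) HBF]) (use Dc Bc in \<open>auto simp: F_def\<close>)
        also have "\<dots> \<le> hit_count I B (v x) + hit_count I F (v x)" by (rule hit_count_Un_le)
        finally show ?thesis .
      qed
      then have 2: "box_average (\<lambda>x. (2 * real c) ^ card I) P
          \<le> box_average (\<lambda>x. hit_count I B (v x) + hit_count I F (v x)) P"
        by (rule box_average_mono)
      have "box_average (\<lambda>x. hit_count I B (v x)) P < ?m + e"
        "box_average (\<lambda>x. hit_count I B (v x)) P > ?m - e"
        using 1 2 elim \<open>0 < e\<close> unfolding box_average_add by linarith+
      then show ?case by (simp add: dist_real_def v_def[abs_def] abs_less_iff)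
    qed
  qed
qed

section \<open>Triangular maps preserve volume\<close>

text \<open>
  Coordinate \<open>i\<close> is changed by coordinates of smaller rank \<open>r\<close> only, which makes the map unimodular;
  \<open>a = 0\<close> gives the translations.
\<close>

definition shear :: "'i set \<Rightarrow> ('i \<Rightarrow> nat) \<Rightarrow> ('i \<Rightarrow> 'i \<Rightarrow> real) \<Rightarrow> ('i \<Rightarrow> real) \<Rightarrow> ('i \<Rightarrow> real) \<Rightarrow> 'i \<Rightarrow> real" where
  "shear I r a b y = (\<lambda>i\<in>I. y i + b i + (\<Sum>j\<in>{j\<in>I. r j < r i}. a i j * y j))"

lemma continuous_map_shear:
  assumes "finite I"
  shows "continuous_map (euclid_topology I) (euclid_topology I) (shear I r a b)"
  unfolding euclid_topology_def continuous_map_componentwise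
proof (intro conjI ballI)
  fix k assume k: "k \<in> I"
  have "continuous_map (product_topology (\<lambda>_. euclideanreal) I) euclideanreal
      (\<lambda>y. y k + b k + (\<Sum>j\<in>{j\<in>I. r j < r k}. a k j * y j))"
    using assms k by (intro continuous_intros) auto
  then show "continuous_map (product_topology (\<lambda>_. euclideanreal) I) euclideanreal (\<lambda>y. shear I r a b y k)"
    using k by (simp add: shear_def)
qed (auto simp: shear_def)

lemma shear_PiE: "shear I r a b y \<in> I \<rightarrow>\<^sub>E UNIV"
  by (simp add: shear_def)

lemma measurable_shear:
  assumes "finite I"
  shows "shear I r a b \<in> measurable (Pi\<^sub>M I (\<lambda>_. lborel)) (Pi\<^sub>M I (\<lambda>_. lborel))"
  unfolding shear_def[abs_def]
proof (rule measurable_restrict)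
  fix i assume i: "i \<in> I"
  have [measurable]: "(\<lambda>y. y j) \<in> measurable (Pi\<^sub>M I (\<lambda>_. lborel :: real measure)) borel" if "j \<in> I" for j
    using measurable_component_singleton[OF that, of "\<lambda>_. lborel :: real measure"] by simp
  have "(\<lambda>y. y i + b i + (\<Sum>j\<in>{j\<in>I. r j < r i}. a i j * y j)) \<in> measurable (Pi\<^sub>M I (\<lambda>_. lborel)) borel"
    using i by (intro borel_measurable_add borel_measurable_sum borel_measurable_times) auto
  then show "(\<lambda>y. y i + b i + (\<Sum>j\<in>{j\<in>I. r j < r i}. a i j * y j)) \<in> measurable (Pi\<^sub>M I (\<lambda>_. lborel)) lborel"
    by simp
qed

text \<open>Coordinates are added in order of rank. The new one has maximal rank: it is translated
  by an amount depending only on the others, and these do not depend on it. Fubini with the new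
  coordinate innermost and translation invariance on the line remove this shift.\<close>

lemma nn_integral_shear:
  assumes "finite I" "f \<in> borel_measurable (Pi\<^sub>M I (\<lambda>_. lborel))"
  shows "(\<integral>\<^sup>+ y. f (shear I r a b y) \<partial>Pi\<^sub>M I (\<lambda>_. lborel)) = (\<integral>\<^sup>+ y. f y \<partial>Pi\<^sub>M I (\<lambda>_. lborel))"
  using assms
proof (induction I arbitrary: f rule: finite_ranking_induct[where f = r])
  case empty
  show ?case by (intro nn_integral_cong) (auto simp: shear_def space_PiM)
next
  case (insert i I)
  \<comment> \<open>The induction by rank does not exclude that i is already present.\<close>
  show ?case
  proof (cases "i \<in> I")
    case True
    then have "insert i I = I" by blast
    then show ?thesis using insert.IH insert.prems by simp
  next
    case False
    note [measurable] = insert.prems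
    define s where "s x = b i + (\<Sum>j\<in>{j\<in>I. r j < r i}. a i j * x j)" for x
    define h where "h x = (\<integral>\<^sup>+ t. f (x(i := t)) \<partial>lborel)" for x
    have upd: "shear (insert i I) r a b (x(i := t)) = (shear I r a b x)(i := t + s x)" for x t
    proof
      fix k
      have "{j \<in> insert i I. r j < r k} = {j \<in> I. r j < r k}" if "k \<in> insert i I"
      proof -
        have "r k \<le> r i" using that insert.hyps(2) by auto
        then show ?thesis by auto
      qed
      moreover have "(\<Sum>j\<in>{j \<in> I. r j < r k}. a k j * (x(i := t)) j) = (\<Sum>j\<in>{j \<in> I. r j < r k}. a k j * x j)" for k
        using False by (intro sum.cong) auto
      ultimately show "shear (insert i I) r a b (x(i := t)) k = ((shear I r a b x)(i := t + s x)) k"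
        using False by (auto simp: shear_def s_def)
    qed
    have hm: "h \<in> borel_measurable (Pi\<^sub>M I (\<lambda>_. lborel))"
      unfolding h_def by measurable
    have inner: "(\<integral>\<^sup>+ t. f (z(i := t + u)) \<partial>lborel) = h z" if "z \<in> space (Pi\<^sub>M I (\<lambda>_. lborel :: real measure))" for z u
    proof -
      have "(\<lambda>t. z(i := t)) \<in> measurable lborel (Pi\<^sub>M (insert i I) (\<lambda>_. lborel :: real measure))"
        using measurable_component_update[OF that False] .
      then have "(\<lambda>t. f (z(i := t))) \<in> borel_measurable borel"
        using measurable_compose[OF _ insert.prems] by simp
      from nn_integral_real_affine[OF this, of 1 u] show ?thesis
        by (simp add: h_def add.commute)
    qed
    have "(\<integral>\<^sup>+ y. f (shear (insert i I) r a b y) \<partial>Pi\<^sub>M (insert i I) (\<lambda>_. lborel))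
        = (\<integral>\<^sup>+ x. (\<integral>\<^sup>+ t. f (shear (insert i I) r a b (x(i := t))) \<partial>lborel) \<partial>Pi\<^sub>M I (\<lambda>_. lborel))"
      using measurable_compose[OF measurable_shear insert.prems] insert.hyps
      by (intro lborel_product.product_nn_integral_insert False) auto
    also have "\<dots> = (\<integral>\<^sup>+ x. h (shear I r a b x) \<partial>Pi\<^sub>M I (\<lambda>_. lborel))"
      unfolding upd by (intro nn_integral_cong inner) (simp add: space_PiM shear_PiE)
    also have "\<dots> = (\<integral>\<^sup>+ x. h x \<partial>Pi\<^sub>M I (\<lambda>_. lborel))" by (rule insert.IH[OF hm])
    also have "\<dots> = (\<integral>\<^sup>+ y. f y \<partial>Pi\<^sub>M (insert i I) (\<lambda>_. lborel))"
      unfolding h_def using insert.prems insert.hyps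
      by (intro lborel_product.product_nn_integral_insert[symmetric] False) auto
    finally show ?thesis .
  qed
qed

lemma emeasure_shear_vimage:
  assumes "finite I" "A \<in> sets (Pi\<^sub>M I (\<lambda>_. lborel))"
  shows "emeasure (Pi\<^sub>M I (\<lambda>_. lborel)) {y \<in> I \<rightarrow>\<^sub>E UNIV. shear I r a b y \<in> A} = emeasure (Pi\<^sub>M I (\<lambda>_. lborel)) A"
proof -
  let ?M = "Pi\<^sub>M I (\<lambda>_. lborel :: real measure)"
  have "{y \<in> I \<rightarrow>\<^sub>E UNIV. shear I r a b y \<in> A} = shear I r a b -` A \<inter> space ?M"
    by (auto simp: space_PiM_lborel)
  moreover have "shear I r a b -` A \<inter> space ?M \<in> sets ?M"
    by (rule measurable_sets[OF measurable_shear[OF assms(1)] assms(2)])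
  ultimately have "emeasure ?M {y \<in> I \<rightarrow>\<^sub>E UNIV. shear I r a b y \<in> A}
      = (\<integral>\<^sup>+ y. indicator (shear I r a b -` A \<inter> space ?M) y \<partial>?M)"
    by (simp only: nn_integral_indicator)
  also have "\<dots> = (\<integral>\<^sup>+ y. indicator A (shear I r a b y) \<partial>?M)"
    by (intro nn_integral_cong) (auto simp: indicator_def)
  also have "\<dots> = emeasure ?M A" using assms by (subst nn_integral_shear) auto
  finally show ?thesis .
qed

section \<open>Measures on subspaces and product sets of blocks\<close>

text \<open>At interior points of X the relative and the ambient topology agree locally; any other
  point of the closure of X belongs to the frontier of X. If that frontier is null, a null relative
  frontier implies a null ambient one.\<close>

lemma frontier_of_subset_subtopology:
  assumes "B \<subseteq> X"
  shows "Z frontier_of B \<subseteq> (subtopology Z X) frontier_of B \<union> Z frontier_of X"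
proof
  fix p assume p: "p \<in> Z frontier_of B"
  then have pc: "p \<in> Z closure_of B" and pi: "p \<notin> Z interior_of B" by (auto simp: frontier_of_def)
  have pX: "p \<in> Z closure_of X" using pc closure_of_mono[OF assms] by blast
  show "p \<in> (subtopology Z X) frontier_of B \<union> Z frontier_of X"
  proof (cases "p \<in> Z interior_of X")
    case False
    then show ?thesis using pX by (simp add: frontier_of_def)
  next
    case True
    then have "p \<in> X" using interior_of_subset[of Z X] by blast
    then have "p \<in> (subtopology Z X) closure_of B"
      using pc assms by (simp add: closure_of_subtopology Int_absorb1)
    moreover have "p \<notin> (subtopology Z X) interior_of B"
    proof
      assume "p \<in> (subtopology Z X) interior_of B"
      then obtain W where W: "openin Z W" "p \<in> W" "W \<inter> X \<subseteq> B"
        by (auto simp: interior_of_def openin_subtopology)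
      have "openin Z (W \<inter> Z interior_of X)" "W \<inter> Z interior_of X \<subseteq> B"
        using W interior_of_subset[of Z X] by (auto intro: openin_Int)
      then have "W \<inter> Z interior_of X \<subseteq> Z interior_of B" by (rule interior_of_maximal[rotated])
      then show False using W(2) True pi by blast
    qed
    ultimately show ?thesis by (simp add: frontier_of_def)
  qed
qed

lemma frontier_of_subtopology_le:
  assumes "B \<subseteq> X"
  shows "(subtopology Z X) frontier_of B \<subseteq> Z frontier_of B"
proof
  fix p assume "p \<in> (subtopology Z X) frontier_of B"
  then have p: "p \<in> (subtopology Z X) closure_of B" "p \<notin> (subtopology Z X) interior_of B"
    by (auto simp: frontier_of_def)
  have pX: "p \<in> X" "p \<in> Z closure_of B"
    using p(1) assms by (auto simp: closure_of_subtopology Int_absorb1)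
  have "openin (subtopology Z X) (X \<inter> Z interior_of B)" by (simp add: openin_subtopology_Int2)
  then have "X \<inter> Z interior_of B \<subseteq> (subtopology Z X) interior_of B"
    using interior_of_subset[of Z B] by (intro interior_of_maximal) auto
  then show "p \<in> Z frontier_of B" using p(2) pX by (auto simp: frontier_of_def)
qed

text \<open>Distributed maps refer to relative boundaries and to a restricted measure, whereas
  volumes are computed in the ambient space. These facts translate between the two for a subspace X
  with null frontier, for the single cell as well as for its powers.\<close>

lemma
  assumes op: "\<And>U. openin Z U \<Longrightarrow> U \<in> sets M" and sp: "space M = topspace Z"
    and X: "X \<subseteq> topspace Z" "Z frontier_of X \<in> null_sets (completion M)"
  defines "D \<equiv> borel_restriction (subtopology Z X) (completion M)"
  shows space_borel_restriction: "space D = topspace (subtopology Z X)"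
    and sets_borel_restriction: "sets D = borel_sets (subtopology Z X)"
    and borel_sets_subtopology: "A \<in> borel_sets (subtopology Z X) \<Longrightarrow> A \<in> sets (completion M) \<and> A \<subseteq> X"
    and emeasure_borel_restriction:
      "A \<in> borel_sets (subtopology Z X) \<Longrightarrow> emeasure D A = emeasure (completion M) A"
    and null_frontier_borel_restriction:
      "\<lbrakk>emeasure (completion M) X \<noteq> \<infinity>; A \<in> borel_sets (subtopology Z X);
        measure D ((subtopology Z X) frontier_of A) = 0\<rbrakk> \<Longrightarrow> Z frontier_of A \<in> null_sets (completion M)"
    and borel_restriction_null_frontier:
      "\<lbrakk>A \<subseteq> X; Z frontier_of A \<in> null_sets (completion M)\<rbrakk> \<Longrightarrow>
        measure D ((subtopology Z X) frontier_of A) = 0"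
proof -
  let ?S = "subtopology Z X"
  have tS: "topspace ?S = X" using X(1) by auto
  have pow: "{U. openin ?S U} \<subseteq> Pow X" using openin_subset[of ?S] tS by auto
  have D: "D = measure_of X {U. openin ?S U} (emeasure (completion M))"
    by (simp only: D_def borel_restriction_def tS)
  show spD: "space D = topspace ?S"
    unfolding D tS by (rule space_measure_of[OF pow])
  show seD: "sets D = borel_sets ?S"
    unfolding D borel_sets_def tS by (rule sets_measure_of[OF pow])
  have Xm: "X \<in> sets (completion M)" by (rule null_frontier_sets(1)[OF op sp X])
  have opS: "U \<in> sets (completion M)" if "openin ?S U" for U
    using that op Xm by (auto simp: openin_subtopology intro!: sets.Int)
  have sub: "borel_sets ?S \<subseteq> sets (completion M)"
    unfolding borel_sets_def tS using opS Xm by (intro sets.sigma_sets_subset') auto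
  show bs: "A \<in> sets (completion M) \<and> A \<subseteq> X" if "A \<in> borel_sets ?S" for A
    using that sub sets.sets_into_space[of A D] by (auto simp: seD spD tS)
  show em: "emeasure D A = emeasure (completion M) A" if "A \<in> borel_sets ?S" for A
  proof (rule emeasure_measure_of[OF D pow])
    show "positive (sets D) (emeasure (completion M))" by (simp add: positive_def)
    show "countably_additive (sets D) (emeasure (completion M))"
      using sub unfolding countably_additive_def seD by (auto intro!: suminf_emeasure)
    show "A \<in> sets D" using that seD by simp
  qed
  have frS: "?S frontier_of A \<in> borel_sets ?S" for A
  proof -
    have "openin ?S (topspace ?S - ?S frontier_of A)"
      using closedin_frontier_of[of ?S A] by (simp add: closedin_def)
    then have "topspace ?S - ?S frontier_of A \<in> sets D" by (auto simp: seD borel_sets_def)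
    from sets.compl_sets[OF this] show ?thesis
      using closedin_subset[OF closedin_frontier_of[of ?S A]] by (simp add: seD spD double_diff)
  qed
  show "Z frontier_of A \<in> null_sets (completion M)"
    if fin: "emeasure (completion M) X \<noteq> \<infinity>" and A: "A \<in> borel_sets ?S" and m0: "measure D (?S frontier_of A) = 0"
  proof -
    have fr: "?S frontier_of A \<in> sets (completion M)" "?S frontier_of A \<subseteq> X"
      using bs[OF frS] by auto
    \<comment> \<open>\<open>measure\<close> is 0 also on sets of infinite measure, so nullity
      requires finiteness, inherited here from X.\<close>
    have "emeasure (completion M) (?S frontier_of A) \<le> emeasure (completion M) X"
      by (rule emeasure_mono[OF fr(2) Xm])
    then have "emeasure (completion M) (?S frontier_of A) \<noteq> \<infinity>" using fin by (auto simp: top_unique)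
    moreover have "measure (completion M) (?S frontier_of A) = 0"
      using m0 em[OF frS] by (simp add: measure_def)
    ultimately have "?S frontier_of A \<in> null_sets (completion M)"
      using fr(1) by (auto simp: null_sets_def measure_def enn2real_eq_0_iff)
    then have "?S frontier_of A \<union> Z frontier_of X \<in> null_sets (completion M)" using X(2) by (rule null_sets.Un)
    then show ?thesis
      by (rule null_sets_completion_subset[rotated]) (use frontier_of_subset_subtopology bs[OF A] in blast)
  qed
  show "measure D (?S frontier_of A) = 0" if A: "A \<subseteq> X" "Z frontier_of A \<in> null_sets (completion M)"
  proof -
    have "?S frontier_of A \<in> null_sets (completion M)"
      by (rule null_sets_completion_subset[OF frontier_of_subtopology_le[OF A(1)] A(2)])
    then show ?thesis using em[OF frS] by (simp add: measure_def null_setsD1)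
  qed
qed

section \<open>Lebesgue measure of products of blocks\<close>

lemma sets_borel_vec_box:
  fixes A :: "'n::finite \<Rightarrow> real set"
  assumes "\<And>i. A i \<in> sets borel"
  shows "{v :: real^'n. \<forall>i. v $ i \<in> A i} \<in> sets borel"
proof -
  have "{v :: real^'n. \<forall>i. v $ i \<in> A i} = (\<Inter>i. (\<lambda>v. v $ i) -` A i)" by auto
  also have "\<dots> \<in> sets borel"
  proof (intro sets.countable_INT'')
    fix i show "(\<lambda>v :: real^'n. v $ i) -` A i \<in> sets borel"
      using measurable_sets[OF borel_measurable_continuous_onI assms[of i], of "\<lambda>v::real^'n. v $ i"]
      by (simp add: continuous_on_component)
  qed auto
  finally show ?thesis .
qed

lemma emeasure_lborel_vec:
  fixes A :: "'n::finite \<Rightarrow> real set"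
  assumes "\<And>i. A i \<in> sets borel"
  shows "emeasure lborel {v :: real^'n. \<forall>i. v $ i \<in> A i} = (\<Prod>i\<in>UNIV. emeasure lborel (A i))"
proof -
  \<comment> \<open>The product formula for \<open>lborel\<close> is indexed by basis vectors;
    \<open>THE\<close> reads the coordinate off a basis vector.\<close>
  define f where "f b = (indicator (A (THE i. b = axis i 1)) :: real \<Rightarrow> ennreal)" for b :: "real^'n"
  have the: "(THE i. (axis j 1 :: real^'n) = axis i 1) = j" for j by (auto simp: axis_eq_axis)
  have f: "f (axis i 1) = indicator (A i)" for i by (simp add: f_def the)
  have Basis: "(Basis :: (real^'n) set) = range (\<lambda>i. axis i 1)" by (auto simp: Basis_vec_def)
  have prodB: "(\<Prod>b\<in>Basis. g b) = (\<Prod>i\<in>UNIV. g (axis i 1))" for g :: "real^'n \<Rightarrow> ennreal"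
    unfolding Basis by (subst prod.reindex) (auto simp: inj_on_def axis_eq_axis)
  have "(\<integral>\<^sup>+x. (\<Prod>b\<in>Basis. f b (x \<bullet> b)) \<partial>lborel) = (\<Prod>b\<in>Basis. (\<integral>\<^sup>+x. f b x \<partial>lborel))"
    using assms by (intro nn_integral_lborel_prod) (auto simp: Basis f)
  also have "(\<Prod>b\<in>Basis. (\<integral>\<^sup>+x. f b x \<partial>lborel)) = (\<Prod>i\<in>UNIV. emeasure lborel (A i))"
    unfolding prodB f using assms by simp
  also have "(\<lambda>x. \<Prod>b\<in>Basis. f b (x \<bullet> b)) = indicator {v :: real^'n. \<forall>i. v $ i \<in> A i}"
    unfolding prodB f by (auto simp: fun_eq_iff indicator_def inner_axis)
  also have "(\<integral>\<^sup>+x. indicator {v :: real^'n. \<forall>i. v $ i \<in> A i} x \<partial>lborel) = emeasure lborel {v :: real^'n. \<forall>i. v $ i \<in> A i}"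
    using sets_borel_vec_box[OF assms] by (intro nn_integral_indicator) simp
  finally show ?thesis .
qed

interpretation lborel_vec_product: product_sigma_finite "\<lambda>_::nat. lborel :: (real^'n::finite) measure" ..

lemma finite_block_index: "finite (block_index N :: (nat \<times> 'n::finite) set)"
  by (simp add: block_index_def)

definition flatten_blocks :: "nat \<Rightarrow> (nat \<Rightarrow> real^'n) \<Rightarrow> nat \<times> 'n \<Rightarrow> real" where
  "flatten_blocks N y = (\<lambda>(k, i)\<in>block_index N. y k $ i)"

lemma measurable_flatten_blocks:
  "(flatten_blocks N :: (nat \<Rightarrow> real^'n) \<Rightarrow> _) \<in> measurable (Pi\<^sub>M {1..N} (\<lambda>_. lborel)) (Pi\<^sub>M (block_index N) (\<lambda>_. lborel))"
  unfolding flatten_blocks_def[abs_def]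
proof (rule measurable_restrict)
  fix x :: "nat \<times> 'n" assume "x \<in> block_index N"
  then obtain k i where x: "x = (k, i)" "k \<in> {1..N}" by (auto simp: block_index_def)
  have "(\<lambda>y. y k) \<in> measurable (Pi\<^sub>M {1..N} (\<lambda>_. lborel :: (real^'n) measure)) borel"
    using measurable_component_singleton[OF x(2), of "\<lambda>_. lborel :: (real^'n) measure"] by simp
  moreover have "(\<lambda>v :: real^'n. v $ i) \<in> measurable borel borel"
    by (intro borel_measurable_continuous_onI continuous_intros)
  ultimately have "(\<lambda>y. y k $ i) \<in> measurable (Pi\<^sub>M {1..N} (\<lambda>_. lborel :: (real^'n) measure)) borel"
    by (rule measurable_compose)
  then show "(\<lambda>y. case x of (k, i) \<Rightarrow> y k $ i)
      \<in> measurable (Pi\<^sub>M {1..N} (\<lambda>_. lborel :: (real^'n) measure)) (lborel :: real measure)"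
    by (simp add: x)
qed

text \<open>A product measure is determined by its values on boxes, and there regrouping N vectors
  into one family of coordinates only rewrites a double product as a single one.\<close>

lemma distr_flatten_blocks:
  "distr (Pi\<^sub>M {1..N} (\<lambda>_. lborel :: (real^'n) measure)) (Pi\<^sub>M (block_index N) (\<lambda>_. lborel)) (flatten_blocks N)
    = Pi\<^sub>M (block_index N) (\<lambda>_. lborel)"
proof (rule lborel_product.PiM_eqI)
  fix A :: "nat \<times> 'n \<Rightarrow> real set"
  assume A: "\<And>x. x \<in> block_index N \<Longrightarrow> A x \<in> sets lborel"
  have Am: "A (k, i) \<in> sets borel" if "k \<in> {1..N}" for k i using A[of "(k, i)"] that by (simp add: block_index_def)
  have Vm: "{v :: real^'n. \<forall>i. v $ i \<in> A (k, i)} \<in> sets lborel" if "k \<in> {1..N}" for k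
    using sets_borel_vec_box[of "\<lambda>i. A (k, i)", OF Am[OF that]] by simp
  have "emeasure (distr (Pi\<^sub>M {1..N} (\<lambda>_. lborel :: (real^'n) measure)) (Pi\<^sub>M (block_index N) (\<lambda>_. lborel)) (flatten_blocks N)) (PiE (block_index N) A)
      = emeasure (Pi\<^sub>M {1..N} (\<lambda>_. lborel :: (real^'n) measure)) (flatten_blocks N -` PiE (block_index N) A \<inter> space (Pi\<^sub>M {1..N} (\<lambda>_. lborel)))"
    using A by (intro emeasure_distr measurable_flatten_blocks sets_PiM_I_finite finite_block_index)
  also have "flatten_blocks N -` PiE (block_index N) A \<inter> space (Pi\<^sub>M {1..N} (\<lambda>_. lborel :: (real^'n) measure))
      = PiE {1..N} (\<lambda>k. {v. \<forall>i. v $ i \<in> A (k, i)})"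
    by (auto simp: flatten_blocks_def block_index_def space_PiM PiE_iff split: prod.splits)
  also have "emeasure (Pi\<^sub>M {1..N} (\<lambda>_. lborel)) \<dots> = (\<Prod>k\<in>{1..N}. emeasure lborel {v :: real^'n. \<forall>i. v $ i \<in> A (k, i)})"
    using Vm by (intro lborel_vec_product.emeasure_PiM) auto
  also have "\<dots> = (\<Prod>k\<in>{1..N}. \<Prod>i\<in>UNIV. emeasure lborel (A (k, i)))"
    using Am by (intro prod.cong refl emeasure_lborel_vec)
  also have "\<dots> = (\<Prod>x\<in>block_index N. emeasure lborel (A x))"
    by (simp add: block_index_def prod.cartesian_product)
  finally show "emeasure (distr (Pi\<^sub>M {1..N} (\<lambda>_. lborel :: (real^'n) measure)) (Pi\<^sub>M (block_index N) (\<lambda>_. lborel)) (flatten_blocks N)) (PiE (block_index N) A)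
      = (\<Prod>x\<in>block_index N. emeasure lborel (A x))" .
qed (auto simp: finite_block_index)

text \<open>The Cartesian product of C 1, ..., C N in flat coordinates, the form in which topology
  and volume are available.\<close>

definition block_set :: "nat \<Rightarrow> (nat \<Rightarrow> (real^'n) set) \<Rightarrow> (nat \<times> 'n \<Rightarrow> real) set" where
  "block_set N C = {y \<in> block_index N \<rightarrow>\<^sub>E UNIV. \<forall>k\<in>{1..N}. (\<chi> i. y (k, i)) \<in> C k}"

lemma block_set_mono: "(\<And>k. k \<in> {1..N} \<Longrightarrow> C k \<subseteq> C' k) \<Longrightarrow> block_set N C \<subseteq> block_set N C'"
  unfolding block_set_def by blast

lemma continuous_map_block:
  assumes "k \<in> {1..N}"
  shows "continuous_map (euclid_topology (block_index N)) euclidean (\<lambda>y :: nat \<times> 'n::finite \<Rightarrow> real. \<chi> i. y (k, i))"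
  unfolding continuous_map_atin limitin_canonical_iff
proof (intro ballI tendsto_vec_lambda)
  fix y :: "nat \<times> 'n \<Rightarrow> real" and i :: 'n assume y: "y \<in> topspace (euclid_topology (block_index N))"
  have "continuous_map (euclid_topology (block_index N)) euclideanreal (\<lambda>y. y (k, i))"
    using assms unfolding euclid_topology_def
    by (intro continuous_map_product_projection) (auto simp: block_index_def)
  then show "((\<lambda>y. y (k, i)) \<longlongrightarrow> y (k, i)) (atin (euclid_topology (block_index N)) y)"
    using y by (auto simp: continuous_map_atin limitin_canonical_iff)
qed

text \<open>N is positive because an intersection over no indices would be the whole type, including
  non-extensional functions.\<close>

lemma block_set_eq_INT:
  assumes "0 < N"
  shows "block_set N C = (\<Inter>k\<in>{1..N}. {y \<in> topspace (euclid_topology (block_index N)). (\<chi> i. y (k, i)) \<in> C k})"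
proof -
  have "1 \<in> {1..N}" using assms by simp
  then show ?thesis unfolding block_set_def topspace_euclid_topology by blast
qed

lemma openin_block_set:
  assumes "0 < N" "\<And>k. k \<in> {1..N} \<Longrightarrow> open (C k)"
  shows "openin (euclid_topology (block_index N)) (block_set N C)"
  unfolding block_set_eq_INT[OF assms(1)] using assms
  by (intro openin_INT2 openin_continuous_map_preimage[OF continuous_map_block]) auto

lemma closedin_block_set:
  assumes "0 < N" "\<And>k. k \<in> {1..N} \<Longrightarrow> closed (C k)"
  shows "closedin (euclid_topology (block_index N)) (block_set N C)"
  unfolding block_set_eq_INT[OF assms(1)] using assms
  by (intro closedin_INT closedin_continuous_map_preimage[OF continuous_map_block]) auto

lemma emeasure_block_set:
  assumes "\<And>k. k \<in> {1..N} \<Longrightarrow> C k \<in> sets borel" "block_set N C \<in> sets (Pi\<^sub>M (block_index N) (\<lambda>_. lborel))"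
  shows "emeasure (Pi\<^sub>M (block_index N) (\<lambda>_. lborel)) (block_set N C) = (\<Prod>k\<in>{1..N}. emeasure lborel (C k))"
proof -
  have "emeasure (Pi\<^sub>M (block_index N) (\<lambda>_. lborel)) (block_set N C)
      = emeasure (distr (Pi\<^sub>M {1..N} (\<lambda>_. lborel)) (Pi\<^sub>M (block_index N) (\<lambda>_. lborel)) (flatten_blocks N)) (block_set N C)"
    by (simp only: distr_flatten_blocks)
  also have "\<dots> = emeasure (Pi\<^sub>M {1..N} (\<lambda>_. lborel)) (flatten_blocks N -` block_set N C \<inter> space (Pi\<^sub>M {1..N} (\<lambda>_. lborel)))"
    by (rule emeasure_distr[OF measurable_flatten_blocks assms(2)])
  also have "flatten_blocks N -` block_set N C \<inter> space (Pi\<^sub>M {1..N} (\<lambda>_. lborel)) = PiE {1..N} C"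
    by (auto simp: flatten_blocks_def block_set_def block_index_def space_PiM PiE_iff vec_lambda_eta)
  also have "emeasure (Pi\<^sub>M {1..N} (\<lambda>_. lborel)) \<dots> = (\<Prod>k\<in>{1..N}. emeasure lborel (C k))"
    using assms(1) by (intro lborel_vec_product.emeasure_PiM) auto
  finally show ?thesis .
qed

lemma jordan_measurable_sets:
  fixes S :: "(real^'n) set"
  assumes "jordan_measurable S"
  shows "S \<in> sets lebesgue" "emeasure lebesgue S = emeasure lborel (closure S)"
    "emeasure lebesgue S = emeasure lborel (interior S)" "emeasure lebesgue S < \<infinity>"
proof -
  have fr: "euclidean frontier_of S \<in> null_sets (completion lborel)"
    using assms by (simp add: jordan_measurable_def negligible_iff_null_sets)
  note * = null_frontier_sets[where Z=euclidean and M=lborel and B=S, OF _ _ _ fr, simplified]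
  show "S \<in> sets lebesgue" "emeasure lebesgue S = emeasure lborel (closure S)"
    "emeasure lebesgue S = emeasure lborel (interior S)" using * by auto
  have "bounded (closure S)" using assms by (auto simp: jordan_measurable_def intro: bounded_closure)
  then show "emeasure lebesgue S < \<infinity>"
    unfolding \<open>emeasure lebesgue S = emeasure lborel (closure S)\<close> by (rule emeasure_bounded_finite)
qed

text \<open>The factors may fail to be Borel, so the product formula is applied to their closures
  and interiors. The two products have the same finite volume; hence their difference, which
  contains the frontier of the block set, is null.\<close>

lemma jordan_measurable_block_set:
  fixes C :: "nat \<Rightarrow> (real^'n) set"
  assumes N: "0 < N" and C: "\<And>k. k \<in> {1..N} \<Longrightarrow> jordan_measurable (C k)"
  shows "jordan_measurable_on (block_index N) (block_set N C)"
    and "measure (euclid_lebesgue (block_index N)) (block_set N C) = (\<Prod>k\<in>{1..N}. measure lebesgue (C k))"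
    and "emeasure (euclid_lebesgue (block_index N)) (block_set N C) < \<infinity>"
proof -
  let ?T = "euclid_topology (block_index N :: (nat \<times> 'n) set)"
  let ?M = "Pi\<^sub>M (block_index N :: (nat \<times> 'n) set) (\<lambda>_. lborel :: real measure)"
  let ?K = "block_set N (\<lambda>k. closure (C k))" and ?U = "block_set N (\<lambda>k. interior (C k))"
  have fin: "finite (block_index N :: (nat \<times> 'n) set)" by (rule finite_block_index)
  have K: "closedin ?T ?K" and U: "openin ?T ?U"
    using N by (auto intro!: closedin_block_set openin_block_set)
  have sub: "?U \<subseteq> block_set N C" "block_set N C \<subseteq> ?K"
    by (intro block_set_mono interior_subset closure_subset)+
  have Km: "?K \<in> sets ?M" and Um: "?U \<in> sets ?M"
    using closedin_euclid_sets[OF fin K] openin_euclid_sets[OF fin U] .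
  have eK: "emeasure ?M ?K = (\<Prod>k\<in>{1..N}. emeasure lebesgue (C k))"
    using emeasure_block_set[OF _ Km] jordan_measurable_sets(2)[OF C] by simp
  have eU: "emeasure ?M ?U = (\<Prod>k\<in>{1..N}. emeasure lebesgue (C k))"
    using emeasure_block_set[OF _ Um] jordan_measurable_sets(3)[OF C] by simp
  have finK: "emeasure ?M ?K < \<infinity>"
  proof -
    have "emeasure ?M ?K = (\<Prod>k\<in>{1..N}. ennreal (measure lebesgue (C k)))"
      unfolding eK using jordan_measurable_sets(4)[OF C]
      by (intro prod.cong refl emeasure_eq_ennreal_measure) (auto simp: less_top)
    also have "\<dots> = ennreal (\<Prod>k\<in>{1..N}. measure lebesgue (C k))" by (rule prod_ennreal) simp
    finally show ?thesis by simp
  qed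
  have "?K - ?U \<in> null_sets ?M"
    using eK eU finK sub Km Um by (auto simp: null_sets_def emeasure_Diff less_top)
  moreover have "?T frontier_of block_set N C \<subseteq> ?K - ?U"
    unfolding frontier_of_def using closure_of_minimal[OF sub(2) K] interior_of_maximal[OF sub(1) U] by blast
  ultimately have fr: "?T frontier_of block_set N C \<in> null_sets (euclid_lebesgue (block_index N))"
    unfolding euclid_lebesgue_def using null_sets_completion_subset null_sets_completionI by blast
  have bd: "\<exists>c. \<forall>y\<in>block_set N C. \<forall>x\<in>block_index N. \<bar>y x\<bar> \<le> c"
  proof -
    have "\<forall>k\<in>{1..N}. \<exists>b. \<forall>v\<in>C k. norm v \<le> b" using C by (auto simp: jordan_measurable_def bounded_iff)
    then obtain b where b: "\<And>k v. k \<in> {1..N} \<Longrightarrow> v \<in> C k \<Longrightarrow> norm v \<le> b k" by metis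
    have "\<bar>y x\<bar> \<le> (\<Sum>k\<in>{1..N}. \<bar>b k\<bar>)" if y: "y \<in> block_set N C" and x: "x \<in> block_index N" for y x
    proof -
      obtain k i where ki: "x = (k, i)" "k \<in> {1..N}" using x by (auto simp: block_index_def)
      have "\<bar>y x\<bar> \<le> norm (\<chi> i. y (k, i))"
        using component_le_norm_cart[of "\<chi> i. y (k, i)" i] by (simp add: ki(1))
      also have "\<dots> \<le> b k" using y ki(2) by (intro b) (auto simp: block_set_def)
      also have "\<dots> \<le> \<bar>b k\<bar>" by simp
      also have "\<dots> \<le> (\<Sum>k\<in>{1..N}. \<bar>b k\<bar>)" using ki(2) by (intro member_le_sum) auto
      finally show ?thesis .
    qed
    then show ?thesis by blast
  qed
  show J: "jordan_measurable_on (block_index N) (block_set N C)"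
    unfolding jordan_measurable_on_def using fr bd by (auto simp: block_set_def)
  have B: "block_set N C \<in> sets (euclid_lebesgue (block_index N))"
    by (rule jordan_measurable_on_sets(1)[OF fin J])
  have "emeasure (euclid_lebesgue (block_index N)) ?U \<le> emeasure (euclid_lebesgue (block_index N)) (block_set N C)"
    by (rule emeasure_mono[OF sub(1) B])
  moreover have "emeasure (euclid_lebesgue (block_index N)) (block_set N C) \<le> emeasure (euclid_lebesgue (block_index N)) ?K"
    using Km by (intro emeasure_mono[OF sub(2)]) (simp add: euclid_lebesgue_def)
  ultimately have e: "emeasure (euclid_lebesgue (block_index N)) (block_set N C) = (\<Prod>k\<in>{1..N}. emeasure lebesgue (C k))"
    using Km Um by (simp add: euclid_lebesgue_def eK eU)
  then show "emeasure (euclid_lebesgue (block_index N)) (block_set N C) < \<infinity>" using finK eK by simp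
  show "measure (euclid_lebesgue (block_index N)) (block_set N C) = (\<Prod>k\<in>{1..N}. measure lebesgue (C k))"
    unfolding measure_def e by (induction ("{1..N}") rule: infinite_finite_induct) (simp_all add: enn2real_mult)
qed

section \<open>Sets with null frontier\<close>

text \<open>Jordan measurability without boundedness. The property passes to intersections, finite
  unions and shear preimages; boundedness is tracked separately.\<close>

definition null_frontier :: "'i set \<Rightarrow> ('i \<Rightarrow> real) set \<Rightarrow> bool" where
  "null_frontier I A \<longleftrightarrow> A \<subseteq> (I \<rightarrow>\<^sub>E UNIV) \<and> euclid_topology I frontier_of A \<in> null_sets (euclid_lebesgue I)"

lemma null_frontier_subset:
  "\<lbrakk>A \<subseteq> (I \<rightarrow>\<^sub>E UNIV); euclid_topology I frontier_of A \<subseteq> N; N \<in> null_sets (euclid_lebesgue I)\<rbrakk> \<Longrightarrow> null_frontier I A"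
  unfolding null_frontier_def euclid_lebesgue_def using null_sets_completion_subset by blast

lemma null_frontier_Int: "null_frontier I A \<Longrightarrow> null_frontier I B \<Longrightarrow> null_frontier I (A \<inter> B)"
  by (rule null_frontier_subset[OF _ frontier_of_Int_subset]) (auto simp: null_frontier_def)

lemma null_frontier_UN:
  assumes "finite J" "\<And>j. j \<in> J \<Longrightarrow> null_frontier I (A j)"
  shows "null_frontier I (\<Union>j\<in>J. A j)"
proof (rule null_frontier_subset)
  show "euclid_topology I frontier_of (\<Union>j\<in>J. A j) \<subseteq> (\<Union>j\<in>J. euclid_topology I frontier_of (A j))"
    using frontier_of_Union_subset[of "A ` J" "euclid_topology I"] assms(1) by auto
  show "(\<Union>j\<in>J. euclid_topology I frontier_of (A j)) \<in> null_sets (euclid_lebesgue I)"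
    using assms by (intro null_sets_UN' countable_finite) (auto simp: null_frontier_def)
  show "(\<Union>j\<in>J. A j) \<subseteq> (I \<rightarrow>\<^sub>E UNIV)"
    using assms(2) unfolding null_frontier_def by blast
qed

text \<open>The frontier of a preimage under a continuous map lies in the preimage of the frontier,
  and volume preservation keeps the latter null.\<close>

lemma null_frontier_shear_vimage:
  assumes "finite I" "null_frontier I A"
  shows "null_frontier I {y \<in> I \<rightarrow>\<^sub>E UNIV. shear I r a b y \<in> A}"
proof (rule null_frontier_subset)
  let ?T = "euclid_topology I" and ?M = "Pi\<^sub>M I (\<lambda>_. lborel :: real measure)"
  show "?T frontier_of {y \<in> I \<rightarrow>\<^sub>E UNIV. shear I r a b y \<in> A} \<subseteq> {y \<in> I \<rightarrow>\<^sub>E UNIV. shear I r a b y \<in> ?T frontier_of A}"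
    using continuous_map_frontier_frontier_preimage_subset[OF continuous_map_shear[OF assms(1)], of r a b A]
    by (simp add: topspace_euclid_topology)
  have m: "?T frontier_of A \<in> sets ?M" by (rule closedin_euclid_sets[OF assms(1) closedin_frontier_of])
  then have "?T frontier_of A \<in> null_sets ?M"
    using assms(2) by (simp add: null_frontier_def euclid_lebesgue_def null_sets_completion_iff)
  moreover have "{y \<in> I \<rightarrow>\<^sub>E UNIV. shear I r a b y \<in> ?T frontier_of A} = shear I r a b -` (?T frontier_of A) \<inter> space ?M"
    by (auto simp: space_PiM_lborel)
  ultimately have "{y \<in> I \<rightarrow>\<^sub>E UNIV. shear I r a b y \<in> ?T frontier_of A} \<in> null_sets ?M"
    using emeasure_shear_vimage[OF assms(1) m, of r a b] measurable_sets[OF measurable_shear[OF assms(1)] m, of r a b]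
    by (auto simp: null_sets_def)
  then show "{y \<in> I \<rightarrow>\<^sub>E UNIV. shear I r a b y \<in> ?T frontier_of A} \<in> null_sets (euclid_lebesgue I)"
    unfolding euclid_lebesgue_def by (rule null_sets_completionI)
qed auto

lemma jordan_measurable_on_iff:
  "jordan_measurable_on I G \<longleftrightarrow> null_frontier I G \<and> (\<exists>c. \<forall>y\<in>G. \<forall>i\<in>I. \<bar>y i\<bar> \<le> c)"
  by (auto simp: jordan_measurable_on_def null_frontier_def)

text \<open>Invariance is available for sets of the product sigma-algebra; a Jordan set and its
  preimage are squeezed between interior and closure and their preimages.\<close>

lemma emeasure_jordan_shear_vimage:
  assumes "finite I" "jordan_measurable_on I B" "jordan_measurable_on I {y \<in> I \<rightarrow>\<^sub>E UNIV. shear I r a b y \<in> B}"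
  shows "emeasure (euclid_lebesgue I) {y \<in> I \<rightarrow>\<^sub>E UNIV. shear I r a b y \<in> B} = emeasure (euclid_lebesgue I) B"
proof -
  let ?T = "euclid_topology I" and ?M = "Pi\<^sub>M I (\<lambda>_. lborel :: real measure)"
  let ?V = "\<lambda>A. {y \<in> I \<rightarrow>\<^sub>E UNIV. shear I r a b y \<in> A}"
  have V: "?V A \<in> sets ?M \<and> emeasure ?M (?V A) = emeasure ?M A" if "A \<in> sets ?M" for A
  proof -
    have "?V A = shear I r a b -` A \<inter> space ?M" by (auto simp: space_PiM_lborel)
    then show ?thesis
      using emeasure_shear_vimage[OF assms(1) that, of r a b] measurable_sets[OF measurable_shear[OF assms(1)] that, of r a b]
      by auto
  qed
  have C: "?T closure_of B \<in> sets ?M" by (rule closedin_euclid_sets[OF assms(1) closedin_closure_of])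
  have U: "?T interior_of B \<in> sets ?M" by (rule openin_euclid_sets[OF assms(1) openin_interior_of])
  have BT: "B \<subseteq> topspace ?T" using assms(2) by (simp add: jordan_measurable_on_def topspace_euclid_topology)
  have "emeasure (euclid_lebesgue I) (?V B) \<le> emeasure (euclid_lebesgue I) (?V (?T closure_of B))"
    using V[OF C] closure_of_subset[OF BT] by (intro emeasure_mono) (auto simp: euclid_lebesgue_def)
  then have 1: "emeasure (euclid_lebesgue I) (?V B) \<le> emeasure (euclid_lebesgue I) B"
    using V[OF C] jordan_measurable_on_sets(2)[OF assms(1,2)] by (simp add: euclid_lebesgue_def)
  have "emeasure (euclid_lebesgue I) (?V (?T interior_of B)) \<le> emeasure (euclid_lebesgue I) (?V B)"
    using jordan_measurable_on_sets(1)[OF assms(1,3)] interior_of_subset[of ?T B] by (intro emeasure_mono) auto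
  then have "emeasure (euclid_lebesgue I) B \<le> emeasure (euclid_lebesgue I) (?V B)"
    using V[OF U] jordan_measurable_on_sets(3)[OF assms(1,2)] by (simp add: euclid_lebesgue_def)
  with 1 show ?thesis by (rule antisym)
qed

lemma shear_bounded:
  assumes "finite I" "\<forall>y\<in>B. \<forall>i\<in>I. \<bar>y i\<bar> \<le> c"
  obtains c' where "\<forall>y\<in>B. \<forall>i\<in>I. \<bar>shear I r a b y i\<bar> \<le> c'"
proof -
  define d where "d i = c + \<bar>b i\<bar> + (\<Sum>j\<in>{j\<in>I. r j < r i}. \<bar>a i j\<bar> * c)" for i
  have "\<bar>shear I r a b y i\<bar> \<le> (\<Sum>k\<in>I. \<bar>d k\<bar>)" if "y \<in> B" "i \<in> I" for y i
  proof -
    have "\<bar>\<Sum>j\<in>{j\<in>I. r j < r i}. a i j * y j\<bar> \<le> (\<Sum>j\<in>{j\<in>I. r j < r i}. \<bar>a i j\<bar> * c)"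
      using assms(2) that by (intro sum_abs[THEN order_trans] sum_mono) (auto simp: abs_mult mult_left_mono)
    moreover have "\<bar>y i\<bar> \<le> c" using assms(2) that by blast
    ultimately have "\<bar>shear I r a b y i\<bar> \<le> d i" using that by (simp add: shear_def d_def)
    also have "\<dots> \<le> \<bar>d i\<bar>" by simp
    also have "\<dots> \<le> (\<Sum>k\<in>I. \<bar>d k\<bar>)" using assms(1) that by (intro member_le_sum) auto
    finally show ?thesis .
  qed
  then show thesis using that by blast
qed

lemma null_frontier_unit_cube:
  assumes "finite I"
  shows "null_frontier I (I \<rightarrow>\<^sub>E {0..<1})"
proof (rule null_frontier_subset)
  let ?T = "euclid_topology I" and ?M = "Pi\<^sub>M I (\<lambda>_. lborel :: real measure)"
  let ?C = "I \<rightarrow>\<^sub>E {0..1::real}" and ?U = "I \<rightarrow>\<^sub>E {0<..<1::real}"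
  have C: "closedin ?T ?C" by (rule closedin_euclid_topology_PiE) simp
  have U: "openin ?T ?U"
    unfolding euclid_topology_def openin_PiE_gen using assms by auto
  have "?T frontier_of (I \<rightarrow>\<^sub>E {0..<1}) \<subseteq> ?C - ?U"
    unfolding frontier_of_def
    by (intro Diff_mono closure_of_minimal[OF _ C] interior_of_maximal[OF _ U] PiE_mono) auto
  then show "?T frontier_of (I \<rightarrow>\<^sub>E {0..<1}) \<subseteq> ?C - ?U" .
  have Cm: "?C \<in> sets ?M" "?U \<in> sets ?M"
    using closedin_euclid_sets[OF assms C] openin_euclid_sets[OF assms U] by auto
  have "emeasure ?M ?C = 1" "emeasure ?M ?U = 1"
    using assms by (simp_all add: lborel_product.emeasure_PiM)
  moreover have "?U \<subseteq> ?C" by (intro PiE_mono) auto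
  ultimately have "?C - ?U \<in> null_sets ?M"
    using Cm by (auto simp: null_sets_def emeasure_Diff)
  then show "?C - ?U \<in> null_sets (euclid_lebesgue I)"
    unfolding euclid_lebesgue_def by (rule null_sets_completionI)
qed (auto intro: PiE_mono[THEN subsetD])

section \<open>Unwinding the powers of the matrix\<close>

text \<open>
  The shear with coefficients \<open>unwind L\<close> is \<open>w \<mapsto> (w\<^sub>k - L w\<^sub>k\<^sub>-\<^sub>1)\<^sub>k\<close> with \<open>w\<^sub>0 = 0\<close>; its inverse has the
  coefficients \<open>rewind L\<close>.
\<close>

definition unwind :: "real^'n^'n \<Rightarrow> nat \<times> 'n \<Rightarrow> nat \<times> 'n \<Rightarrow> real" where
  "unwind L = (\<lambda>(k, i) (l, j). if k = Suc l then - L $ i $ j else 0)"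

definition rewind :: "real^'n^'n \<Rightarrow> nat \<times> 'n \<Rightarrow> nat \<times> 'n \<Rightarrow> real" where
  "rewind L = (\<lambda>(k, i) (l, j). matrix_power L (k - l) $ i $ j)"

definition block :: "nat \<Rightarrow> (nat \<times> 'n \<Rightarrow> 'a) \<Rightarrow> 'a^'n" where
  "block k y = (\<chi> i. y (k, i))"

lemma matrix_power_Suc: "matrix_power L (Suc m) *v v = L *v (matrix_power L m *v v)"
  by (simp add: matrix_power_def matrix_vector_mul_assoc)

lemma matrix_power_0: "matrix_power L 0 = mat 1"
  by (simp add: matrix_power_def)

text \<open>The rank of a coordinate is its block number, so the coordinates of smaller rank are
  those of the earlier blocks.\<close>

lemma sum_lower_blocks:
  fixes f :: "nat \<times> 'n::finite \<Rightarrow> real"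
  assumes "k \<le> Suc N"
  shows "(\<Sum>p\<in>{p\<in>block_index N. fst p < k}. f p) = (\<Sum>l\<in>{1..<k}. \<Sum>j\<in>UNIV. f (l, j))"
proof -
  have "{p\<in>block_index N. fst p < k} = {1..<k} \<times> (UNIV :: 'n set)"
    using assms by (auto simp: block_index_def)
  then show ?thesis by (simp add: sum.cartesian_product)
qed

lemma block_unwind:
  fixes w :: "nat \<times> 'n::finite \<Rightarrow> real"
  assumes "k \<in> {1..N}"
  shows "block k (shear (block_index N) fst (unwind L) (\<lambda>_. 0) w)
    = block k w - (if k = 1 then 0 else L *v block (k - 1) w)"
proof -
  have "shear (block_index N) fst (unwind L) (\<lambda>_. 0) w (k, i)
      = w (k, i) + (\<Sum>l\<in>{1..<k}. \<Sum>j\<in>UNIV. unwind L (k, i) (l, j) * w (l, j))" for i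
    using assms sum_lower_blocks[of k N "\<lambda>p. unwind L (k, i) p * w p"] by (simp add: shear_def block_index_def)
  moreover have "(\<Sum>l\<in>{1..<k}. \<Sum>j\<in>UNIV. unwind L (k, i) (l, j) * w (l, j))
      = - (if k = 1 then 0 else (L *v block (k - 1) w) $ i)" for i
  proof (cases "k = 1")
    case False
    then have k: "k - 1 \<in> {1..<k}" "Suc (k - 1) = k" using assms by auto
    have "(\<Sum>l\<in>{1..<k}. \<Sum>j\<in>UNIV. unwind L (k, i) (l, j) * w (l, j))
        = (\<Sum>l\<in>{1..<k}. if l = k - 1 then - (\<Sum>j\<in>UNIV. L $ i $ j * w (l, j)) else 0)"
    proof (rule sum.cong[OF refl])
      fix l assume "l \<in> {1..<k}"
      have "k = Suc l \<longleftrightarrow> l = k - 1" using k by auto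
      then show "(\<Sum>j\<in>UNIV. unwind L (k, i) (l, j) * w (l, j))
          = (if l = k - 1 then - (\<Sum>j\<in>UNIV. L $ i $ j * w (l, j)) else 0)"
        by (cases "l = k - 1") (simp_all add: unwind_def sum_negf)
    qed
    also have "\<dots> = - (\<Sum>j\<in>UNIV. L $ i $ j * w (k - 1, j))" using k by (subst sum.delta) auto
    finally show ?thesis using False by (simp add: matrix_vector_mult_def block_def)
  qed simp
  ultimately show ?thesis by (simp add: vec_eq_iff block_def)
qed

lemma block_rewind:
  fixes w :: "nat \<times> 'n::finite \<Rightarrow> real"
  assumes "k \<in> {1..N}"
  shows "block k (shear (block_index N) fst (rewind L) b w)
    = block k w + block k b + (\<Sum>l\<in>{1..<k}. matrix_power L (k - l) *v block l w)"
proof -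
  have "shear (block_index N) fst (rewind L) b w (k, i)
      = w (k, i) + b (k, i) + (\<Sum>l\<in>{1..<k}. \<Sum>j\<in>UNIV. rewind L (k, i) (l, j) * w (l, j))" for i
    using assms sum_lower_blocks[of k N "\<lambda>p. rewind L (k, i) p * w p"] by (simp add: shear_def block_index_def)
  then show ?thesis by (simp add: vec_eq_iff block_def rewind_def matrix_vector_mult_def)
qed

lemma block_ext:
  fixes y y' :: "nat \<times> 'n::finite \<Rightarrow> 'a"
  assumes "y \<in> block_index N \<rightarrow>\<^sub>E UNIV" "y' \<in> block_index N \<rightarrow>\<^sub>E UNIV"
    "\<And>k. k \<in> {1..N} \<Longrightarrow> block k y = block k y'"
  shows "y = y'"
proof (rule PiE_ext[OF assms(1,2)])
  fix p :: "nat \<times> 'n" assume "p \<in> block_index N"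
  then obtain k i where p: "p = (k, i)" "k \<in> {1..N}" by (auto simp: block_index_def)
  have "block k y $ i = block k y' $ i" using assms(3)[OF p(2)] by simp
  then show "y p = y' p" by (simp add: block_def p)
qed

text \<open>Solving u_k = w_k - L w_(k-1) recursively expresses w_k as the sum of L^(k-l) u_l over l
  from 1 to k. The offset b will be an integer vector, so the identity also covers lattice
  translates.\<close>

lemma rewind_unwind:
  fixes w :: "nat \<times> 'n::finite \<Rightarrow> real"
  shows "shear (block_index N) fst (rewind L) b (shear (block_index N) fst (unwind L) (\<lambda>_. 0) w)
    = (\<lambda>p\<in>block_index N. w p + b p)" (is "shear _ _ _ _ ?u = _")
proof (rule block_ext)
  fix k assume k: "k \<in> {1..N}"
  have "block k ?u + (\<Sum>l\<in>{1..<k}. matrix_power L (k - l) *v block l ?u) = block k w"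
    using k
  proof (induction k)
    case (Suc k)
    show ?case
    proof (cases "k = 0")
      case True
      then show ?thesis using Suc.prems by (simp add: block_unwind)
    next
      case False
      then have k: "k \<in> {1..N}" using Suc.prems by simp
      have "(\<Sum>l\<in>{1..<Suc k}. matrix_power L (Suc k - l) *v block l ?u)
          = (\<Sum>l\<in>{1..<k}. L *v (matrix_power L (k - l) *v block l ?u)) + L *v block k ?u"
        using k by (simp add: Suc_diff_le matrix_power_Suc matrix_power_0 less_imp_le)
      also have "\<dots> = L *v (block k ?u + (\<Sum>l\<in>{1..<k}. matrix_power L (k - l) *v block l ?u))"
        by (simp add: matrix_vector_right_distrib linear_sum[OF matrix_vector_mul_linear])
      also have "\<dots> = L *v block k w" using Suc.IH[OF k] by simp
      finally show ?thesis using block_unwind[OF Suc.prems, of L w] False by simp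
    qed
  qed simp
  then show "block k (shear (block_index N) fst (rewind L) b ?u) = block k (\<lambda>p\<in>block_index N. w p + b p)"
    unfolding block_rewind[OF k] using k by (simp add: block_def vec_eq_iff block_index_def algebra_simps)
qed (auto simp: shear_PiE)

section \<open>The quantized linear system\<close>

definition power_rows :: "real^'n^'n \<Rightarrow> nat \<times> 'n \<Rightarrow> real^'n" where
  "power_rows L = (\<lambda>(k, i). row i (matrix_power L k))"

text \<open>If an integer combination of the rows, with coefficients g, had only integer coordinates
  m, then g together with -m on the rows of the identity matrix would be a nontrivial rational
  relation.\<close>

lemma torus_free_power_rows:
  fixes L :: "real^'n^'n"
  assumes "iteratively_nonresonant L"
  shows "torus_free (block_index N) (power_rows L)"
  unfolding torus_free_def
proof (intro allI impI, rule ccontr)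
  fix g :: "nat \<times> 'n \<Rightarrow> int"
  define \<theta> where "\<theta> = (\<Sum>p\<in>block_index N. real_of_int (g p) *\<^sub>R power_rows L p)"
  assume g: "\<exists>p\<in>block_index N. g p \<noteq> 0"
    and "\<not> (\<exists>j. (\<Sum>p\<in>block_index N. real_of_int (g p) *\<^sub>R power_rows L p) $ j \<notin> \<int>)"
  then have "\<forall>j. \<exists>m :: int. \<theta> $ j = real_of_int m" by (auto simp: \<theta>_def elim: Ints_cases)
  then obtain m :: "'n \<Rightarrow> int" where m: "\<And>j. \<theta> $ j = real_of_int (m j)" by metis
  \<comment> \<open>Nonresonance speaks of integer exponents; \<open>f\<close> embeds the natural
    ones.\<close>
  define f where "f = (\<lambda>(k :: nat, i :: 'n). (int k, i))"
  define J where "J = f ` block_index N"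
  have injf: "inj_on f (block_index N)" by (auto simp: inj_on_def f_def)
  have J: "finite J" "J \<subseteq> (- {0}) \<times> UNIV"
    using finite_block_index by (auto simp: J_def f_def block_index_def)
  define \<Lambda> where "\<Lambda> = (\<lambda>(k, i). row i (matrix_int_power L k))"
  have \<Lambda>f: "\<Lambda> (int k, i) = power_rows L (k, i)" for k i
    by (simp add: \<Lambda>_def power_rows_def matrix_int_power_def)
  have "nonresonant J \<Lambda>"
    using assms J unfolding iteratively_nonresonant_def \<Lambda>_def by blast
  then have indep: "rationally_independent (UNIV <+> J) (case_sum (\<lambda>j. row j (mat 1 :: real^'n^'n)) \<Lambda>)"
    by (simp add: nonresonant_def)
  define c :: "'n + int \<times> 'n \<Rightarrow> rat" where
    "c = case_sum (\<lambda>j. - of_int (m j)) (\<lambda>(k, i). of_int (g (nat k, i)))"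
  have "(\<Sum>j\<in>UNIV <+> J. real_of_rat (c j) *\<^sub>R case_sum (\<lambda>j. row j (mat 1 :: real^'n^'n)) \<Lambda> j)
      = (\<Sum>j\<in>UNIV. - real_of_int (m j) *\<^sub>R row j (mat 1)) + (\<Sum>p\<in>J. real_of_rat (c (Inr p)) *\<^sub>R \<Lambda> p)"
    using J(1) by (simp add: sum.Plus c_def o_def of_rat_minus)
  also have "(\<Sum>p\<in>J. real_of_rat (c (Inr p)) *\<^sub>R \<Lambda> p) = \<theta>"
    unfolding J_def sum.reindex[OF injf] \<theta>_def
    by (intro sum.cong refl) (auto simp: \<Lambda>f c_def f_def)
  also have "(\<Sum>j\<in>UNIV. - real_of_int (m j) *\<^sub>R row j (mat 1 :: real^'n^'n)) + \<theta> = 0"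
    by (simp add: vec_eq_iff m row_def mat_def sum_negf if_distrib cong: if_cong)
  finally have "\<forall>j\<in>UNIV <+> J. c j = 0" using indep unfolding rationally_independent_def by blast
  then have c0: "c (Inr q) = 0" if "q \<in> J" for q using that by blast
  have "g p = 0" if p: "p \<in> block_index N" for p
  proof -
    have "f p \<in> J" using p by (simp add: J_def)
    from c0[OF this] show ?thesis by (cases p) (simp add: f_def c_def)
  qed
  then show False using g by blast
qed

lemma inner_power_rows: "block k (\<lambda>p. power_rows L p \<bullet> v) = matrix_power L k *v v"
  by (simp add: vec_eq_iff block_def power_rows_def row_def inner_vec_def matrix_vector_mult_def)

lemma quantizer_diff_eq_0_iff:
  assumes "quantizer R"
  shows "R (u - real_vec z) = 0 \<longleftrightarrow> z = R u"
proof -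
  have "R (u - real_vec z + real_vec z) = R (u - real_vec z) + z"
    using assms unfolding quantizer_def by blast
  then show ?thesis by auto
qed

lemma quantization_error_eq:
  assumes "1 \<le> k"
  shows "quantization_error R L k x
    = L *v real_vec ((quantized_map R L ^^ (k - 1)) x) - real_vec ((quantized_map R L ^^ k) x)"
proof -
  obtain m where "k = Suc m" using assms by (cases k) auto
  then show ?thesis by (simp add: quantization_error_def one_step_error_def)
qed

lemma quantizer_quantization_error:
  assumes "quantizer R"
  shows "R (quantization_error R L k x) = 0"
  unfolding quantization_error_def one_step_error_def comp_def
  by (simp add: quantizer_diff_eq_0_iff[OF assms] quantized_map_def)

lemma block_stacked_errors:
  "k \<in> {1..N} \<Longrightarrow> block k (stacked_errors R L N x) = quantization_error R L k x"
  by (simp add: vec_eq_iff block_def stacked_errors_def block_index_def)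

lemma stacked_errors_PiE: "stacked_errors R L N x \<in> block_index N \<rightarrow>\<^sub>E UNIV"
  by (simp add: stacked_errors_def)

lemma block_set_alt: "block_set N C = {y \<in> block_index N \<rightarrow>\<^sub>E UNIV. \<forall>k\<in>{1..N}. block k y \<in> C k}"
  by (simp add: block_set_def block_def)

lemma stacked_errors_in_block_set:
  "stacked_errors R L N x \<in> block_set N C \<longleftrightarrow> (\<forall>k\<in>{1..N}. quantization_error R L k x \<in> C k)"
  by (auto simp: block_set_alt stacked_errors_PiE block_stacked_errors)

text \<open>The powers of L cancel between L^k x - z_k and L (L^(k-1) x - z_(k-1)). This holds for
  every integer family z, not just for an orbit, as uniqueness requires. Setting
  \<open>orb 0\<close> to x covers k = 1, where there is no previous block.\<close>

lemma block_unwind_residue: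
  fixes z :: "nat \<times> 'n::finite \<Rightarrow> int" and x :: "int^'n"
  assumes "k \<in> {1..N}"
  defines "orb \<equiv> \<lambda>m. if m = 0 then x else block m z"
  shows "block k (shear (block_index N) fst (unwind L) (\<lambda>_. 0)
      (\<lambda>p\<in>block_index N. power_rows L p \<bullet> real_vec x - real_of_int (z p)))
    = L *v real_vec (orb (k - 1)) - real_vec (orb k)"
proof -
  let ?w = "\<lambda>p\<in>block_index N. power_rows L p \<bullet> real_vec x - real_of_int (z p)"
  have w: "block l ?w = matrix_power L l *v real_vec x - real_vec (block l z)" if "l \<in> {1..N}" for l
  proof -
    have "block l ?w = block l (\<lambda>p. power_rows L p \<bullet> real_vec x) - real_vec (block l z)"
      using that by (simp add: vec_eq_iff block_def real_vec_def block_index_def)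
    then show ?thesis by (simp only: inner_power_rows)
  qed
  show ?thesis
  proof (cases "k = 1")
    case True
    then show ?thesis using assms(1)
      by (simp add: block_unwind w orb_def matrix_power_Suc[of L 0, simplified] matrix_power_0)
  next
    case False
    then have k: "k - 1 \<in> {1..N}" "k = Suc (k - 1)" using assms(1) by auto
    have "matrix_power L k *v real_vec x = L *v (matrix_power L (k - 1) *v real_vec x)"
      using matrix_power_Suc[of L "k - 1"] k(2) by metis
    then show ?thesis
      using False k(1) assms(1)
      by (simp add: block_unwind w orb_def matrix_vector_mult_diff_distrib)
  qed
qed

text \<open>The set of hits is determined, not only its size: the size gives the indicator for the
  frequency, and being nonempty expresses the preimage through residues modulo 1.\<close>

theorem lattice_hits_unwind:
  fixes R :: "real^'n \<Rightarrow> int^'n"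
  assumes "quantizer R" "B \<subseteq> block_set N (\<lambda>_. R -` {0})"
  defines "I \<equiv> block_index N"
  shows "lattice_hits I {y \<in> I \<rightarrow>\<^sub>E UNIV. shear I fst (unwind L) (\<lambda>_. 0) y \<in> B} (\<lambda>p. power_rows L p \<bullet> real_vec x)
    = (if stacked_errors R L N x \<in> B then {\<lambda>(k, i)\<in>I. (quantized_map R L ^^ k) x $ i} else {})"
proof -
  let ?T = "quantized_map R L"
  define \<zeta> where "\<zeta> = (\<lambda>(k, i)\<in>I. (?T ^^ k) x $ i)"
  define F where "F z = shear I fst (unwind L) (\<lambda>_. 0) (\<lambda>p\<in>I. power_rows L p \<bullet> real_vec x - real_of_int (z p))"
    for z :: "nat \<times> 'n \<Rightarrow> int"
  define orb where "orb z m = (if m = 0 then x else block m z)" for z :: "nat \<times> 'n \<Rightarrow> int" and m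
  have F: "block k (F z) = L *v real_vec (orb z (k - 1)) - real_vec (orb z k)" if "k \<in> {1..N}" for k z
    unfolding F_def orb_def I_def by (rule block_unwind_residue[OF that])
  have \<zeta>: "\<zeta> \<in> I \<rightarrow>\<^sub>E UNIV" by (simp add: \<zeta>_def)
  have orb\<zeta>: "orb \<zeta> k = (?T ^^ k) x" if "k \<le> N" for k
    using that by (auto simp: orb_def \<zeta>_def I_def block_def block_index_def vec_eq_iff)
  have F\<zeta>: "F \<zeta> = stacked_errors R L N x"
  proof (rule block_ext)
    show "F \<zeta> \<in> block_index N \<rightarrow>\<^sub>E UNIV" by (simp add: F_def I_def shear_PiE)
    fix k assume k: "k \<in> {1..N}"
    then have k': "k - 1 \<le> N" "k \<le> N" by auto
    from k show "block k (F \<zeta>) = block k (stacked_errors R L N x)"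
      using F[OF k, of \<zeta>] orb\<zeta>[OF k'(1)] orb\<zeta>[OF k'(2)]
      by (simp add: block_stacked_errors quantization_error_eq)
  qed (rule stacked_errors_PiE)
  have uniq: "z = \<zeta>" if z: "z \<in> I \<rightarrow>\<^sub>E UNIV" "F z \<in> B" for z
  proof -
    have orb: "orb z k = (?T ^^ k) x" if "k \<le> N" for k
      using that
    proof (induction k)
      case (Suc k)
      then have k: "Suc k \<in> {1..N}" by simp
      \<comment> \<open>Lying in the cell forces the next integer vector to be R (L z), where z is
        the current orbit point.\<close>
      then have "R (block (Suc k) (F z)) = 0" using z(2) assms(2) by (auto simp: block_set_alt)
      then have "orb z (Suc k) = R (L *v real_vec (orb z k))"
        unfolding F[OF k] quantizer_diff_eq_0_iff[OF assms(1)] by simp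
      then show ?case using Suc by (simp add: quantized_map_def)
    qed (simp add: orb_def)
    show ?thesis
    proof (rule block_ext)
      show "z \<in> block_index N \<rightarrow>\<^sub>E UNIV" "\<zeta> \<in> block_index N \<rightarrow>\<^sub>E UNIV" using z(1) \<zeta> by (simp_all add: I_def)
      show "block k z = block k \<zeta>" if "k \<in> {1..N}" for k
        using orb[of k] orb\<zeta>[of k] that by (simp add: orb_def)
    qed
  qed
  have "lattice_hits I {y \<in> I \<rightarrow>\<^sub>E UNIV. shear I fst (unwind L) (\<lambda>_. 0) y \<in> B} (\<lambda>p. power_rows L p \<bullet> real_vec x)
      = {z \<in> I \<rightarrow>\<^sub>E UNIV. F z \<in> B}"
    by (auto simp: lattice_hits_def F_def)
  also have "\<dots> = (if stacked_errors R L N x \<in> B then {\<zeta>} else {})"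
  proof (cases "stacked_errors R L N x \<in> B")
    case True
    then have "{z \<in> I \<rightarrow>\<^sub>E UNIV. F z \<in> B} = {\<zeta>}"
      using uniq \<zeta> unfolding F\<zeta>[symmetric] by blast
    then show ?thesis using True by (simp only: if_True)
  next
    case False
    then have "{z \<in> I \<rightarrow>\<^sub>E UNIV. F z \<in> B} = {}"
      using uniq unfolding F\<zeta>[symmetric] by blast
    then show ?thesis using False by (simp only: if_False)
  qed
  finally show ?thesis by (simp add: \<zeta>_def)
qed

text \<open>Any shear preimage keeps a null frontier; boundedness holds because the inverse shear
  \<open>rewind L\<close> is bounded on B.\<close>

lemma jordan_measurable_unwind_vimage:
  fixes B :: "(nat \<times> 'n::finite \<Rightarrow> real) set"
  assumes "jordan_measurable_on (block_index N) B"
  shows "jordan_measurable_on (block_index N)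
    {y \<in> block_index N \<rightarrow>\<^sub>E UNIV. shear (block_index N) fst (unwind L) (\<lambda>_. 0) y \<in> B}" (is "jordan_measurable_on ?I ?V")
proof -
  obtain c where c: "\<forall>y\<in>B. \<forall>p\<in>?I. \<bar>y p\<bar> \<le> c" using assms by (auto simp: jordan_measurable_on_def)
  obtain c' where c': "\<forall>y\<in>B. \<forall>p\<in>?I. \<bar>shear ?I fst (rewind L) (\<lambda>_. 0) y p\<bar> \<le> c'"
    by (rule shear_bounded[OF finite_block_index c])
  have b: "\<bar>y p\<bar> \<le> c'" if "y \<in> ?V" "p \<in> ?I" for y p
  proof -
    have "shear ?I fst (rewind L) (\<lambda>_. 0) (shear ?I fst (unwind L) (\<lambda>_. 0) y) p = y p"
      using that by (simp add: rewind_unwind)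
    then show ?thesis using c' that by (metis (mono_tags, lifting) mem_Collect_eq)
  qed
  have "null_frontier ?I ?V"
    using assms by (intro null_frontier_shear_vimage finite_block_index) (simp add: jordan_measurable_on_iff)
  then show ?thesis unfolding jordan_measurable_on_iff using b by blast
qed

theorem frequency_stacked_errors:
  fixes R :: "real^'n \<Rightarrow> int^'n"
  assumes "quantizer R" "iteratively_nonresonant L"
    "jordan_measurable_on (block_index N) B" "B \<subseteq> block_set N (\<lambda>_. R -` {0})"
  shows "frequency_measurable (stacked_errors R L N -` B) \<and>
    frequency (stacked_errors R L N -` B) = measure (euclid_lebesgue (block_index N)) B"
proof (rule frequency_indicatorI)
  let ?I = "block_index N :: (nat \<times> 'n) set"
  let ?V = "{y \<in> ?I \<rightarrow>\<^sub>E UNIV. shear ?I fst (unwind L) (\<lambda>_. 0) y \<in> B}"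
  have V: "jordan_measurable_on ?I ?V" by (rule jordan_measurable_unwind_vimage[OF assms(3)])
  have "hit_count ?I ?V (\<lambda>p. power_rows L p \<bullet> real_vec x) = indicat_real (stacked_errors R L N -` B) x" for x
    unfolding hit_count_def lattice_hits_unwind[OF assms(1,4)] by (simp add: indicator_def)
  moreover have "measure (euclid_lebesgue ?I) ?V = measure (euclid_lebesgue ?I) B"
    using emeasure_jordan_shear_vimage[OF finite_block_index assms(3) V] by (simp add: measure_def)
  ultimately show "(box_average (indicat_real (stacked_errors R L N -` B)) \<longlongrightarrow> measure (euclid_lebesgue ?I) B) box_filter"
    using box_average_jordan[OF finite_block_index torus_free_power_rows[OF assms(2)] V] by simp
qed

lemma forward_algebra_upto_eq: "forward_algebra_upto L N = quasiperiodic_algebra (block_index N) (power_rows L)"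
  by (simp add: forward_algebra_upto_def power_rows_def)

text \<open>\<open>G\<close> is the unwound set \<open>?V\<close> reduced modulo 1: the union of the
  parts of its integer translates in the unit cube. Boundedness leaves finitely many translates, so
  the frontier of the union stays null.\<close>

theorem stacked_errors_vimage_in_forward_algebra:
  fixes R :: "real^'n \<Rightarrow> int^'n"
  assumes "quantizer R" "jordan_measurable_on (block_index N) B" "B \<subseteq> block_set N (\<lambda>_. R -` {0})"
  shows "stacked_errors R L N -` B \<in> forward_algebra_upto L N"
proof -
  let ?I = "block_index N :: (nat \<times> 'n) set"
  let ?V = "{y \<in> ?I \<rightarrow>\<^sub>E UNIV. shear ?I fst (unwind L) (\<lambda>_. 0) y \<in> B}"
  have fin: "finite ?I" by (rule finite_block_index)
  have V: "jordan_measurable_on ?I ?V" by (rule jordan_measurable_unwind_vimage[OF assms(2)])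
  then obtain c where c: "\<forall>y\<in>?V. \<forall>p\<in>?I. \<bar>y p\<bar> \<le> c" by (auto simp: jordan_measurable_on_def)
  \<comment> \<open>If g is in the unit cube and g - z in \<open>?V\<close>, the entries of z are at
    most c + 1 in absolute value; the range is rounded outwards.\<close>
  define Z where "Z = PiE ?I (\<lambda>_. {\<lfloor>- c\<rfloor> - 1..\<lceil>c\<rceil> + 1})"
  have finZ: "finite Z" using fin by (auto simp: Z_def intro: finite_PiE)
  define tr where "tr z g = (\<lambda>p\<in>?I. g p - real_of_int (z p))" for z :: "nat \<times> 'n \<Rightarrow> int" and g
  have tr: "tr z g = shear ?I fst (\<lambda>_ _. 0) (\<lambda>p. - real_of_int (z p)) g" for z g
    by (auto simp: tr_def shear_def)
  define G where "G = (\<Union>z\<in>Z. (?I \<rightarrow>\<^sub>E {0..<1}) \<inter> {g \<in> ?I \<rightarrow>\<^sub>E UNIV. tr z g \<in> ?V})"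
  have Vn: "null_frontier ?I ?V" using V unfolding jordan_measurable_on_iff by blast
  have "null_frontier ?I G"
    unfolding G_def tr
    by (rule null_frontier_UN[OF finZ])
      (rule null_frontier_Int[OF null_frontier_unit_cube[OF fin] null_frontier_shear_vimage[OF fin Vn]])
  moreover have GI: "G \<subseteq> (?I \<rightarrow>\<^sub>E {0..<1})" by (auto simp: G_def)
  moreover have "\<forall>y\<in>G. \<forall>i\<in>?I. \<bar>y i\<bar> \<le> 1" using GI by (fastforce simp: PiE_iff)
  ultimately have G: "jordan_measurable_on ?I G" by (auto simp: jordan_measurable_on_iff)
  have inG: "g \<in> G" if g: "g \<in> ?I \<rightarrow>\<^sub>E {0..<1}" and z: "tr z g \<in> ?V" for g z
  proof -
    have "restrict z ?I \<in> Z"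
      unfolding Z_def
    proof (intro PiE_I)
      fix p assume p: "p \<in> ?I"
      have "\<bar>tr z g p\<bar> \<le> c" using c z p by blast
      moreover have "0 \<le> g p" "g p < 1" using g p by (auto simp: PiE_iff)
      ultimately have "- c - 1 \<le> real_of_int (z p)" "real_of_int (z p) \<le> c + 1"
        using p by (simp_all add: tr_def abs_le_iff)
      then show "restrict z ?I p \<in> {\<lfloor>- c\<rfloor> - 1..\<lceil>c\<rceil> + 1}"
        using p by (simp, linarith)
    qed simp
    moreover have "tr (restrict z ?I) g = tr z g" by (auto simp: tr_def)
    ultimately show ?thesis using g z by (auto simp: G_def intro!: bexI[of _ "restrict z ?I"])
  qed
  have "stacked_errors R L N -` B = quasiperiodic_set ?I G (power_rows L)"
  proof (intro set_eqI)
    fix x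
    define v where "v p = power_rows L p \<bullet> real_vec x" for p
    have "x \<in> stacked_errors R L N -` B \<longleftrightarrow> lattice_hits ?I ?V v \<noteq> {}"
      unfolding v_def lattice_hits_unwind[OF assms(1,3)] by simp
    also have "\<dots> \<longleftrightarrow> (\<exists>z. tr z v \<in> ?V)"
    proof
      assume "lattice_hits ?I ?V v \<noteq> {}" then show "\<exists>z. tr z v \<in> ?V" by (auto simp: lattice_hits_def tr_def)
    next
      assume "\<exists>z. tr z v \<in> ?V"
      then obtain z where "tr z v \<in> ?V" by blast
      moreover have "tr (restrict z ?I) v = tr z v" by (auto simp: tr_def)
      ultimately have "restrict z ?I \<in> lattice_hits ?I ?V v" by (simp add: lattice_hits_def tr_def)
      then show "lattice_hits ?I ?V v \<noteq> {}" by blast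
    qed
    also have "\<dots> \<longleftrightarrow> (\<exists>g\<in>G. \<exists>z. \<forall>p\<in>?I. v p = g p + real_of_int (z p))"
    proof
      assume "\<exists>z. tr z v \<in> ?V"
      then obtain z where z: "tr z v \<in> ?V" by blast
      define g where "g = (\<lambda>p\<in>?I. v p - real_of_int \<lfloor>v p\<rfloor>)"
      have g: "g \<in> ?I \<rightarrow>\<^sub>E {0..<1}" by (auto simp: g_def) linarith
      have "tr (\<lambda>p. z p - \<lfloor>v p\<rfloor>) g = tr z v" by (auto simp: tr_def g_def)
      then have "tr (\<lambda>p. z p - \<lfloor>v p\<rfloor>) g \<in> ?V" using z by (simp only:)
      then have "g \<in> G" by (rule inG[OF g])
      moreover have "\<forall>p\<in>?I. v p = g p + real_of_int \<lfloor>v p\<rfloor>" by (simp add: g_def)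
      ultimately show "\<exists>g\<in>G. \<exists>z. \<forall>p\<in>?I. v p = g p + real_of_int (z p)"
        by (intro bexI[of _ g] exI[of _ "\<lambda>p. \<lfloor>v p\<rfloor>"])
    next
      assume "\<exists>g\<in>G. \<exists>z. \<forall>p\<in>?I. v p = g p + real_of_int (z p)"
      then obtain g z' z where "\<forall>p\<in>?I. v p = g p + real_of_int (z' p)" and z: "tr z g \<in> ?V"
        unfolding G_def by blast
      then have "tr (\<lambda>p. z' p + z p) v = tr z g" by (auto simp: tr_def)
      then have "tr (\<lambda>p. z' p + z p) v \<in> ?V" using z by (simp only:)
      then show "\<exists>z. tr z v \<in> ?V" by (rule exI[where x = "\<lambda>p. z' p + z p"])
    qed
    finally show "x \<in> stacked_errors R L N -` B \<longleftrightarrow> x \<in> quasiperiodic_set ?I G (power_rows L)"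
      by (simp add: quasiperiodic_set_def v_def)
  qed
  then show ?thesis using G GI unfolding forward_algebra_upto_eq quasiperiodic_algebra_def by blast
qed

section \<open>Error spaces, their measures and the converse inclusion\<close>

abbreviation error_cell :: "(real^'n \<Rightarrow> int^'n) \<Rightarrow> (real^'n) set" where
  "error_cell R \<equiv> R -` {0}"

lemma quantizer_jordan: "quantizer R \<Longrightarrow> jordan_measurable (error_cell R)"
  by (simp add: quantizer_def)

lemma stacked_error_space_eq:
  "stacked_error_space R N = subtopology (euclid_topology (block_index N)) (block_set N (\<lambda>_. error_cell R))"
  by (simp add: stacked_error_space_def block_set_def)

lemma topspace_stacked_error_space: "topspace (stacked_error_space R N) = block_set N (\<lambda>_. error_cell R)"
  by (auto simp: stacked_error_space_eq topspace_euclid_topology block_set_def)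

lemma topspace_error_space: "topspace (error_space R) = error_cell R"
  by (simp add: error_space_def)

context
  fixes R :: "real^'n \<Rightarrow> int^'n" and N :: nat
  assumes quantizer: "quantizer R" and N: "0 < N"
begin

private lemma stacked_restriction_assms:
  shows "\<And>U. openin (euclid_topology (block_index N :: (nat \<times> 'n) set)) U \<Longrightarrow> U \<in> sets (Pi\<^sub>M (block_index N) (\<lambda>_. lborel))"
    and "space (Pi\<^sub>M (block_index N :: (nat \<times> 'n) set) (\<lambda>_. lborel :: real measure)) = topspace (euclid_topology (block_index N))"
    and "block_set N (\<lambda>_. error_cell R) \<subseteq> topspace (euclid_topology (block_index N))"
    and "euclid_topology (block_index N) frontier_of block_set N (\<lambda>_. error_cell R)
      \<in> null_sets (completion (Pi\<^sub>M (block_index N) (\<lambda>_. lborel)))"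
proof -
  have "jordan_measurable_on (block_index N) (block_set N (\<lambda>_. error_cell R))"
    by (rule jordan_measurable_block_set(1)[OF N quantizer_jordan[OF quantizer]])
  then show "block_set N (\<lambda>_. error_cell R) \<subseteq> topspace (euclid_topology (block_index N))"
    "euclid_topology (block_index N) frontier_of block_set N (\<lambda>_. error_cell R)
      \<in> null_sets (completion (Pi\<^sub>M (block_index N) (\<lambda>_. lborel)))"
    by (simp_all add: jordan_measurable_on_def topspace_euclid_topology euclid_lebesgue_def)
qed (simp_all add: openin_euclid_sets finite_block_index space_PiM topspace_euclid_topology)

lemma stacked_error_measure_eq:
  "stacked_error_measure R N = borel_restriction
    (subtopology (euclid_topology (block_index N)) (block_set N (\<lambda>_. error_cell R)))
    (completion (Pi\<^sub>M (block_index N) (\<lambda>_. lborel)))"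
  by (simp add: stacked_error_measure_def stacked_error_space_eq euclid_lebesgue_def)

lemma space_stacked_error_measure: "space (stacked_error_measure R N) = topspace (stacked_error_space R N)"
  unfolding stacked_error_measure_eq stacked_error_space_eq
  by (rule space_borel_restriction[OF stacked_restriction_assms])

lemma sets_stacked_error_measure: "sets (stacked_error_measure R N) = borel_sets (stacked_error_space R N)"
  unfolding stacked_error_measure_eq stacked_error_space_eq
  by (rule sets_borel_restriction[OF stacked_restriction_assms])

lemma emeasure_stacked_error_measure:
  "A \<in> borel_sets (stacked_error_space R N) \<Longrightarrow>
    emeasure (stacked_error_measure R N) A = emeasure (euclid_lebesgue (block_index N)) A"
  unfolding stacked_error_measure_eq stacked_error_space_eq euclid_lebesgue_def
  by (rule emeasure_borel_restriction[OF stacked_restriction_assms])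

lemma borel_sets_stacked_error_space:
  "A \<in> borel_sets (stacked_error_space R N) \<Longrightarrow> A \<subseteq> block_set N (\<lambda>_. error_cell R)"
  unfolding stacked_error_space_eq
  by (rule conjunct2[OF borel_sets_subtopology[OF stacked_restriction_assms]])

text \<open>Turns the relative boundary condition on the sets of the generated algebra into the
  ambient form in which the frequency theorem applies.\<close>

lemma jordan_measurable_on_stacked:
  assumes "A \<in> borel_sets (stacked_error_space R N)"
    "measure (stacked_error_measure R N) (stacked_error_space R N frontier_of A) = 0"
  shows "jordan_measurable_on (block_index N) A"
proof -
  note J = jordan_measurable_block_set[OF N quantizer_jordan[OF quantizer]]
  have "emeasure (completion (Pi\<^sub>M (block_index N) (\<lambda>_. lborel))) (block_set N (\<lambda>_. error_cell R)) \<noteq> \<infinity>"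
    using J(3) by (simp add: euclid_lebesgue_def)
  from null_frontier_borel_restriction[OF stacked_restriction_assms this]
  have "euclid_topology (block_index N) frontier_of A \<in> null_sets (euclid_lebesgue (block_index N))"
    using assms unfolding stacked_error_measure_eq stacked_error_space_eq euclid_lebesgue_def by blast
  then show ?thesis
    using J(1) borel_sets_stacked_error_space[OF assms(1)] unfolding jordan_measurable_on_def by blast
qed

lemma measure_stacked_frontier:
  assumes "A \<subseteq> block_set N (\<lambda>_. error_cell R)" "null_frontier (block_index N) A"
  shows "measure (stacked_error_measure R N) (stacked_error_space R N frontier_of A) = 0"
  unfolding stacked_error_measure_eq stacked_error_space_eq
  by (rule borel_restriction_null_frontier[OF stacked_restriction_assms])
    (use assms in \<open>auto simp: null_frontier_def euclid_lebesgue_def\<close>)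

text \<open>Points are closed, so countable sets are Borel. This permits correcting a set at the
  values attained by the errors.\<close>

lemma countable_borel_sets_stacked:
  assumes "countable A" "A \<subseteq> block_set N (\<lambda>_. error_cell R)"
  shows "A \<in> borel_sets (stacked_error_space R N)"
proof -
  have single: "{y} \<in> sets (stacked_error_measure R N)" if "y \<in> A" for y
  proof -
    have yX: "y \<in> block_set N (\<lambda>_. error_cell R)" using assms(2) that by blast
    then have "y \<in> block_index N \<rightarrow>\<^sub>E UNIV" by (simp add: block_set_def)
    then have "PiE (block_index N) (\<lambda>p. {y p}) = {y}" by (auto simp: PiE_singleton PiE_iff)
    then have "closedin (euclid_topology (block_index N)) {y}"
      using closedin_euclid_topology_PiE[of "block_index N" "\<lambda>p. {y p}"] by simp
    then have "closedin (stacked_error_space R N) {y}"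
      unfolding stacked_error_space_eq closedin_subtopology using yX by blast
    then have "openin (stacked_error_space R N) (topspace (stacked_error_space R N) - {y})"
      by (simp add: closedin_def)
    then have "topspace (stacked_error_space R N) - {y} \<in> sets (stacked_error_measure R N)"
      unfolding sets_stacked_error_measure borel_sets_def by blast
    from sets.compl_sets[OF this] show ?thesis
      using yX unfolding space_stacked_error_measure topspace_stacked_error_space by (simp add: double_diff)
  qed
  have "A \<in> sets (stacked_error_measure R N)" by (rule sets.countable[OF single assms(1)])
  then show ?thesis by (simp add: sets_stacked_error_measure)
qed

text \<open>\<open>B0\<close> consists of the points y of the error space whose rewound vector is
  congruent modulo 1 to a point of \<open>G\<close>. For y = \<open>?E x\<close> the rewound vector
  is congruent to the stack of the L^k x, so y lies in \<open>B0\<close> exactly if x lies in the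
  quasiperiodic set.\<close>

lemma quasiperiodic_set_vimage_stacked_errors:
  assumes GI: "G \<subseteq> block_index N \<rightarrow>\<^sub>E {0..<1}" and G: "jordan_measurable_on (block_index N) G"
  obtains B where "B \<in> borel_sets (stacked_error_space R N)"
    "measure (stacked_error_measure R N) (stacked_error_space R N frontier_of B) = 0"
    "stacked_errors R L N -` B = quasiperiodic_set (block_index N) G (power_rows L)"
proof -
  let ?I = "block_index N :: (nat \<times> 'n) set" and ?S = "stacked_error_space R N"
  let ?X = "block_set N (\<lambda>_. error_cell R)" and ?E = "stacked_errors R L N"
  define sh where "sh z y = shear ?I fst (rewind L) (\<lambda>p. real_of_int (z p)) y" for z :: "nat \<times> 'n \<Rightarrow> int" and y
  note J = jordan_measurable_block_set[OF N quantizer_jordan[OF quantizer]]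
  have fin: "finite ?I" by (rule finite_block_index)
  obtain c where "\<forall>y\<in>?X. \<forall>p\<in>?I. \<bar>y p\<bar> \<le> c" using J(1) by (auto simp: jordan_measurable_on_def)
  then obtain c' where c': "\<forall>y\<in>?X. \<forall>p\<in>?I. \<bar>shear ?I fst (rewind L) (\<lambda>_. 0) y p\<bar> \<le> c'"
    by (rule shear_bounded[OF fin])
  \<comment> \<open>Rewound vectors are bounded by c' on the error space, so only finitely many
    integer shifts can bring one into the unit cube.\<close>
  define Z where "Z = PiE ?I (\<lambda>_. {\<lfloor>- c'\<rfloor> - 1..\<lceil>c'\<rceil> + 1})"
  have finZ: "finite Z" using fin by (auto simp: Z_def intro: finite_PiE)
  define B0 where "B0 = ?X \<inter> (\<Union>z\<in>Z. {y \<in> ?I \<rightarrow>\<^sub>E UNIV. sh z y \<in> G})"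
  have nX: "null_frontier ?I ?X" using J(1) by (simp add: jordan_measurable_on_iff)
  have nG: "null_frontier ?I G" using G by (simp add: jordan_measurable_on_iff)
  have nB0: "null_frontier ?I B0"
    unfolding B0_def sh_def
    by (intro null_frontier_Int nX null_frontier_UN finZ null_frontier_shear_vimage[OF fin nG])
  have inB0: "y \<in> B0" if y: "y \<in> ?X" and z: "sh z y \<in> G" for y z
  proof -
    have rz: "restrict z ?I \<in> Z"
      unfolding Z_def
    proof (intro PiE_I)
      fix p assume p: "p \<in> ?I"
      have "\<bar>shear ?I fst (rewind L) (\<lambda>_. 0) y p\<bar> \<le> c'" using c' y p by blast
      moreover have "sh z y p = shear ?I fst (rewind L) (\<lambda>_. 0) y p + real_of_int (z p)"
        using p by (simp add: sh_def shear_def)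
      moreover have "0 \<le> sh z y p" "sh z y p < 1" using subsetD[OF GI z] p by (auto simp: PiE_iff)
      ultimately have "- c' - 1 \<le> real_of_int (z p)" "real_of_int (z p) \<le> c' + 1"
        by (simp_all add: abs_le_iff)
      then show "restrict z ?I p \<in> {\<lfloor>- c'\<rfloor> - 1..\<lceil>c'\<rceil> + 1}"
        using p by (simp, linarith)
    qed simp
    have "sh (restrict z ?I) y = sh z y" by (auto simp: sh_def shear_def)
    moreover have "y \<in> ?I \<rightarrow>\<^sub>E UNIV" using y by (simp add: block_set_def)
    ultimately have "y \<in> {y \<in> ?I \<rightarrow>\<^sub>E UNIV. sh (restrict z ?I) y \<in> G}" using z by simp
    with rz show ?thesis unfolding B0_def by (intro IntI y UN_I)
  qed
  (* B0 need not be a Borel set; of its boundary only the countably many attained values matter. *)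
  define B where "B = ?S interior_of B0 \<union> (B0 \<inter> range ?E)"
  have UB: "?S interior_of B0 \<subseteq> B" "B \<subseteq> B0" using interior_of_subset[of ?S B0] by (auto simp: B_def)
  have BX: "B \<subseteq> ?X" using UB(2) by (auto simp: B0_def)
  have "countable (B0 \<inter> range ?E)" by (intro countable_Int2 countable_image) simp
  then have "B0 \<inter> range ?E \<in> sets (stacked_error_measure R N)"
    unfolding sets_stacked_error_measure by (intro countable_borel_sets_stacked) (auto simp: B0_def)
  moreover have "?S interior_of B0 \<in> sets (stacked_error_measure R N)"
    unfolding sets_stacked_error_measure borel_sets_def by (intro sigma_sets.Basic) simp
  ultimately have B: "B \<in> borel_sets ?S"
    unfolding B_def sets_stacked_error_measure[symmetric] by (intro sets.Un)
  \<comment> \<open>\<open>B\<close> lies between the relative interior of \<open>B0\<close> and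
    \<open>B0\<close> itself, so its frontier is no larger.\<close>
  have "?S frontier_of B \<subseteq> ?S frontier_of B0"
  proof -
    have "?S interior_of B0 \<subseteq> ?S interior_of B" using UB(1) by (intro interior_of_maximal) auto
    moreover have "?S closure_of B \<subseteq> ?S closure_of B0" by (rule closure_of_mono[OF UB(2)])
    ultimately show ?thesis unfolding frontier_of_def by blast
  qed
  moreover have "?S frontier_of B0 \<subseteq> euclid_topology ?I frontier_of B0"
    unfolding stacked_error_space_eq by (rule frontier_of_subtopology_le) (auto simp: B0_def)
  moreover have "euclid_topology ?I frontier_of B \<subseteq> ?S frontier_of B \<union> euclid_topology ?I frontier_of ?X"
    unfolding stacked_error_space_eq by (rule frontier_of_subset_subtopology[OF BX])
  ultimately have frB: "euclid_topology ?I frontier_of B \<subseteq> euclid_topology ?I frontier_of B0 \<union> euclid_topology ?I frontier_of ?X"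
    by blast
  have "null_frontier ?I B"
    by (rule null_frontier_subset[OF _ frB])
      (use BX nB0 nX in \<open>auto simp: null_frontier_def intro: null_sets.Un\<close>)
  then have m: "measure (stacked_error_measure R N) (?S frontier_of B) = 0"
    by (rule measure_stacked_frontier[OF BX])
  have "?E x \<in> B \<longleftrightarrow> x \<in> quasiperiodic_set ?I G (power_rows L)" for x
  proof -
    define v where "v p = power_rows L p \<bullet> real_vec x" for p
    have EX: "?E x \<in> ?X"
      by (simp add: stacked_errors_in_block_set quantizer_quantization_error[OF quantizer])
    \<comment> \<open>Applied to the single point \<open>?E x\<close>, the description of hits
      supplies an integer vector \<zeta> such that unwinding v - \<zeta> gives \<open>?E x\<close>;
      rewinding then recovers v - \<zeta>.\<close>
    have "lattice_hits ?I {y \<in> ?I \<rightarrow>\<^sub>E UNIV. shear ?I fst (unwind L) (\<lambda>_. 0) y \<in> {?E x}} v \<noteq> {}"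
      unfolding v_def using EX by (subst lattice_hits_unwind[OF quantizer]) auto
    then obtain \<zeta> where \<zeta>: "shear ?I fst (unwind L) (\<lambda>_. 0) (\<lambda>p\<in>?I. v p - real_of_int (\<zeta> p)) = ?E x"
      by (auto simp: lattice_hits_def)
    have sh: "sh z (?E x) = (\<lambda>p\<in>?I. v p - real_of_int (\<zeta> p) + real_of_int (z p))" for z
      unfolding sh_def \<zeta>[symmetric] rewind_unwind by (auto simp: restrict_def)
    have "?E x \<in> B \<longleftrightarrow> ?E x \<in> B0" using UB by (auto simp: B_def)
    also have "\<dots> \<longleftrightarrow> (\<exists>z. sh z (?E x) \<in> G)" using inB0[OF EX] by (auto simp: B0_def)
    also have "\<dots> \<longleftrightarrow> (\<exists>g\<in>G. \<exists>z. \<forall>p\<in>?I. v p = g p + real_of_int (z p))"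
    proof
      assume "\<exists>z. sh z (?E x) \<in> G"
      then obtain z where z: "sh z (?E x) \<in> G" by blast
      then show "\<exists>g\<in>G. \<exists>z. \<forall>p\<in>?I. v p = g p + real_of_int (z p)"
        by (intro bexI[OF _ z] exI[of _ "\<lambda>p. \<zeta> p - z p"]) (simp add: sh)
    next
      assume "\<exists>g\<in>G. \<exists>z. \<forall>p\<in>?I. v p = g p + real_of_int (z p)"
      then obtain g z where g: "g \<in> G" and v: "\<forall>p\<in>?I. v p = g p + real_of_int (z p)" by blast
      have "sh (\<lambda>p. \<zeta> p - z p) (?E x) = g"
        unfolding sh using v subsetD[OF GI g] by (auto simp: fun_eq_iff PiE_iff extensional_def)
      then have "sh (\<lambda>p. \<zeta> p - z p) (?E x) \<in> G" using g by (simp only:)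
      then show "\<exists>z. sh z (?E x) \<in> G" by (rule exI[where x = "\<lambda>p. \<zeta> p - z p"])
    qed
    finally show ?thesis by (simp add: quasiperiodic_set_def v_def)
  qed
  then have "?E -` B = quasiperiodic_set ?I G (power_rows L)" by auto
  with B m show thesis by (rule that)
qed

end

context
  fixes R :: "real^'n \<Rightarrow> int^'n"
  assumes quantizer: "quantizer R"
begin

private lemma error_restriction_assms:
  shows "\<And>U. openin (euclidean :: (real^'n) topology) U \<Longrightarrow> U \<in> sets lborel"
    and "space (lborel :: (real^'n) measure) = topspace euclidean"
    and "error_cell R \<subseteq> topspace euclidean"
    and "euclidean frontier_of error_cell R \<in> null_sets lebesgue"
  using quantizer_jordan[OF quantizer] by (auto simp: jordan_measurable_def negligible_iff_null_sets)

lemma error_measure_eq: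
  "error_measure R = borel_restriction (subtopology euclidean (error_cell R)) lebesgue"
  by (simp add: error_measure_def error_space_def)

lemma space_error_measure: "space (error_measure R) = topspace (error_space R)"
  unfolding error_measure_eq error_space_def
  by (rule space_borel_restriction[OF error_restriction_assms])

lemma sets_error_measure: "sets (error_measure R) = borel_sets (error_space R)"
  unfolding error_measure_eq error_space_def
  by (rule sets_borel_restriction[OF error_restriction_assms])

lemma emeasure_error_measure:
  "A \<in> borel_sets (error_space R) \<Longrightarrow> emeasure (error_measure R) A = emeasure lebesgue A"
  unfolding error_measure_eq error_space_def
  by (rule emeasure_borel_restriction[OF error_restriction_assms])

lemma jordan_measurable_error:
  assumes "A \<in> borel_sets (error_space R)"
    "measure (error_measure R) (error_space R frontier_of A) = 0"
  shows "jordan_measurable A \<and> A \<subseteq> error_cell R"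
proof -
  have X: "emeasure lebesgue (error_cell R) \<noteq> \<infinity>"
    using jordan_measurable_sets(4)[OF quantizer_jordan[OF quantizer]] by simp
  have "euclidean frontier_of A \<in> null_sets lebesgue"
    by (rule null_frontier_borel_restriction[OF error_restriction_assms X])
      (use assms in \<open>simp_all add: error_measure_eq error_space_def\<close>)
  moreover have "A \<subseteq> error_cell R"
    by (rule conjunct2[OF borel_sets_subtopology[OF error_restriction_assms]])
      (use assms in \<open>simp_all add: error_space_def\<close>)
  ultimately show ?thesis
    using quantizer_jordan[OF quantizer] bounded_subset
    by (auto simp: jordan_measurable_def negligible_iff_null_sets)
qed

section \<open>Frequencies, independence and generated algebras of the errors\<close>

context
  fixes L :: "real^'n^'n"
  assumes L: "iteratively_nonresonant L"
begin

lemma frequency_block_vimage: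
  assumes N: "0 < N" and C: "\<And>k. k \<in> {1..N} \<Longrightarrow> jordan_measurable (C k) \<and> C k \<subseteq> error_cell R"
  shows "frequency_measurable {x. \<forall>k\<in>{1..N}. quantization_error R L k x \<in> C k}"
    and "frequency {x. \<forall>k\<in>{1..N}. quantization_error R L k x \<in> C k} = (\<Prod>k\<in>{1..N}. measure lebesgue (C k))"
    and "{x. \<forall>k\<in>{1..N}. quantization_error R L k x \<in> C k} \<in> forward_algebra_upto L N"
proof -
  have vim: "{x. \<forall>k\<in>{1..N}. quantization_error R L k x \<in> C k} = stacked_errors R L N -` block_set N C"
    by (auto simp: stacked_errors_in_block_set)
  have J: "jordan_measurable_on (block_index N) (block_set N C)"
    and m: "measure (euclid_lebesgue (block_index N)) (block_set N C) = (\<Prod>k\<in>{1..N}. measure lebesgue (C k))"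
    using jordan_measurable_block_set(1,2)[OF N, of C] C by blast+
  have sub: "block_set N C \<subseteq> block_set N (\<lambda>_. error_cell R)"
    using C by (intro block_set_mono) blast
  show "frequency_measurable {x. \<forall>k\<in>{1..N}. quantization_error R L k x \<in> C k}"
    "frequency {x. \<forall>k\<in>{1..N}. quantization_error R L k x \<in> C k} = (\<Prod>k\<in>{1..N}. measure lebesgue (C k))"
    using frequency_stacked_errors[OF quantizer L J sub] unfolding vim m by auto
  show "{x. \<forall>k\<in>{1..N}. quantization_error R L k x \<in> C k} \<in> forward_algebra_upto L N"
    unfolding vim by (rule stacked_errors_vimage_in_forward_algebra[OF quantizer J sub])
qed

lemma frequency_UNIV: "frequency (UNIV :: (int^'n) set) = 1"
proof -
  have "(box_average (indicat_real (UNIV :: (int^'n) set)) \<longlongrightarrow> 1) box_filter"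
    by (simp add: tendsto_eventually eventually_box_average_const)
  then show ?thesis using frequency_indicatorI by blast
qed

lemma quantization_error_in_cell: "quantization_error R L k x \<in> error_cell R"
  by (simp add: quantizer_quantization_error[OF quantizer])

text \<open>For N = 1 the preimage of the whole cell is the whole lattice. It has frequency 1, and
  by the frequency formula this is the volume of the cell.\<close>

lemma measure_error_cell: "measure lebesgue (error_cell R) = 1"
  using frequency_block_vimage(2)[of 1 "\<lambda>_. error_cell R"] quantizer_jordan[OF quantizer]
  by (simp add: quantization_error_in_cell[simplified] frequency_UNIV)

text \<open>Indices up to \<open>Max J\<close> outside J are filled with the whole cell, which
  imposes no condition and contributes the factor 1.\<close>

lemma frequency_Int_vimage:
  assumes J: "finite J" "J \<noteq> {}" "J \<subseteq> {1..}"
    and C: "\<And>k. k \<in> J \<Longrightarrow> jordan_measurable (C k) \<and> C k \<subseteq> error_cell R"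
  shows "frequency_measurable (\<Inter>k\<in>J. quantization_error R L k -` C k)"
    and "frequency (\<Inter>k\<in>J. quantization_error R L k -` C k) = (\<Prod>k\<in>J. measure lebesgue (C k))"
    and "(\<Inter>k\<in>J. quantization_error R L k -` C k) \<in> forward_algebra_upto L (Max J)"
proof -
  define N where "N = Max J"
  have JN: "J \<subseteq> {1..N}" using J by (auto simp: N_def)
  then have N: "0 < N" using J(2) by fastforce
  define C' where "C' k = (if k \<in> J then C k else error_cell R)" for k
  have C': "jordan_measurable (C' k) \<and> C' k \<subseteq> error_cell R" for k
    using C quantizer_jordan[OF quantizer] by (simp add: C'_def)
  have eq: "(\<Inter>k\<in>J. quantization_error R L k -` C k) = {x. \<forall>k\<in>{1..N}. quantization_error R L k x \<in> C' k}"
  proof (intro set_eqI)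
    fix x
    have "(\<forall>k\<in>J. quantization_error R L k x \<in> C k) \<longleftrightarrow> (\<forall>k\<in>{1..N}. quantization_error R L k x \<in> C' k)"
      using JN quantization_error_in_cell unfolding C'_def by (smt (verit) subsetD)
    then show "x \<in> (\<Inter>k\<in>J. quantization_error R L k -` C k) \<longleftrightarrow> x \<in> {x. \<forall>k\<in>{1..N}. quantization_error R L k x \<in> C' k}"
      by simp
  qed
  have "(\<Prod>k\<in>{1..N}. measure lebesgue (C' k)) = (\<Prod>k\<in>J. measure lebesgue (C k))"
    by (rule prod.mono_neutral_cong_right) (use JN measure_error_cell in \<open>auto simp: C'_def\<close>)
  then show "frequency_measurable (\<Inter>k\<in>J. quantization_error R L k -` C k)"
    "frequency (\<Inter>k\<in>J. quantization_error R L k -` C k) = (\<Prod>k\<in>J. measure lebesgue (C k))"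
    "(\<Inter>k\<in>J. quantization_error R L k -` C k) \<in> forward_algebra_upto L (Max J)"
    unfolding eq N_def[symmetric] using frequency_block_vimage[OF N C'] by simp_all
qed

lemma distributed_map_quantization_error:
  assumes "1 \<le> k"
  shows "distributed_map (error_space R) (error_measure R) (quantization_error R L k)"
  unfolding distributed_map_def
proof (intro conjI ballI impI)
  show "metrizable_space (error_space R)"
    unfolding error_space_def by (intro metrizable_space_subtopology metrizable_space_euclidean)
  show "prob_space (error_measure R)"
  proof (rule prob_spaceI)
    have "error_cell R \<in> borel_sets (error_space R)"
      using sets.top[of "error_measure R"] by (simp add: space_error_measure sets_error_measure topspace_error_space)
    then have "emeasure (error_measure R) (error_cell R) = emeasure lebesgue (error_cell R)"
      by (rule emeasure_error_measure)
    also have "\<dots> = 1"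
      using measure_error_cell jordan_measurable_sets(4)[OF quantizer_jordan[OF quantizer]]
      by (simp add: emeasure_eq_ennreal_measure less_top)
    finally show "emeasure (error_measure R) (space (error_measure R)) = 1"
      by (simp add: space_error_measure topspace_error_space)
  qed
  show "range (quantization_error R L k) \<subseteq> topspace (error_space R)"
    using quantization_error_in_cell by (auto simp: topspace_error_space)
  fix B assume B: "B \<in> borel_sets (error_space R)" "measure (error_measure R) (error_space R frontier_of B) = 0"
  have J: "jordan_measurable B \<and> B \<subseteq> error_cell R" by (rule jordan_measurable_error[OF B])
  have "measure (error_measure R) B = measure lebesgue B"
    by (simp add: measure_def emeasure_error_measure[OF B(1)])
  then show "frequency_measurable (quantization_error R L k -` B)"
    "frequency (quantization_error R L k -` B) = measure (error_measure R) B"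
    using frequency_Int_vimage(1,2)[of "{k}" "\<lambda>_. B"] assms J by simp_all
qed (simp_all add: space_error_measure sets_error_measure)

lemma generated_algebra_quantization_error:
  assumes "1 \<le> k"
  shows "generated_algebra (error_space R) (error_measure R) (quantization_error R L k) \<subseteq> forward_algebra L"
proof
  fix A assume "A \<in> generated_algebra (error_space R) (error_measure R) (quantization_error R L k)"
  then obtain B where A: "A = quantization_error R L k -` B"
    and B: "B \<in> borel_sets (error_space R)" "measure (error_measure R) (error_space R frontier_of B) = 0"
    by (auto simp: generated_algebra_def)
  have "A \<in> forward_algebra_upto L k"
    using frequency_Int_vimage(3)[of "{k}" "\<lambda>_. B"] assms jordan_measurable_error[OF B] by (simp add: A)
  then show "A \<in> forward_algebra L" using assms by (auto simp: forward_algebra_def)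
qed

text \<open>Each event is the preimage of a Jordan set \<open>C k\<close>. One-element index sets
  identify its frequency as the volume of \<open>C k\<close>, and the intersection has the product
  of these volumes as its frequency.\<close>

lemma mutually_independent_quantization_errors:
  "mutually_independent {1..}
    (\<lambda>k. generated_algebra (error_space R) (error_measure R) (quantization_error R L k))"
  unfolding mutually_independent_def
proof (intro allI impI)
  fix J :: "nat set" and A
  assume *: "J \<subseteq> {1..} \<and> finite J \<and> J \<noteq> {} \<and>
    (\<forall>k\<in>J. A k \<in> generated_algebra (error_space R) (error_measure R) (quantization_error R L k))"
  then have "\<forall>k\<in>J. \<exists>B. A k = quantization_error R L k -` B \<and> jordan_measurable B \<and> B \<subseteq> error_cell R"
    using jordan_measurable_error unfolding generated_algebra_def by blast
  then obtain C where C: "\<And>k. k \<in> J \<Longrightarrow> A k = quantization_error R L k -` C k"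
    "\<And>k. k \<in> J \<Longrightarrow> jordan_measurable (C k) \<and> C k \<subseteq> error_cell R" by metis
  have Int: "(\<Inter>k\<in>J. A k) = (\<Inter>k\<in>J. quantization_error R L k -` C k)" using C(1) by simp
  have single: "frequency_measurable (A k) \<and> frequency (A k) = measure lebesgue (C k)" if "k \<in> J" for k
    using frequency_Int_vimage(1,2)[of "{k}" C] * C that by auto
  have "frequency_measurable (\<Inter>k\<in>J. A k)" "frequency (\<Inter>k\<in>J. A k) = (\<Prod>k\<in>J. measure lebesgue (C k))"
    unfolding Int using frequency_Int_vimage(1,2)[of J C] * C(2) by auto
  then show "(\<forall>k\<in>J. frequency_measurable (A k)) \<and> frequency_measurable (\<Inter>k\<in>J. A k) \<and>
      frequency (\<Inter>k\<in>J. A k) = (\<Prod>k\<in>J. frequency (A k))"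
    using single by simp
qed

lemma distributed_map_stacked_errors:
  assumes N: "0 < N"
  shows "distributed_map (stacked_error_space R N) (stacked_error_measure R N) (stacked_errors R L N)"
  unfolding distributed_map_def
proof (intro conjI ballI impI)
  let ?X = "block_set N (\<lambda>_. error_cell R)"
  have "countable (block_index N :: (nat \<times> 'n) set)" by (rule countable_finite[OF finite_block_index])
  then show "metrizable_space (stacked_error_space R N)"
    unfolding stacked_error_space_eq euclid_topology_def
    by (intro metrizable_space_subtopology)
      (auto simp: metrizable_space_product_topology metrizable_space_euclidean intro: countable_subset)
  show "prob_space (stacked_error_measure R N)"
  proof (rule prob_spaceI)
    have "?X \<in> borel_sets (stacked_error_space R N)"
      using sets.top[of "stacked_error_measure R N"]
      by (simp add: space_stacked_error_measure[OF quantizer N] sets_stacked_error_measure[OF quantizer N] topspace_stacked_error_space)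
    then have "emeasure (stacked_error_measure R N) ?X = emeasure (euclid_lebesgue (block_index N)) ?X"
      by (rule emeasure_stacked_error_measure[OF quantizer N])
    also have "\<dots> = 1"
      using jordan_measurable_block_set(2,3)[OF N quantizer_jordan[OF quantizer]]
      by (simp add: emeasure_eq_ennreal_measure less_top measure_error_cell)
    finally show "emeasure (stacked_error_measure R N) (space (stacked_error_measure R N)) = 1"
      by (simp add: space_stacked_error_measure[OF quantizer N] topspace_stacked_error_space)
  qed
  show "range (stacked_errors R L N) \<subseteq> topspace (stacked_error_space R N)"
    using quantization_error_in_cell by (auto simp: topspace_stacked_error_space stacked_errors_in_block_set)
  fix B assume B: "B \<in> borel_sets (stacked_error_space R N)"
    "measure (stacked_error_measure R N) (stacked_error_space R N frontier_of B) = 0"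
  have "measure (stacked_error_measure R N) B = measure (euclid_lebesgue (block_index N)) B"
    by (simp add: measure_def emeasure_stacked_error_measure[OF quantizer N B(1)])
  then show "frequency_measurable (stacked_errors R L N -` B)"
    "frequency (stacked_errors R L N -` B) = measure (stacked_error_measure R N) B"
    using frequency_stacked_errors[OF quantizer L jordan_measurable_on_stacked[OF quantizer N B]
        borel_sets_stacked_error_space[OF quantizer N B(1)]] by simp_all
qed (simp_all add: space_stacked_error_measure[OF quantizer N] sets_stacked_error_measure[OF quantizer N])

lemma generated_algebra_stacked_errors:
  assumes N: "0 < N"
  shows "generated_algebra (stacked_error_space R N) (stacked_error_measure R N) (stacked_errors R L N)
    = forward_algebra_upto L N"
proof
  show "generated_algebra (stacked_error_space R N) (stacked_error_measure R N) (stacked_errors R L N)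
      \<subseteq> forward_algebra_upto L N"
    unfolding generated_algebra_def
    using stacked_errors_vimage_in_forward_algebra[OF quantizer jordan_measurable_on_stacked[OF quantizer N]
        borel_sets_stacked_error_space[OF quantizer N]] by blast
  show "forward_algebra_upto L N
      \<subseteq> generated_algebra (stacked_error_space R N) (stacked_error_measure R N) (stacked_errors R L N)"
  proof
    fix A assume "A \<in> forward_algebra_upto L N"
    then obtain G where A: "A = quasiperiodic_set (block_index N) G (power_rows L)"
      and G: "G \<subseteq> block_index N \<rightarrow>\<^sub>E {0..<1}" "jordan_measurable_on (block_index N) G"
      unfolding forward_algebra_upto_eq quasiperiodic_algebra_def by blast
    obtain B where "B \<in> borel_sets (stacked_error_space R N)"
      "measure (stacked_error_measure R N) (stacked_error_space R N frontier_of B) = 0"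
      "stacked_errors R L N -` B = A"
      unfolding A by (rule quasiperiodic_set_vimage_stacked_errors[OF quantizer N G])
    then show "A \<in> generated_algebra (stacked_error_space R N) (stacked_error_measure R N) (stacked_errors R L N)"
      unfolding generated_algebra_def by blast
  qed
qed

end

end

theorem theorem9:
  fixes R :: "real^'n \<Rightarrow> int^'n" and L :: "real^'n^'n"
  assumes "quantizer R" and "invertible L" and "iteratively_nonresonant L"
  shows
    "mutually_independent {1..}
       (\<lambda>k. generated_algebra (error_space R) (error_measure R) (quantization_error R L k)) \<and>
     (\<forall>k\<ge>1. distributed_map (error_space R) (error_measure R) (quantization_error R L k)) \<and>
     (\<forall>k\<ge>1. generated_algebra (error_space R) (error_measure R) (quantization_error R L k)
              \<subseteq> forward_algebra L) \<and>
     (\<forall>N\<ge>1.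
        distributed_map (stacked_error_space R N) (stacked_error_measure R N)
          (stacked_errors R L N) \<and>
        generated_algebra (stacked_error_space R N) (stacked_error_measure R N)
          (stacked_errors R L N) = forward_algebra_upto L N)"
  using mutually_independent_quantization_errors[OF assms(1,3)]
    distributed_map_quantization_error[OF assms(1,3)]
    generated_algebra_quantization_error[OF assms(1,3)]
    distributed_map_stacked_errors[OF assms(1,3)]
    generated_algebra_stacked_errors[OF assms(1,3)]
  by simp

end
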